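(* Suppose $\mathcal U$ is a nondiscrete unital subring of $\mathbb R$, and $A$ and $B$ are nonnegative eventually rank one matrices which are strong shift equivalent over $\mathcal U$. Then $A$ and $B$ are strong shift equivalent over $\mathcal U_+$.
   Context: Unital nondiscrete means containing $1$ and dense in $\mathbb R$; $\mathcal U_+=\mathcal U\cap[0,\infty)$. A square matrix $A$ is eventually rank one if $\mathrm{rank}(A^k)=1$ for all large $k$; equivalently its characteristic polynomial is $t^m(t-\lambda)$ with $\lambda\ne 0$. Square matrices $A,B$ (possibly of different sizes) are strong shift equivalent (SSE) over a semiring $\mathcal S$ if there are $\ell\in\mathbb N$, square matrices $A=A_0,A_1,\dots,A_\ell=B$ and (possibly rectangular) matrices $R_i,S_i$ over $\mathcal S$ with $A_{i-1}=R_iS_i$ and $A_i=S_iR_i$ for $1\le i\le\ell$. *)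

theory Defs
  imports
    "HOL-Analysis.Elementary_Topology"
    "HOL-Algebra.Subrings"
    "Jordan_Normal_Form.DL_Rank"
begin

text \<open>The locale \<^locale>\<open>subring\<close> contains the unit of the ambient ring.\<close>

definition nondiscrete_unital_subring :: "real set \<Rightarrow> bool" where
  "nondiscrete_unital_subring U \<longleftrightarrow> subring U (class_ring :: real ring) \<and> closure U = UNIV"

definition mat_over :: "'a set \<Rightarrow> 'a mat \<Rightarrow> bool" where
  "mat_over S A \<longleftrightarrow> elements_mat A \<subseteq> S"

definition eventually_rank_one :: "real mat \<Rightarrow> bool" where
  "eventually_rank_one A \<longleftrightarrow>
     square_mat A \<and> (\<forall>\<^sub>F k in sequentially. vec_space.rank (dim_row A) (A ^\<^sub>m k) = 1)"

text \<open>
  All matrices have positive size, as usual; the library also has empty ones. That \<open>As i\<close> has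
  entries in \<open>S\<close> follows from the factorizations when \<open>l > 0\<close> and \<open>S\<close> is a semiring; it is
  stated so that a chain of length \<open>l = 0\<close> relates only matrices over \<open>S\<close>.
\<close>

definition strong_shift_equivalent_over :: "'a::semiring_0 set \<Rightarrow> 'a mat \<Rightarrow> 'a mat \<Rightarrow> bool" where
  "strong_shift_equivalent_over S A B \<longleftrightarrow>
     (\<exists>(l::nat) As Rs Ss.
        As 0 = A \<and> As l = B \<and>
        (\<forall>i\<le>l. square_mat (As i) \<and> 0 < dim_row (As i) \<and> mat_over S (As i)) \<and>
        (\<forall>i\<in>{1..l}.
           Rs i \<in> carrier_mat (dim_row (As (i - 1))) (dim_row (As i)) \<and> mat_over S (Rs i) \<and>
           Ss i \<in> carrier_mat (dim_row (As i)) (dim_row (As (i - 1))) \<and> mat_over S (Ss i) \<and>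
           As (i - 1) = Rs i * Ss i \<and> As i = Ss i * Rs i))"

end

theory Submission
  imports Defs "Jordan_Normal_Form.Jordan_Normal_Form_Existence"
begin

text \<open>
  Write \<open>X \<sim> Y\<close> if \<open>X\<close> and \<open>Y\<close> are strong shift equivalent over the nonnegative part of \<open>U\<close>.
  A positive form of a matrix \<open>A\<close> over \<open>U\<close> is a matrix \<open>g' * A * g\<close> with positive entries, where
  \<open>g\<close> and \<open>g'\<close> are mutually inverse over \<open>U\<close>. If the high powers of \<open>A\<close> have rank one and the nonzero
  eigenvalue of \<open>A\<close> is positive, then \<open>A\<close> has positive forms, any two of them are related by \<open>\<sim>\<close>, and
  their class does not change if \<open>A\<close> is replaced by a matrix that is strong shift equivalent to it
  over \<open>U\<close>. As every nonnegative such \<open>A\<close> is related by \<open>\<sim>\<close> to some positive matrix, the theorem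
  follows.

  That two positive forms are equivalent is the heart of the matter. Think of \<open>A\<close> as an endomorphism and of
  \<open>g\<close> as a basis over \<open>U\<close> that spans a cone. Suppose that the basis \<open>c\<close> lies in this cone, that the
  basis \<open>d\<close> of covectors lies in the dual cone, and that \<open>A\<close> is a nonnegative combination of the
  tensors of \<open>c\<close> with \<open>d\<close>, with coefficient matrix \<open>Z = c' * A * d'\<close>. Then
  \<open>g' * A * g = x * Z * y\<close> with \<open>x = g' * c\<close> and \<open>y = d * g\<close> nonnegative, so that
  \<open>g' * A * g \<sim> Z * y * x = Z * d * c\<close>, where \<open>g\<close> no longer occurs (\<open>common_refinement\<close>). Hence
  cones that admit the same \<open>c\<close> and \<open>d\<close> give equivalent forms. The conditions on \<open>c\<close> and \<open>d\<close> are
  strict inequalities, and up to positive rescaling of the basis vectors every real basis is a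
  limit of bases over \<open>U\<close> (\<open>GL_limit_dense\<close>); so it suffices to find \<open>c\<close> and \<open>d\<close> over the reals.
  In this way a class is attached to a real cone, and it does not change under small motions of the
  cone (\<open>represents_linked\<close>).

  Here the assumption on the rank enters. The Jordan form yields \<open>A = B + N\<close> with \<open>B\<close> of rank one,
  and a one-parameter group \<open>T\<close> with \<open>T s * A * T (- s) = B + exp (- s) \<cdot>\<^sub>m N\<close>. If \<open>A\<close> and \<open>B\<close> are
  positive in a basis, so are all \<open>B + u \<cdot>\<^sub>m N\<close> with \<open>u\<close> between 0 and 1, and the cone of the basis
  may be moved by \<open>T (- s)\<close> from \<open>s = 0\<close> to any large \<open>s\<close> in steps of a fixed small length
  (\<open>represents_moved\<close>). For large \<open>s\<close> the nilpotent part is negligible. Two cones moved that far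
  can be compared through one narrow cone around the Perron eigenvector (\<open>conj_positive_core\<close>).

  For the invariance along \<open>A = R * S\<close>, \<open>B = S * R\<close>, the zero extensions with block rows
  \<open>(A, 0), (S, 0)\<close> and \<open>(0, 0), (S, B)\<close> are conjugate by a shear, and a zero extension of a positive
  matrix has a positive form that is equivalent to this matrix (\<open>zero_extension_below\<close>,
  \<open>zero_extension_left\<close>). For a nonnegative matrix, deleting zero rows and columns leaves a matrix
  with a positive power; its trace is the positive eigenvalue, so it has a positive diagonal entry,
  from which state splittings and row additions spread positivity to all entries
  (\<open>sse_to_positive\<close>).
\<close>

section \<open>Strong shift equivalence as a chain of elementary steps\<close>

definition semiring_set :: "'a::semiring_0 set \<Rightarrow> bool" where
  "semiring_set S \<longleftrightarrow> 0 \<in> S \<and> (\<forall>a\<in>S. \<forall>b\<in>S. a + b \<in> S \<and> a * b \<in> S)"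

lemma mat_over_iff:
  "A \<in> carrier_mat n m \<Longrightarrow> mat_over S A \<longleftrightarrow> (\<forall>i<n. \<forall>j<m. A $$ (i,j) \<in> S)"
  unfolding mat_over_def elements_mat_def by (fastforce simp: image_iff)

lemma semiring_set_sum:
  "semiring_set S \<Longrightarrow> (\<And>i. i \<in> I \<Longrightarrow> f i \<in> S) \<Longrightarrow> sum f I \<in> S"
  by (induction I rule: infinite_finite_induct) (auto simp: semiring_set_def)

lemma index_mult_sum:
  "A \<in> carrier_mat n m \<Longrightarrow> B \<in> carrier_mat m k \<Longrightarrow> i < n \<Longrightarrow> j < k \<Longrightarrow>
    (A * B) $$ (i,j) = (\<Sum>l<m. A $$ (i,l) * B $$ (l,j))"
  by (auto simp: scalar_prod_def lessThan_atLeast0 intro!: sum.cong)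

lemma mat_over_mult:
  assumes "semiring_set S" "A \<in> carrier_mat n m" "B \<in> carrier_mat m k"
    and "mat_over S A" "mat_over S B"
  shows "mat_over S (A * B)"
proof -
  have "(\<Sum>l<m. A $$ (i,l) * B $$ (l,j)) \<in> S" if "i < n" "j < k" for i j
    using assms that by (intro semiring_set_sum) (auto simp: mat_over_iff semiring_set_def)
  then show ?thesis using assms(2,3)
    by (subst mat_over_iff[of _ n k]) (auto simp: index_mult_sum simp del: index_mult_mat)
qed

lemma mat_over_mono: "mat_over S A \<Longrightarrow> S \<subseteq> T \<Longrightarrow> mat_over T A"
  unfolding mat_over_def by auto

definition elementary_sse :: "'a::semiring_0 set \<Rightarrow> 'a mat \<Rightarrow> 'a mat \<Rightarrow> bool" where
  "elementary_sse S A B \<longleftrightarrow>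
     (\<exists>n m R T. 0 < n \<and> 0 < m \<and> R \<in> carrier_mat n m \<and> T \<in> carrier_mat m n \<and>
        mat_over S R \<and> mat_over S T \<and> A = R * T \<and> B = T * R)"

abbreviation sse :: "'a::semiring_0 set \<Rightarrow> 'a mat \<Rightarrow> 'a mat \<Rightarrow> bool" where
  "sse S \<equiv> (elementary_sse S)\<^sup>*\<^sup>*"

lemma elementary_sseI:
  "R \<in> carrier_mat n m \<Longrightarrow> T \<in> carrier_mat m n \<Longrightarrow> 0 < n \<Longrightarrow> 0 < m \<Longrightarrow>
    mat_over S R \<Longrightarrow> mat_over S T \<Longrightarrow> A = R * T \<Longrightarrow> B = T * R \<Longrightarrow> elementary_sse S A B"
  unfolding elementary_sse_def by blast

lemma elementary_sse_sym: "elementary_sse S A B \<Longrightarrow> elementary_sse S B A"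
  unfolding elementary_sse_def by blast

lemma sse_sym: "sse S A B \<Longrightarrow> sse S B A"
  by (metis elementary_sse_sym symp_def symp_rtranclp)

lemma sse_trans: "sse S A B \<Longrightarrow> sse S B C \<Longrightarrow> sse S A C"
  by (rule rtranclp_trans)

lemma sse_of_strong_shift_equivalent_over:
  assumes "strong_shift_equivalent_over S A B"
  shows "sse S A B"
proof -
  obtain l As Rs Ss where c: "As (0::nat) = A" "As l = B"
    "\<forall>i\<le>l. square_mat (As i) \<and> 0 < dim_row (As i) \<and> mat_over S (As i)"
    "\<forall>i\<in>{1..l}.
           Rs i \<in> carrier_mat (dim_row (As (i - 1))) (dim_row (As i)) \<and> mat_over S (Rs i) \<and>
           Ss i \<in> carrier_mat (dim_row (As i)) (dim_row (As (i - 1))) \<and> mat_over S (Ss i) \<and>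
           As (i - 1) = Rs i * Ss i \<and> As i = Ss i * Rs i"
    using assms unfolding strong_shift_equivalent_over_def by blast
  have "i \<le> l \<Longrightarrow> sse S (As 0) (As i)" for i
  proof (induction i)
    case (Suc i)
    have "elementary_sse S (As i) (As (Suc i))"
      using c(3)[rule_format, of i] c(3)[rule_format, of "Suc i"] c(4)[rule_format, of "Suc i"] Suc.prems
      by (intro elementary_sseI[of "Rs (Suc i)" "dim_row (As i)" "dim_row (As (Suc i))" "Ss (Suc i)"]) auto
    with Suc show ?case by (simp add: rtranclp.rtrancl_into_rtrancl)
  qed simp
  then show ?thesis using c(1,2) by blast
qed

lemma strong_shift_equivalent_over_of_sse:
  assumes "sse S A B" "semiring_set S" "A \<in> carrier_mat n n" "0 < n" "mat_over S A"
  shows "strong_shift_equivalent_over S A B"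
  using assms(1)
proof (induction rule: rtranclp_induct)
  case base
  show ?case unfolding strong_shift_equivalent_over_def
    using assms by (intro exI[of _ 0] exI[of _ "\<lambda>_. A"]) auto
next
  case (step B C)
  obtain l As Rs Ss where c: "As (0::nat) = A" "As l = B"
    "\<forall>i\<le>l. square_mat (As i) \<and> 0 < dim_row (As i) \<and> mat_over S (As i)"
    "\<forall>i\<in>{1..l}.
           Rs i \<in> carrier_mat (dim_row (As (i - 1))) (dim_row (As i)) \<and> mat_over S (Rs i) \<and>
           Ss i \<in> carrier_mat (dim_row (As i)) (dim_row (As (i - 1))) \<and> mat_over S (Ss i) \<and>
           As (i - 1) = Rs i * Ss i \<and> As i = Ss i * Rs i"
    using step.IH unfolding strong_shift_equivalent_over_def by blast
  obtain p q R T where e: "0 < p" "0 < q" "R \<in> carrier_mat p q" "T \<in> carrier_mat q p"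
     "mat_over S R" "mat_over S T" "B = R * T" "C = T * R"
    using step.hyps unfolding elementary_sse_def by blast
  have C: "square_mat C" "0 < dim_row C" "mat_over S C"
    using e assms(2) by (auto intro!: mat_over_mult)
  have d: "dim_row B = p" "dim_row C = q" using e by auto
  define As' Rs' Ss' where "As' = As(Suc l := C)" and "Rs' = Rs(Suc l := R)" and "Ss' = Ss(Suc l := T)"
  have old: "As' i = As i" "Rs' i = Rs i" "Ss' i = Ss i" if "i \<le> l" for i
    using that by (auto simp: As'_def Rs'_def Ss'_def)
  have new: "As' (Suc l) = C" "Rs' (Suc l) = R" "Ss' (Suc l) = T"
    by (auto simp: As'_def Rs'_def Ss'_def)
  have "square_mat (As' i) \<and> 0 < dim_row (As' i) \<and> mat_over S (As' i)" if "i \<le> Suc l" for i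
    using that c(3) old(1) new(1) C by (cases "i = Suc l") auto
  moreover have "Rs' i \<in> carrier_mat (dim_row (As' (i - 1))) (dim_row (As' i)) \<and> mat_over S (Rs' i) \<and>
           Ss' i \<in> carrier_mat (dim_row (As' i)) (dim_row (As' (i - 1))) \<and> mat_over S (Ss' i) \<and>
           As' (i - 1) = Rs' i * Ss' i \<and> As' i = Ss' i * Rs' i" if "i \<in> {1..Suc l}" for i
  proof (cases "i = Suc l")
    case True
    have "As' (i - 1) = B" "As' i = C" "Rs' i = R" "Ss' i = T" using True c(2) old new by auto
    then show ?thesis using e d by auto
  next
    case False
    then have i: "i \<in> {1..l}" using that by auto
    have eqs: "As' (i - 1) = As (i - 1)" "As' i = As i" "Rs' i = Rs i" "Ss' i = Ss i" using i old by auto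
    show ?thesis unfolding eqs using c(4) i by blast
  qed
  moreover have "As' 0 = A" "As' (Suc l) = C" using c(1) old new by auto
  ultimately show ?case unfolding strong_shift_equivalent_over_def by blast
qed

section \<open>Positivity, limits and inverses of real matrices\<close>

definition pos_mat :: "real mat \<Rightarrow> bool" where
  "pos_mat M \<longleftrightarrow> (\<forall>i<dim_row M. \<forall>j<dim_col M. 0 < M $$ (i,j))"

lemma pos_matD: "pos_mat M \<Longrightarrow> M \<in> carrier_mat n m \<Longrightarrow> i < n \<Longrightarrow> j < m \<Longrightarrow> 0 < M $$ (i,j)"
  unfolding pos_mat_def by auto

lemma pos_matI:
  "M \<in> carrier_mat n m \<Longrightarrow> (\<And>i j. i < n \<Longrightarrow> j < m \<Longrightarrow> 0 < M $$ (i,j)) \<Longrightarrow> pos_mat M"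
  unfolding pos_mat_def by auto

lemma pos_mat_mult:
  assumes "A \<in> carrier_mat n m" "B \<in> carrier_mat m k" "0 < m" "pos_mat A" "pos_mat B"
  shows "pos_mat (A * B)"
proof (rule pos_matI)
  fix i j assume ij: "i < n" "j < k"
  have "0 < (\<Sum>l<m. A $$ (i,l) * B $$ (l,j))"
    using assms ij by (intro sum_pos) (auto intro!: mult_pos_pos simp: pos_mat_def)
  then show "0 < (A * B) $$ (i,j)" using assms ij by (simp only: index_mult_sum)
qed (use assms in auto)

lemma pos_mat_add:
  "A \<in> carrier_mat n m \<Longrightarrow> B \<in> carrier_mat n m \<Longrightarrow> pos_mat A \<Longrightarrow> pos_mat B \<Longrightarrow> pos_mat (A + B)"
  unfolding pos_mat_def by (auto intro: add_pos_pos)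

lemma pos_mat_smult: "0 < c \<Longrightarrow> pos_mat A \<Longrightarrow> pos_mat (c \<cdot>\<^sub>m A)"
  unfolding pos_mat_def by auto

lemma pos_mat_pow: 
  assumes "A \<in> carrier_mat n n" "0 < n" "pos_mat A"
  shows "pos_mat (A ^\<^sub>m (Suc k))"
proof (induction k)
  case 0
  then show ?case using assms by auto
next
  case (Suc k)
  show ?case unfolding pow_mat.simps(2)[of A "Suc k"]
    by (rule pos_mat_mult[of _ n n]) (use assms Suc in auto)
qed

lemma pos_mat_diag_left:
  "A \<in> carrier_mat n m \<Longrightarrow> (\<And>i. i < n \<Longrightarrow> 0 < e i) \<Longrightarrow> pos_mat A \<Longrightarrow> pos_mat (mat_diag n e * A)"
  unfolding pos_mat_def by (auto simp: mat_diag_mult_left[of _ n m])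

lemma pos_mat_diag_right:
  "A \<in> carrier_mat n m \<Longrightarrow> (\<And>i. i < m \<Longrightarrow> 0 < e i) \<Longrightarrow> pos_mat A \<Longrightarrow> pos_mat (A * mat_diag m e)"
  unfolding pos_mat_def by (auto simp: mat_diag_mult_right[of _ n m])

text \<open>
  Entrywise convergence. The dimension is required at every index, so that limits of products
  need no side conditions.
\<close>

definition mat_tendsto :: "('b \<Rightarrow> real mat) \<Rightarrow> real mat \<Rightarrow> 'b filter \<Rightarrow> bool" where
  "mat_tendsto f M F \<longleftrightarrow> (\<forall>x. f x \<in> carrier_mat (dim_row M) (dim_col M)) \<and>
     (\<forall>i<dim_row M. \<forall>j<dim_col M. ((\<lambda>x. f x $$ (i,j)) \<longlongrightarrow> M $$ (i,j)) F)"

lemma mat_tendstoI: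
  "M \<in> carrier_mat n m \<Longrightarrow> (\<And>x. f x \<in> carrier_mat n m) \<Longrightarrow>
   (\<And>i j. i < n \<Longrightarrow> j < m \<Longrightarrow> ((\<lambda>x. f x $$ (i,j)) \<longlongrightarrow> M $$ (i,j)) F) \<Longrightarrow> mat_tendsto f M F"
  unfolding mat_tendsto_def by auto

lemma mat_tendsto_const [intro]: "mat_tendsto (\<lambda>_. M) M F"
  unfolding mat_tendsto_def by auto

lemma mat_tendsto_carrier: "mat_tendsto f M F \<Longrightarrow> M \<in> carrier_mat n m \<Longrightarrow> f x \<in> carrier_mat n m"
  unfolding mat_tendsto_def by auto

lemma mat_tendsto_mult:
  assumes "mat_tendsto f A F" "mat_tendsto g B F"
    and A: "A \<in> carrier_mat n m" and B: "B \<in> carrier_mat m k"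
  shows "mat_tendsto (\<lambda>x. f x * g x) (A * B) F"
proof (rule mat_tendstoI)
  have f: "f x \<in> carrier_mat n m" and g: "g x \<in> carrier_mat m k" for x
    using mat_tendsto_carrier[OF assms(1,3)] mat_tendsto_carrier[OF assms(2,4)] by auto
  show "f x * g x \<in> carrier_mat n k" for x using f[of x] g[of x] by (rule mult_carrier_mat)
  fix i j assume ij: "i < n" "j < k"
  show "((\<lambda>x. (f x * g x) $$ (i, j)) \<longlongrightarrow> (A * B) $$ (i, j)) F"
    unfolding index_mult_sum[OF f g ij] index_mult_sum[OF A B ij]
    using assms ij unfolding mat_tendsto_def by (intro tendsto_sum tendsto_mult) auto
qed (use A B in auto)

lemma eventually_pos_mat:
  assumes "mat_tendsto f M F" "pos_mat M"
  shows "\<forall>\<^sub>F x in F. pos_mat (f x)"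
proof -
  have d: "dim_row (f x) = dim_row M" "dim_col (f x) = dim_col M" for x
    using assms unfolding mat_tendsto_def by auto
  have "\<forall>\<^sub>F x in F. \<forall>i\<in>{..<dim_row M}. \<forall>j\<in>{..<dim_col M}. 0 < f x $$ (i,j)"
    using assms unfolding mat_tendsto_def pos_mat_def
    by (intro eventually_ball_finite ballI order_tendstoD(1)) auto
  then show ?thesis by eventually_elim (auto simp: pos_mat_def d)
qed

text \<open>
  Carrying the inverse along makes limits and conjugations symmetric in a matrix and its inverse,
  without a continuity argument for inversion.
\<close>

definition inv_pair :: "nat \<Rightarrow> 'a::semiring_1 mat \<Rightarrow> 'a mat \<Rightarrow> bool" where
  "inv_pair n g g' \<longleftrightarrow> g \<in> carrier_mat n n \<and> g' \<in> carrier_mat n n \<and> g * g' = 1\<^sub>m n \<and> g' * g = 1\<^sub>m n"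

lemma inv_pair_carrier:
  assumes "inv_pair n g g'"
  shows "g \<in> carrier_mat n n" "g' \<in> carrier_mat n n"
  using assms unfolding inv_pair_def by auto

lemma inv_pair_sym: "inv_pair n g g' \<Longrightarrow> inv_pair n g' g"
  unfolding inv_pair_def by auto

lemma inv_pair_one: "inv_pair n (1\<^sub>m n) (1\<^sub>m n)"
  unfolding inv_pair_def by auto

lemma inv_pair_cancel:
  assumes "inv_pair n g g'" and "X \<in> carrier_mat n k"
  shows "g * (g' * X) = X" "g' * (g * X) = X"
proof -
  have c: "g \<in> carrier_mat n n" "g' \<in> carrier_mat n n" "g * g' = 1\<^sub>m n" "g' * g = 1\<^sub>m n"
    using assms unfolding inv_pair_def by auto
  show "g * (g' * X) = X" "g' * (g * X) = X"
    using assoc_mult_mat[OF c(1,2) assms(2)] assoc_mult_mat[OF c(2,1) assms(2)] c assms(2) by auto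
qed

lemma inv_pair_cancel_right:
  assumes "inv_pair n g g'" and "X \<in> carrier_mat k n"
  shows "X * g * g' = X" "X * g' * g = X"
proof -
  have c: "g \<in> carrier_mat n n" "g' \<in> carrier_mat n n" "g * g' = 1\<^sub>m n" "g' * g = 1\<^sub>m n"
    using assms unfolding inv_pair_def by auto
  show "X * g * g' = X" "X * g' * g = X"
    using assoc_mult_mat[OF assms(2) c(1,2)] assoc_mult_mat[OF assms(2) c(2,1)] c assms(2) by auto
qed

lemma inv_pair_mult:
  assumes g: "inv_pair n g g'" and h: "inv_pair n h h'"
  shows "inv_pair n (g * h) (h' * g')"
proof -
  note c = inv_pair_carrier[OF g] inv_pair_carrier[OF h]
  have "g * h * (h' * g') = g * (h * (h' * g'))" "h' * g' * (g * h) = h' * (g' * (g * h))"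
    using c by (auto simp: assoc_mult_mat[of _ n n _ n _ n])
  then have "g * h * (h' * g') = 1\<^sub>m n" "h' * g' * (g * h) = 1\<^sub>m n"
    using inv_pair_cancel[OF g c(3)] inv_pair_cancel[OF h c(2)] g h
    unfolding inv_pair_def by auto
  then show ?thesis using c unfolding inv_pair_def by auto
qed

lemma mat_diag_eqI: "(\<And>i. i < n \<Longrightarrow> f i = g i) \<Longrightarrow> mat_diag n f = mat_diag n g"
  unfolding mat_diag_def by (intro cong_mat) auto

lemma mat_diag_eq_one: "(\<And>i. i < n \<Longrightarrow> f i = 1) \<Longrightarrow> mat_diag n f = 1\<^sub>m n"
  unfolding mat_diag_def one_mat_def by (intro cong_mat) auto

text \<open>
  Left multiplication adds multiples of row \<open>k\<close> to the other rows, right multiplication adds a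
  combination of the columns to column \<open>k\<close>. With \<open>x k = 0\<close> the inverse has the same shape, so that no
  division occurs and such a matrix over a ring is invertible over this ring.
\<close>

definition colop :: "nat \<Rightarrow> nat \<Rightarrow> (nat \<Rightarrow> 'a) \<Rightarrow> 'a::comm_ring_1 mat" where
  "colop n k x = mat n n (\<lambda>(i,j). (if i = j then 1 else 0) + (if j = k then x i else 0))"

lemma colop_carrier [simp]: "colop n k x \<in> carrier_mat n n"
  unfolding colop_def by auto

lemma colop_mult:
  assumes "M \<in> carrier_mat n m" "k < n" "i < n" "j < m"
  shows "(colop n k x * M) $$ (i,j) = M $$ (i,j) + x i * M $$ (k,j)"
proof -
  have "(colop n k x * M) $$ (i,j) = (\<Sum>l<n. colop n k x $$ (i,l) * M $$ (l,j))"
    using assms by (intro index_mult_sum[of _ n n _ m]) auto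
  also have "\<dots> = (\<Sum>l<n. (if l = i then M $$ (l,j) else 0) + (if l = k then x i * M $$ (l,j) else 0))"
    using assms by (intro sum.cong) (auto simp: colop_def algebra_simps)
  finally show ?thesis using assms by (simp add: sum.distrib)
qed

lemma mult_colop:
  assumes "M \<in> carrier_mat m n" "k < n" "i < m" "j < n"
  shows "(M * colop n k x) $$ (i,j) = M $$ (i,j) + (if j = k then \<Sum>l<n. M $$ (i,l) * x l else 0)"
proof -
  have "(M * colop n k x) $$ (i,j) = (\<Sum>l<n. M $$ (i,l) * colop n k x $$ (l,j))"
    using assms by (intro index_mult_sum[of _ m n _ n]) auto
  also have "\<dots> = (\<Sum>l<n. (if l = j then M $$ (i,l) else 0) + (if j = k then M $$ (i,l) * x l else 0))"
    using assms by (intro sum.cong) (auto simp: colop_def algebra_simps)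
  finally show ?thesis using assms by (simp add: sum.distrib)
qed

lemma colop_inv:
  assumes "k < n" "x k = 0"
  shows "inv_pair n (colop n k x) (colop n k (\<lambda>i. - x i))"
proof -
  have "colop n k x * colop n k (\<lambda>i. - x i) = 1\<^sub>m n" if "x k = 0" for x :: "nat \<Rightarrow> 'a"
  proof (rule eq_matI)
    fix i j assume "i < dim_row (1\<^sub>m n :: 'a mat)" "j < dim_col (1\<^sub>m n :: 'a mat)"
    then have ij: "i < n" "j < n" by auto
    show "(colop n k x * colop n k (\<lambda>i. - x i)) $$ (i,j) = 1\<^sub>m n $$ (i,j)"
      using colop_mult[of "colop n k (\<lambda>i. - x i)" n n k i j x] ij assms(1) that
      by (auto simp: colop_def)
  qed (auto simp: colop_def)
  from this[of x] this[of "\<lambda>i. - x i"] assms show ?thesis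
    unfolding inv_pair_def by auto
qed

section \<open>Matrices over a dense subring of the reals\<close>

locale dense_ring =
  fixes U :: "real set"
  assumes nondiscrete: "nondiscrete_unital_subring U"
begin

lemma U_subring: "subring U (class_ring :: real ring)"
  using nondiscrete unfolding nondiscrete_unital_subring_def by auto

lemma U_closed [simp, intro]:
  "0 \<in> U" "1 \<in> U" "a \<in> U \<Longrightarrow> b \<in> U \<Longrightarrow> a + b \<in> U" "a \<in> U \<Longrightarrow> b \<in> U \<Longrightarrow> a * b \<in> U"
  "a \<in> U \<Longrightarrow> - a \<in> U" "a \<in> U \<Longrightarrow> b \<in> U \<Longrightarrow> a - b \<in> U"
proof -
  note [simp] = class_ring_simps
  show p: "0 \<in> U" "1 \<in> U" "a \<in> U \<Longrightarrow> b \<in> U \<Longrightarrow> a + b \<in> U" "a \<in> U \<Longrightarrow> b \<in> U \<Longrightarrow> a * b \<in> U" for a b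
    using subringE(2,3,6,7)[OF U_subring] by auto
  have m: "- a \<in> U" if "a \<in> U" for a
  proof -
    have "\<ominus>\<^bsub>class_ring\<^esub> a = - a"
      by (rule abelian_group.minus_equality) 
         (auto intro!: ring.is_abelian_group field.is_ring class_field)
    then show ?thesis using subringE(5)[OF U_subring that] by simp
  qed
  show "a \<in> U \<Longrightarrow> - a \<in> U" by (rule m)
  show "a \<in> U \<Longrightarrow> b \<in> U \<Longrightarrow> a - b \<in> U" using p(3)[of a "- b"] m[of b] by simp
qed

abbreviation "Uplus \<equiv> U \<inter> {0..}"

lemma semiring_U: "semiring_set U" and semiring_Uplus: "semiring_set Uplus"
  unfolding semiring_set_def by auto

lemma U_limit: "\<exists>f. (\<forall>k. f k \<in> U) \<and> f \<longlonglongrightarrow> (x::real)"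
  using nondiscrete closure_sequential[of x U] unfolding nondiscrete_unital_subring_def by auto

lemma U_between:
  assumes "a < (b::real)" shows "\<exists>u\<in>U. a < u \<and> u < b"
proof -
  obtain f where f: "\<And>k. f k \<in> U" "f \<longlonglongrightarrow> (a + b) / 2" using U_limit by blast
  have "\<forall>\<^sub>F k in sequentially. a < f k" "\<forall>\<^sub>F k in sequentially. f k < b"
    using f(2) assms by (auto intro: order_tendstoD)
  then have "\<forall>\<^sub>F k in sequentially. a < f k \<and> f k < b" by (rule eventually_conj)
  then show ?thesis using f(1) eventually_happens'[OF sequentially_bot] by blast
qed

lemmas over_mult = mat_over_mult[OF semiring_U] and over_mult_Uplus = mat_over_mult[OF semiring_Uplus]

lemma over_one: "mat_over U (1\<^sub>m n)" and over_zero: "mat_over U (0\<^sub>m n m)"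
  by (auto simp: mat_over_iff[of _ n n] mat_over_iff[of _ n m])

lemma over_add: "A \<in> carrier_mat n m \<Longrightarrow> B \<in> carrier_mat n m \<Longrightarrow> mat_over U A \<Longrightarrow> mat_over U B \<Longrightarrow> mat_over U (A + B)"
  by (auto simp: mat_over_iff[of _ n m])

lemma over_minus: "A \<in> carrier_mat n m \<Longrightarrow> B \<in> carrier_mat n m \<Longrightarrow> mat_over U A \<Longrightarrow> mat_over U B \<Longrightarrow> mat_over U (A - B)"
  by (subst mat_over_iff[of _ n m]) (auto simp: mat_over_iff[of _ n m])

lemma over_Uplus: "mat_over Uplus A \<Longrightarrow> mat_over U A"
  by (rule mat_over_mono) auto

lemma over_Uplus_of_pos: "mat_over U A \<Longrightarrow> pos_mat A \<Longrightarrow> mat_over Uplus A"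
  using mat_over_iff[of A "dim_row A" "dim_col A"] unfolding pos_mat_def by force

lemma over_four_block:
  assumes "A \<in> carrier_mat n m" "B \<in> carrier_mat n l" "C \<in> carrier_mat k m" "D \<in> carrier_mat k l"
    "mat_over S A" "mat_over S B" "mat_over S C" "mat_over S D"
  shows "mat_over S (four_block_mat A B C D)"
  using subset_trans[OF elements_four_block_mat[OF assms(1-4)]] assms(5-8)
  unfolding mat_over_def by simp

definition U_inv :: "nat \<Rightarrow> real mat \<Rightarrow> real mat \<Rightarrow> bool" where
  "U_inv n g g' \<longleftrightarrow> inv_pair n g g' \<and> mat_over U g \<and> mat_over U g'"

lemma U_invD: "U_inv n g g' \<Longrightarrow> inv_pair n g g'" "U_inv n g g' \<Longrightarrow> mat_over U g" "U_inv n g g' \<Longrightarrow> mat_over U g'"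
  unfolding U_inv_def by auto

lemma U_inv_carrier:
  assumes "U_inv n g g'"
  shows "g \<in> carrier_mat n n" "g' \<in> carrier_mat n n"
  using inv_pair_carrier[OF U_invD(1)[OF assms]] by auto

lemma U_inv_sym: "U_inv n g g' \<Longrightarrow> U_inv n g' g"
  unfolding U_inv_def using inv_pair_sym by auto

lemma U_inv_one: "U_inv n (1\<^sub>m n) (1\<^sub>m n)"
  unfolding U_inv_def using inv_pair_one over_one by auto

lemma U_inv_mult: "U_inv n g g' \<Longrightarrow> U_inv n h h' \<Longrightarrow> U_inv n (g * h) (h' * g')"
  unfolding U_inv_def using inv_pair_mult[of n g g' h h'] inv_pair_carrier over_mult by metis

lemma colop_over: "(\<And>i. i < n \<Longrightarrow> x i \<in> U) \<Longrightarrow> mat_over U (colop n k x)"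
  by (subst mat_over_iff[of _ n n]) (auto simp: colop_def)

section \<open>Real bases as limits of bases over the subring\<close>

definition GL_limit :: "nat \<Rightarrow> real mat \<Rightarrow> real mat \<Rightarrow> bool" where
  "GL_limit n h h' \<longleftrightarrow> inv_pair n h h' \<and> (\<exists>c c'. (\<forall>k. U_inv n (c k) (c' k)) \<and>
     mat_tendsto c h sequentially \<and> mat_tendsto c' h' sequentially)"

lemma GL_limitI:
  "inv_pair n h h' \<Longrightarrow> (\<And>k. U_inv n (c k) (c' k)) \<Longrightarrow> mat_tendsto c h sequentially \<Longrightarrow>
    mat_tendsto c' h' sequentially \<Longrightarrow> GL_limit n h h'"
  unfolding GL_limit_def by blast

lemma GL_limit_of_U_inv: "U_inv n g g' \<Longrightarrow> GL_limit n g g'"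
  unfolding GL_limit_def using U_invD
  by (intro conjI exI[of _ "\<lambda>_. g"] exI[of _ "\<lambda>_. g'"]) auto

lemma GL_limit_sym: "GL_limit n g g' \<Longrightarrow> GL_limit n g' g"
  unfolding GL_limit_def using U_inv_sym inv_pair_sym by metis

lemma GL_limit_mult:
  assumes "GL_limit n g g'" "GL_limit n h h'"
  shows "GL_limit n (g * h) (h' * g')"
proof -
  obtain a a' b b' where a: "\<And>k. U_inv n (a k) (a' k)" "mat_tendsto a g sequentially" "mat_tendsto a' g' sequentially"
     and b: "\<And>k. U_inv n (b k) (b' k)" "mat_tendsto b h sequentially" "mat_tendsto b' h' sequentially"
     and i: "inv_pair n g g'" "inv_pair n h h'"
    using assms unfolding GL_limit_def by blast
  note c = inv_pair_carrier[OF i(1)] inv_pair_carrier[OF i(2)]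
  show ?thesis unfolding GL_limit_def
    using mat_tendsto_mult[OF a(2) b(2) c(1,3)] mat_tendsto_mult[OF b(3) a(3) c(4,2)]
      U_inv_mult[OF a(1) b(1)] inv_pair_mult[OF i]
    by (intro conjI exI[of _ "\<lambda>k. a k * b k"] exI[of _ "\<lambda>k. b' k * a' k"]) auto
qed

lemma GL_limit_colop:
  assumes "k < n" "x k = 0"
  shows "GL_limit n (colop n k x) (colop n k (\<lambda>i. - x i))"
proof -
  have "\<exists>f. \<forall>i. (\<forall>m. f i m \<in> U) \<and> f i \<longlonglongrightarrow> x i" by (rule choice) (use U_limit in auto)
  then obtain f where f: "\<And>i m. f i m \<in> U" "\<And>i. f i \<longlonglongrightarrow> x i" by auto
  define y where "y m i = (if i = k then 0 else f i m)" for m i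
  have y: "y m i \<in> U" "y m k = 0" "(\<lambda>m. y m i) \<longlonglongrightarrow> x i" for m i
    using f assms(2) by (cases "i = k"; auto simp: y_def)+
  have "U_inv n (colop n k (y m)) (colop n k (\<lambda>i. - y m i))" for m
    unfolding U_inv_def using y colop_inv[OF assms(1), of "y m"] colop_over[of n "y m"]
      colop_over[of n "\<lambda>i. - y m i"] by auto
  moreover have "mat_tendsto (\<lambda>m. colop n k (y m)) (colop n k x) sequentially"
    by (rule mat_tendstoI[of _ n n]) (auto simp: colop_def intro!: y tendsto_add)
  moreover have "mat_tendsto (\<lambda>m. colop n k (\<lambda>i. - y m i)) (colop n k (\<lambda>i. - x i)) sequentially"
    by (rule mat_tendstoI[of _ n n]) (auto simp: colop_def intro!: y tendsto_diff tendsto_minus)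
  ultimately show ?thesis using colop_inv[of k n x] assms
    by (intro GL_limitI[of _ _ _ "\<lambda>m. colop n k (y m)" "\<lambda>m. colop n k (\<lambda>i. - y m i)"]) auto
qed

text \<open>
  Gaussian elimination by row additions alone: since those are limits of matrices over \<open>U\<close> with
  an inverse over \<open>U\<close>, the real pivots may be used although \<open>U\<close> need not contain their inverses.
\<close>

lemma GL_limit_elimination:
  assumes M: "inv_pair n M M'" and "k \<le> n"
  shows "\<exists>g g'. GL_limit n g g' \<and> (\<forall>i<n. \<forall>j<k. i \<noteq> j \<longrightarrow> (g * M) $$ (i,j) = 0)"
  using \<open>k \<le> n\<close>
proof (induction k)
  case 0
  show ?case using GL_limit_of_U_inv[OF U_inv_one] by auto
next
  case (Suc k)
  then have k: "k < n" by simp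
  obtain g g' where g: "GL_limit n g g'" and z: "\<And>i j. i < n \<Longrightarrow> j < k \<Longrightarrow> i \<noteq> j \<Longrightarrow> (g * M) $$ (i,j) = 0"
    using Suc by auto
  have gi: "inv_pair n g g'" using g unfolding GL_limit_def by auto
  define L where "L = g * M"
  define R where "R = M' * g'"
  have L: "inv_pair n L R" unfolding L_def R_def by (rule inv_pair_mult[OF gi M])
  note Lc = inv_pair_carrier[OF L]
  note Mc = inv_pair_carrier[OF M] inv_pair_carrier[OF gi]
  have RL: "(\<Sum>l<n. R $$ (i,l) * L $$ (l,j)) = (if i = j then 1 else 0)" if "i < n" "j < n" for i j
  proof -
    have "(R * L) $$ (i,j) = (if i = j then 1 else 0)" using L that unfolding inv_pair_def by auto
    then show ?thesis using index_mult_sum[OF Lc(2,1) that] by simp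
  qed
  have RLj: "R $$ (i,j) * L $$ (j,j) = (if i = j then 1 else 0)" if "i < n" "j < k" for i j
  proof -
    have "(\<Sum>l<n. R $$ (i,l) * L $$ (l,j)) = (\<Sum>l<n. if l = j then R $$ (i,j) * L $$ (j,j) else 0)"
      using z that k by (intro sum.cong) (auto simp: L_def)
    then show ?thesis using RL[of i j] that k by simp
  qed
  \<comment> \<open>Otherwise column \<open>k\<close> would depend on the cleared columns, against invertibility.\<close>
  have "\<exists>i<n. k \<le> i \<and> L $$ (i,k) \<noteq> 0"
  proof (rule ccontr)
    assume c: "\<not> ?thesis"
    have "R $$ (k,l) * L $$ (l,k) = 0" if "l < n" for l
    proof (cases "l < k")
      case True
      then have "R $$ (k,l) = 0" using RLj[of k l] RLj[of l l] k by auto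
      then show ?thesis by simp
    qed (use c that in auto)
    then have "(\<Sum>l<n. R $$ (k,l) * L $$ (l,k)) = 0" by (intro sum.neutral) blast
    then show False using RL[of k k] k by simp
  qed
  then obtain p where p: "p < n" "k \<le> p" "L $$ (p,k) \<noteq> 0" by blast
  \<comment> \<open>The pivot entry may vanish; then row \<open>p\<close> is added to row \<open>k\<close>.\<close>
  obtain h h' where h: "GL_limit n h h'" "(h * L) $$ (k,k) \<noteq> 0"
     "\<And>i j. i < n \<Longrightarrow> j < k \<Longrightarrow> i \<noteq> j \<Longrightarrow> (h * L) $$ (i,j) = 0"
  proof (cases "L $$ (k,k) = 0")
    case True
    then have pk: "p \<noteq> k" using p by auto
    define x :: "nat \<Rightarrow> real" where "x i = (if i = k then 1 else 0)" for i
    show ?thesis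
      by (rule that[OF GL_limit_colop[of p n x]])
        (use p k pk True Lc z in \<open>auto simp: colop_mult[of L n n] x_def L_def[symmetric]\<close>)
  next
    case False
    show ?thesis 
      by (rule that[OF GL_limit_of_U_inv[OF U_inv_one]]) (use False Lc z L_def in auto)
  qed
  have hi: "inv_pair n h h'" using h(1) unfolding GL_limit_def by auto
  note hc = inv_pair_carrier[OF hi]
  define x where "x i = (if i = k then 0 else - (h * L) $$ (i,k) / (h * L) $$ (k,k))" for i
  let ?c = "colop n k x"
  have hL: "h * L \<in> carrier_mat n n" using hc Lc by auto
  have "(?c * (h * L)) $$ (i,j) = 0" if "i < n" "j < Suc k" "i \<noteq> j" for i j
    using that h k by (auto simp: colop_mult[OF hL] x_def less_Suc_eq simp del: index_mult_mat)
  moreover have "?c * (h * L) = (?c * h) * g * M"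
    using hc Mc unfolding L_def by (simp add: assoc_mult_mat[of _ n n _ n _ n])
  moreover have "GL_limit n (?c * h * g) (g' * (h' * colop n k (\<lambda>i. - x i)))"
    using GL_limit_mult[OF GL_limit_mult[OF GL_limit_colop[of k n x, OF k] h(1)] g] by (simp add: x_def)
  ultimately show ?case by metis
qed

text \<open>
  Elimination writes \<open>h\<close> as a limit of invertible matrices over \<open>U\<close> times a diagonal matrix. The signs
  of the diagonal are invertible over \<open>U\<close>, its absolute values only rescale the basis vectors. Such a
  rescaling cannot be avoided in general, as the determinant must be close to a unit of \<open>U\<close>, but it does not change
  the cone spanned by the columns of \<open>h\<close>.
\<close>

lemma GL_limit_dense:
  assumes h: "inv_pair n h h'"
  shows "\<exists>e. (\<forall>j<n. 0 < e j) \<and> GL_limit n (h * mat_diag n e) (mat_diag n (\<lambda>i. 1 / e i) * h')"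
proof -
  obtain g g' where g: "GL_limit n g g'" and z: "\<And>i j. i < n \<Longrightarrow> j < n \<Longrightarrow> i \<noteq> j \<Longrightarrow> (g * h) $$ (i,j) = 0"
    using GL_limit_elimination[OF h, of n] by auto
  have gi: "inv_pair n g g'" using g unfolding GL_limit_def by auto
  note c = inv_pair_carrier[OF h] inv_pair_carrier[OF gi]
  define d where "d i = (g * h) $$ (i,i)" for i
  have gh: "g * h = mat_diag n d"
    using z c by (intro eq_matI) (auto simp: mat_diag_def d_def simp del: index_mult_mat(1))
  have d0: "d i \<noteq> 0" if "i < n" for i
  proof
    assume "d i = 0"
    have "(g * h * (h' * g')) $$ (i,i) = 1"
      using inv_pair_mult[OF gi h] that unfolding inv_pair_def by auto
    moreover have "(g * h * (h' * g')) $$ (i,i) = d i * (h' * g') $$ (i,i)"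
      unfolding gh using that c by (subst mat_diag_mult_left[of _ n n]) auto
    ultimately show False using \<open>d i = 0\<close> by simp
  qed
  define e where "e i = 1 / \<bar>d i\<bar>" for i
  define S where "S = mat_diag n (\<lambda>i. sgn (d i))"
  have SS: "S * S = 1\<^sub>m n" unfolding S_def mat_diag_diag
    by (rule mat_diag_eq_one) (use d0 in \<open>auto simp: sgn_if\<close>)
  have Sc: "S \<in> carrier_mat n n" unfolding S_def by auto
  have "U_inv n S S" unfolding U_inv_def inv_pair_def using SS Sc
    by (auto simp: mat_over_iff[OF Sc]) (auto simp: S_def mat_diag_def sgn_if)
  then have "GL_limit n (g' * S) (S * g)"
    using GL_limit_mult[OF GL_limit_sym[OF g] GL_limit_of_U_inv] by blast
  moreover have "h * mat_diag n e = g' * S"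
  proof -
    have "h * mat_diag n e = g' * (g * h) * mat_diag n e"
      using inv_pair_cancel(2)[OF gi c(1)] by simp
    also have "\<dots> = g' * (mat_diag n d * mat_diag n e)"
      unfolding gh using c by (simp add: assoc_mult_mat[of _ n n _ n _ n])
    also have "mat_diag n d * mat_diag n e = S" unfolding S_def mat_diag_diag
      by (rule mat_diag_eqI) (use d0 in \<open>auto simp: e_def sgn_if\<close>)
    finally show ?thesis .
  qed
  moreover have "mat_diag n (\<lambda>i. 1 / e i) * h' = S * g"
  proof -
    have "S * g = S * (g * h * h')"
      using inv_pair_cancel_right[OF h c(3)] by simp
    also have "\<dots> = S * mat_diag n d * h'"
      unfolding gh using c Sc by (simp add: assoc_mult_mat[of _ n n _ n _ n])
    also have "S * mat_diag n d = mat_diag n (\<lambda>i. 1 / e i)"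
      unfolding S_def mat_diag_diag
      by (rule mat_diag_eqI) (use d0 in \<open>auto simp: e_def sgn_if\<close>)
    finally show ?thesis by simp
  qed
  ultimately show ?thesis using d0 by (intro exI[of _ e]) (auto simp: e_def)
qed

end

section \<open>Classes attached to real cones\<close>

text \<open>
  The columns of \<open>g\<close> and of \<open>h\<close> span two cones. They are linked if some basis \<open>c\<close> lies in the interior of
  both, some basis \<open>d\<close> of covectors (rows) in the interior of both dual cones, and the coefficients
  of \<open>A\<close> with respect to the tensors of \<open>c\<close> and \<open>d\<close> are positive. All conditions are open.
\<close>

definition linked :: "nat \<Rightarrow> real mat \<Rightarrow> real mat \<Rightarrow> real mat \<Rightarrow> real mat \<Rightarrow> real mat \<Rightarrow> bool" where
  "linked n A g g' h h' \<longleftrightarrow> (\<exists>c c' d d'. inv_pair n c c' \<and> inv_pair n d d' \<and>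
     pos_mat (g' * c) \<and> pos_mat (h' * c) \<and> pos_mat (d * g) \<and> pos_mat (d * h) \<and>
     pos_mat (c' * A * d'))"

context dense_ring
begin

text \<open>
  Bases over \<open>U\<close> that converge to \<open>h\<close> after the basis vectors of \<open>h\<close> are rescaled by \<open>e\<close>; strict
  positivity of products with \<open>h\<close> or \<open>h'\<close> is inherited by all late members.
\<close>

definition U_basis_seq ::
  "nat \<Rightarrow> real mat \<Rightarrow> real mat \<Rightarrow> (nat \<Rightarrow> real) \<Rightarrow> (nat \<Rightarrow> real mat) \<Rightarrow> (nat \<Rightarrow> real mat) \<Rightarrow> bool" where
  "U_basis_seq n h h' e c c' \<longleftrightarrow> inv_pair n h h' \<and> (\<forall>j<n. 0 < e j) \<and> (\<forall>k. U_inv n (c k) (c' k)) \<and>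
     mat_tendsto c (h * mat_diag n e) sequentially \<and>
     mat_tendsto c' (mat_diag n (\<lambda>i. 1 / e i) * h') sequentially"

lemma U_basis_seq_exists: "inv_pair n h h' \<Longrightarrow> \<exists>e c c'. U_basis_seq n h h' e c c'"
  using GL_limit_dense[of n h h'] unfolding U_basis_seq_def GL_limit_def by blast

lemma U_basis_seq_const:
  assumes "U_inv n g g'" shows "U_basis_seq n g g' (\<lambda>_. 1) (\<lambda>_. g) (\<lambda>_. g')"
  using assms U_invD(1)[OF assms] U_inv_carrier[OF assms] mat_diag_eq_one[of n "\<lambda>_. 1::real"]
  unfolding U_basis_seq_def by auto

lemma U_basis_seq_left:
  assumes s: "U_basis_seq n h h' e c c'" and X: "X \<in> carrier_mat n m" "pos_mat (h' * X)"
  shows "\<forall>\<^sub>F k in sequentially. pos_mat (c' k * X)"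
proof -
  have h: "h' \<in> carrier_mat n n" using s inv_pair_carrier unfolding U_basis_seq_def by auto
  have dh: "mat_diag n (\<lambda>i. 1 / e i) * h' \<in> carrier_mat n n"
    by (rule mult_carrier_mat[OF mat_diag_dim h])
  have "mat_tendsto (\<lambda>k. c' k * X) (mat_diag n (\<lambda>i. 1 / e i) * h' * X) sequentially"
    by (rule mat_tendsto_mult[of _ _ _ _ _ n n m]) (use s X h dh U_basis_seq_def mult_carrier_mat[of _ n n _ n] mult_carrier_mat[of _ n n _ m] in auto)
  moreover have "mat_diag n (\<lambda>i. 1 / e i) * h' * X = mat_diag n (\<lambda>i. 1 / e i) * (h' * X)"
    using h X by (simp add: assoc_mult_mat[of _ n n _ n _ m])
  moreover have "pos_mat (mat_diag n (\<lambda>i. 1 / e i) * (h' * X))"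
    by (rule pos_mat_diag_left[of _ n m]) (use s X h dh U_basis_seq_def mult_carrier_mat[of _ n n _ n] mult_carrier_mat[of _ n n _ m] in auto)
  ultimately show ?thesis using eventually_pos_mat by metis
qed

lemma U_basis_seq_right:
  assumes s: "U_basis_seq n h h' e c c'" and Y: "Y \<in> carrier_mat m n" "pos_mat (Y * h)"
  shows "\<forall>\<^sub>F k in sequentially. pos_mat (Y * c k)"
proof -
  have h: "h \<in> carrier_mat n n" using s inv_pair_carrier unfolding U_basis_seq_def by auto
  have "mat_tendsto (\<lambda>k. Y * c k) (Y * (h * mat_diag n e)) sequentially"
    by (rule mat_tendsto_mult[of _ _ _ _ _ m n n]) (use s Y h U_basis_seq_def mult_carrier_mat[of _ m n _ n] in auto)
  moreover have "Y * (h * mat_diag n e) = Y * h * mat_diag n e"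
    using h Y by (simp add: assoc_mult_mat[of _ m n _ n _ n])
  moreover have "pos_mat (Y * h * mat_diag n e)"
    by (rule pos_mat_diag_right[of _ m n]) (use s Y h U_basis_seq_def mult_carrier_mat[of _ m n _ n] in auto)
  ultimately show ?thesis using eventually_pos_mat by metis
qed

lemma U_basis_seq_both:
  assumes s: "U_basis_seq n h h' e c c'" "U_basis_seq n g g' f d d'"
    and X: "X \<in> carrier_mat n n" "pos_mat (h' * X * g)"
  shows "\<forall>\<^sub>F k in sequentially. pos_mat (c' k * X * d k)"
proof -
  have h: "h' \<in> carrier_mat n n" "g \<in> carrier_mat n n"
    using s inv_pair_carrier unfolding U_basis_seq_def by auto
  have dh: "mat_diag n (\<lambda>i. 1 / e i) * h' \<in> carrier_mat n n"
    by (rule mult_carrier_mat[OF mat_diag_dim h(1)])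
  have dhX: "mat_diag n (\<lambda>i. 1 / e i) * h' * X \<in> carrier_mat n n"
    by (rule mult_carrier_mat[OF dh X(1)])
  have "mat_tendsto (\<lambda>k. c' k * X * d k) (mat_diag n (\<lambda>i. 1 / e i) * h' * X * (g * mat_diag n f)) sequentially"
    by (rule mat_tendsto_mult[of _ _ _ _ _ n n n] mat_tendsto_mult[of _ _ _ _ _ n n n])+
      (use s X h dh dhX U_basis_seq_def mult_carrier_mat[of _ n n _ n] in auto)
  moreover have "mat_diag n (\<lambda>i. 1 / e i) * h' * X * (g * mat_diag n f) =
      (mat_diag n (\<lambda>i. 1 / e i) * (h' * X * g)) * mat_diag n f"
    using h X by (simp add: assoc_mult_mat[of _ n n _ n _ n])
  moreover have "pos_mat (mat_diag n (\<lambda>i. 1 / e i) * (h' * X * g) * mat_diag n f)"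
  proof -
    have Y: "h' * X * g \<in> carrier_mat n n" using h X by simp
    have "pos_mat (mat_diag n (\<lambda>i. 1 / e i) * (h' * X * g))"
      by (rule pos_mat_diag_left[OF Y _ X(2)]) (use s U_basis_seq_def in auto)
    then show ?thesis
      by (rule pos_mat_diag_right[OF mult_carrier_mat[OF mat_diag_dim Y], rotated])
        (use s U_basis_seq_def in auto)
  qed
  ultimately show ?thesis using eventually_pos_mat by metis
qed

text \<open>
  With \<open>x = g' * c\<close>, \<open>y = d * g\<close> and \<open>Z = c' * A * d'\<close>, the matrix \<open>g' * A * g\<close> is the product
  \<open>x * (Z * y)\<close>, and the product in the other order is \<open>Z * (d * c)\<close>. The latter is independent of \<open>g\<close>.
\<close>

lemma common_refinement:
  assumes "0 < n" and g: "U_inv n g g'" and c: "U_inv n c c'" and d: "U_inv n d d'"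
    and A: "A \<in> carrier_mat n n" "mat_over U A"
    and pos: "pos_mat (g' * c)" "pos_mat (d * g)" "pos_mat (c' * A * d')"
  shows "elementary_sse Uplus (g' * A * g) (c' * A * d' * (d * c))"
proof -
  note cs = U_inv_carrier[OF g] U_inv_carrier[OF c] U_inv_carrier[OF d]
  note os = U_invD(2,3)[OF g] U_invD(2,3)[OF c] U_invD(2,3)[OF d]
  note as = assoc_mult_mat[of _ n n _ n _ n]
  have o: "mat_over U (g' * c)" "mat_over U (d * g)" "mat_over U (c' * A * d')"
    using over_mult[of _ n n _ n] cs os A by auto
  have "g' * A * g = (g' * c) * (c' * A * d' * (d * g))"
  proof -
    have "(g' * c) * (c' * A * d' * (d * g)) = g' * (c * (c' * (A * (d' * (d * g)))))"
      using cs A by (simp add: as)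
    also have "\<dots> = g' * (A * g)"
      using cs A inv_pair_cancel[OF U_invD(1)[OF c], where k = n] inv_pair_cancel[OF U_invD(1)[OF d], where k = n]
        mult_carrier_mat[of _ n n _ n] by simp
    finally show ?thesis using cs A by (simp add: as)
  qed
  moreover have "c' * A * d' * (d * c) = (c' * A * d' * (d * g)) * (g' * c)"
  proof -
    have "(c' * A * d' * (d * g)) * (g' * c) = c' * (A * (d' * (d * (g * (g' * c)))))"
      using cs A by (simp add: as)
    also have "\<dots> = c' * (A * (d' * (d * c)))"
      using cs A inv_pair_cancel[OF U_invD(1)[OF g], where k = n] mult_carrier_mat[of _ n n _ n] by simp
    finally show ?thesis using cs A by (simp add: as)
  qed
  moreover have "mat_over Uplus (g' * c)" "mat_over Uplus (c' * A * d' * (d * g))"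
    using over_Uplus_of_pos[OF o(1) pos(1)] over_Uplus_of_pos[OF o(2) pos(2)] over_Uplus_of_pos[OF o(3) pos(3)] 
      over_mult_Uplus[of "c' * A * d'" n n "d * g" n] cs A by auto
  ultimately show ?thesis using cs A \<open>0 < n\<close>
    by (intro elementary_sseI[of "g' * c" n n "c' * A * d' * (d * g)"]) auto
qed

text \<open>
  Approximating \<open>c\<close> and \<open>d\<close> by bases over \<open>U\<close> gives a common refinement of both forms.
\<close>

lemma linked_U_bases:
  assumes "0 < n" and g: "U_inv n g g'" and h: "U_inv n h h'"
    and A: "A \<in> carrier_mat n n" "mat_over U A" and l: "linked n A g g' h h'"
  shows "sse Uplus (g' * A * g) (h' * A * h)"
proof -
  obtain c c' d d' where c: "inv_pair n c c'" and d: "inv_pair n d d'"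
     and pos: "pos_mat (g' * c)" "pos_mat (h' * c)" "pos_mat (d * g)" "pos_mat (d * h)"
     "pos_mat (c' * A * d')" using l unfolding linked_def by blast
  obtain e a a' where a: "U_basis_seq n c c' e a a'" using U_basis_seq_exists[OF c] by blast
  obtain f b b' where b: "U_basis_seq n d' d f b b'" using U_basis_seq_exists[OF inv_pair_sym[OF d]] by blast
  note cs = U_inv_carrier[OF g] U_inv_carrier[OF h] inv_pair_carrier[OF c] inv_pair_carrier[OF d]
  have "\<forall>\<^sub>F k in sequentially. pos_mat (g' * a k) \<and> pos_mat (h' * a k) \<and> pos_mat (b' k * g) \<and>
     pos_mat (b' k * h) \<and> pos_mat (a' k * A * b k)"
    using U_basis_seq_right[OF a cs(2) pos(1)] U_basis_seq_right[OF a cs(4) pos(2)]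
      U_basis_seq_left[OF b cs(1) pos(3)] U_basis_seq_left[OF b cs(3) pos(4)]
      U_basis_seq_both[OF a b A(1) pos(5)]
    by (auto intro!: eventually_conj)
  then obtain k where k: "pos_mat (g' * a k)" "pos_mat (h' * a k)" "pos_mat (b' k * g)"
     "pos_mat (b' k * h)" "pos_mat (a' k * A * b k)"
    using eventually_happens'[OF sequentially_bot] by blast
  have u: "U_inv n (a k) (a' k)" "U_inv n (b' k) (b k)"
    using a b U_inv_sym unfolding U_basis_seq_def by auto
  show ?thesis
    using common_refinement[OF \<open>0 < n\<close> g u A k(1,3,5)] common_refinement[OF \<open>0 < n\<close> h u A k(2,4,5)]
      elementary_sse_sym by (meson converse_rtranclp_into_rtranclp r_into_rtranclp)
qed

text \<open>
  \<open>X\<close> belongs to the class of the real cone spanned by \<open>h\<close>: the forms of \<open>A\<close> in bases over \<open>U\<close> that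
  approximate \<open>h\<close> are equivalent to it.
\<close>

definition represents :: "nat \<Rightarrow> real mat \<Rightarrow> real mat \<Rightarrow> real mat \<Rightarrow> real mat \<Rightarrow> bool" where
  "represents n A h h' X \<longleftrightarrow>
     (\<exists>e c c'. U_basis_seq n h h' e c c' \<and> (\<forall>\<^sub>F k in sequentially. sse Uplus (c' k * A * c k) X))"

lemma represents_U_basis: "U_inv n g g' \<Longrightarrow> represents n A g g' (g' * A * g)"
  unfolding represents_def using U_basis_seq_const by fastforce

text \<open>
  Both the approximating basis of \<open>g\<close> and late members of the approximating sequence of \<open>h\<close> satisfy
  the same strict inequalities with the linking \<open>c\<close> and \<open>d\<close>, so they are linked themselves.
\<close>

lemma represents_step:
  assumes "0 < n" and A: "A \<in> carrier_mat n n" "mat_over U A" and l: "linked n A g g' h h'"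
    and g: "represents n A g g' X" and h: "U_basis_seq n h h' e c c'"
  shows "\<forall>\<^sub>F k in sequentially. sse Uplus (c' k * A * c k) X"
proof -
  obtain p p' q q' where p: "inv_pair n p p'" and q: "inv_pair n q q'"
     and pos: "pos_mat (g' * p)" "pos_mat (h' * p)" "pos_mat (q * g)" "pos_mat (q * h)"
     "pos_mat (p' * A * q')" using l unfolding linked_def by blast
  note cs = inv_pair_carrier[OF p] inv_pair_carrier[OF q]
  obtain f a a' where a: "U_basis_seq n g g' f a a'"
     "\<forall>\<^sub>F k in sequentially. sse Uplus (a' k * A * a k) X" using g unfolding represents_def by blast
  have "\<forall>\<^sub>F k in sequentially. pos_mat (a' k * p) \<and> pos_mat (q * a k) \<and> sse Uplus (a' k * A * a k) X"
    using U_basis_seq_left[OF a(1) cs(1) pos(1)] U_basis_seq_right[OF a(1) cs(3) pos(3)] a(2)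
    by (intro eventually_conj)
  then obtain k where k: "pos_mat (a' k * p)" "pos_mat (q * a k)" "sse Uplus (a' k * A * a k) X"
    using eventually_happens'[OF sequentially_bot] by blast
  have ak: "U_inv n (a k) (a' k)" using a unfolding U_basis_seq_def by auto
  have "\<forall>\<^sub>F m in sequentially. pos_mat (c' m * p) \<and> pos_mat (q * c m)"
    using U_basis_seq_left[OF h cs(1) pos(2)] U_basis_seq_right[OF h cs(3) pos(4)]
    by (intro eventually_conj)
  then show ?thesis
  proof eventually_elim
    case (elim m)
    have "linked n A (c m) (c' m) (a k) (a' k)"
      unfolding linked_def using p q k elim pos(5) by blast
    moreover have "U_inv n (c m) (c' m)" using h unfolding U_basis_seq_def by auto
    ultimately have "sse Uplus (c' m * A * c m) (a' k * A * a k)"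
      using linked_U_bases[OF \<open>0 < n\<close> _ ak A] by blast
    then show ?case using k(3) sse_trans by blast
  qed
qed

lemma represents_linked:
  assumes "0 < n" and A: "A \<in> carrier_mat n n" "mat_over U A" and l: "linked n A g g' h h'"
    and h: "inv_pair n h h'" and g: "represents n A g g' X"
  shows "represents n A h h' X"
  using U_basis_seq_exists[OF h] represents_step[OF assms(1-4) g] unfolding represents_def by blast

lemma represents_unique:
  assumes "0 < n" and A: "A \<in> carrier_mat n n" "mat_over U A" and l: "linked n A g g' h h'"
    and g: "represents n A g g' X" and h: "represents n A h h' Y"
  shows "sse Uplus X Y"
proof -
  obtain e c c' where c: "U_basis_seq n h h' e c c'"
     "\<forall>\<^sub>F k in sequentially. sse Uplus (c' k * A * c k) Y" using h unfolding represents_def by blast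
  have "\<forall>\<^sub>F k in sequentially. sse Uplus (c' k * A * c k) X \<and> sse Uplus (c' k * A * c k) Y"
    using represents_step[OF assms(1-4) g c(1)] c(2) by (rule eventually_conj)
  then show ?thesis
    using eventually_happens'[OF sequentially_bot] sse_sym sse_trans by blast
qed

end

section \<open>Scaling the nilpotent part\<close>

lemma eigenvalue_of_power_relation:
  assumes "(A::complex mat) \<in> carrier_mat n n" "eigenvector A v e"
    and "A ^\<^sub>m (Suc M) = l \<cdot>\<^sub>m A ^\<^sub>m M"
  shows "e ^ M * (e - l) = 0"
proof -
  have v: "v \<in> carrier_vec n" "v \<noteq> 0\<^sub>v n" using assms unfolding eigenvector_def by auto
  obtain i where i: "i < n" "v $ i \<noteq> 0" using v by force
  have "e ^ Suc M \<cdot>\<^sub>v v = (l \<cdot>\<^sub>m A ^\<^sub>m M) *\<^sub>v v"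
    using eigenvector_pow[OF assms(1,2), of "Suc M"] assms(3) by simp
  also have "\<dots> = l \<cdot>\<^sub>v (A ^\<^sub>m M *\<^sub>v v)"
    using v assms(1)
    by (intro eq_vecI) (auto simp: scalar_prod_def sum_distrib_left mult.assoc)
  also have "A ^\<^sub>m M *\<^sub>v v = e ^ M \<cdot>\<^sub>v v" by (rule eigenvector_pow[OF assms(1,2)])
  finally have "(e ^ Suc M \<cdot>\<^sub>v v) $ i = (l \<cdot>\<^sub>v (e ^ M \<cdot>\<^sub>v v)) $ i" by simp
  then show ?thesis using i v by (simp add: algebra_simps)
qed

text \<open>
  The only possible complex eigenvalues are 0 and \<open>l\<close>, which are real, so that a real Jordan form exists.
\<close>

lemma char_poly_splits:
  assumes A: "(A::real mat) \<in> carrier_mat n n" and p: "A ^\<^sub>m (Suc M) = l \<cdot>\<^sub>m A ^\<^sub>m M"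
  shows "\<exists>as. char_poly A = (\<Prod>a\<leftarrow>as. [:- a, 1:])"
proof -
  interpret h: inj_comm_ring_hom "of_real :: real \<Rightarrow> complex" by unfold_locales auto
  let ?A = "map_mat (of_real :: real \<Rightarrow> complex) A"
  have cA: "?A \<in> carrier_mat n n" using A by auto
  obtain as where as: "char_poly ?A = (\<Prod>a\<leftarrow>as. [:- a, 1:])" using char_poly_factorized[OF cA] by blast
  have pow: "?A ^\<^sub>m (Suc M) = of_real l \<cdot>\<^sub>m ?A ^\<^sub>m M"
  proof -
    have hp: "map_mat (of_real :: real \<Rightarrow> complex) (A ^\<^sub>m k) = ?A ^\<^sub>m k" for k
    proof (induction k)
      case (Suc k)
      then show ?case by (simp add: of_real_hom.mat_hom_mult[OF pow_carrier_mat[OF A] A])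
    qed (use A in \<open>auto simp: of_real_hom.mat_hom_one\<close>)
    have "map_mat (of_real :: real \<Rightarrow> complex) (l \<cdot>\<^sub>m A ^\<^sub>m M) = of_real l \<cdot>\<^sub>m map_mat of_real (A ^\<^sub>m M)"
      by (intro eq_matI) auto
    then show ?thesis using p hp[of "Suc M"] hp[of M] by simp
  qed
  have re: "of_real (Re a) = a" if "a \<in> set as" for a
  proof -
    have "poly (char_poly ?A) a = 0" unfolding as using that
      by (auto simp: poly_prod_list prod_list_zero_iff o_def image_iff intro!: bexI[of _ a])
    then obtain v where "eigenvector ?A v a"
      using eigenvalue_root_char_poly[OF cA] unfolding eigenvalue_def by blast
    then have "a ^ M * (a - of_real l) = 0" using eigenvalue_of_power_relation[OF cA _ pow] by blast
    then have "a = 0 \<or> a = of_real l" by auto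
    then show ?thesis by auto
  qed
  have "map_poly of_real (\<Prod>a\<leftarrow>map Re as. [:- a, 1:]) = (\<Prod>a\<leftarrow>as. [:- a, 1:])"
    using re
  proof (induction as)
    case (Cons a as)
    interpret m: map_poly_comm_ring_hom "of_real :: real \<Rightarrow> complex" ..
    have "map_poly of_real [:- Re a, 1:] = [:- a, 1:]" using Cons(2)[of a]
      by (simp add: map_poly_pCons)
    then show ?case using Cons by (simp add: m.hom_mult del: mult_pCons_left)
  qed simp
  then have "map_poly of_real (char_poly A) = (map_poly of_real (\<Prod>a\<leftarrow>map Re as. [:- a, 1:]) :: complex poly)"
    using of_real_hom.char_poly_hom[OF A] as by metis
  moreover have "inj (map_poly (of_real :: real \<Rightarrow> complex))"
    by (auto intro!: injI poly_eqI simp: poly_eq_iff coeff_map_poly)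
  ultimately show ?thesis by (metis injD)
qed

lemma jordan_matrix_bidiagonal:
  "i < dim_row (jordan_matrix n_as) \<Longrightarrow> j < dim_row (jordan_matrix n_as) \<Longrightarrow> i \<noteq> j \<Longrightarrow> 
    jordan_matrix n_as $$ (i,j) \<noteq> (0::'a::comm_ring_1) \<Longrightarrow>
    j = Suc i \<and> jordan_matrix n_as $$ (i,i) = jordan_matrix n_as $$ (j,j)"
proof (induction n_as arbitrary: i j)
  case (Cons p n_as)
  obtain n a where p: "p = (n, a)" by force
  show ?case
  proof (cases "i < n \<or> j < n")
    case True
    then show ?thesis using Cons.prems unfolding p jordan_matrix_Cons
      by (auto split: if_splits)
  next
    case False
    then have "j - n = Suc (i - n) \<and> jordan_matrix n_as $$ (i - n,i - n) = jordan_matrix n_as $$ (j - n,j - n)"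
      using Cons.prems unfolding p jordan_matrix_Cons
      by (intro Cons.IH) (auto split: if_splits)
    then show ?thesis using False Cons.prems unfolding p jordan_matrix_Cons by auto
  qed
qed auto

text \<open>
  The relation between the powers forces the superdiagonal to vanish next to the eigenvalue \<open>l\<close>.
  Diagonal and superdiagonal part thus annihilate each other, and high powers of the matrix see the
  diagonal part only.
\<close>

lemma bidiagonal_power:
  fixes J :: "real mat"
  assumes J: "J \<in> carrier_mat n n"
    and bi: "\<And>i j. i < n \<Longrightarrow> j < n \<Longrightarrow> i \<noteq> j \<Longrightarrow> J $$ (i,j) \<noteq> 0 \<Longrightarrow> j = Suc i \<and> J $$ (i,i) = J $$ (j,j)"
    and p: "J ^\<^sub>m (Suc M) = l \<cdot>\<^sub>m J ^\<^sub>m M" and l: "l \<noteq> 0"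
  defines "D \<equiv> mat_diag n (\<lambda>i. J $$ (i,i))"
  shows "k \<ge> n \<Longrightarrow> J ^\<^sub>m (Suc k) = l ^ k \<cdot>\<^sub>m D"
proof -
  let ?a = "\<lambda>i. J $$ (i,i)"
  define N where "N = J - D"
  have D: "D \<in> carrier_mat n n" unfolding D_def by auto
  then have N: "N \<in> carrier_mat n n" unfolding N_def by (rule minus_carrier_mat)
  have JN: "J = D + N" unfolding N_def using J D by (intro eq_matI) auto
  have Nij: "N $$ (i,j) = (if i = j then 0 else J $$ (i,j))" if "i < n" "j < n" for i j
    using that J by (auto simp: N_def D_def mat_diag_def)
  have step: "(J ^\<^sub>m Suc m) $$ (i,j) = (J ^\<^sub>m m) $$ (i,j) * ?a j + 
     (if j = 0 then 0 else (J ^\<^sub>m m) $$ (i,j - 1) * N $$ (j - 1,j))" if "i < n" "j < n" for i j m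
  proof -
    have "(J ^\<^sub>m Suc m) $$ (i,j) = (\<Sum>q<n. (J ^\<^sub>m m) $$ (i,q) * J $$ (q,j))"
      unfolding pow_mat.simps using that J by (intro index_mult_sum[of _ n n _ n]) auto
    also have "\<dots> = (\<Sum>q<n. (if q = j then (J ^\<^sub>m m) $$ (i,q) * ?a j else 0) + 
        (if q = j - 1 then (if j = 0 then 0 else (J ^\<^sub>m m) $$ (i,q) * N $$ (q,j)) else 0))"
    proof (intro sum.cong refl)
      fix q assume "q \<in> {..<n}"
      then show "(J ^\<^sub>m m) $$ (i,q) * J $$ (q,j) = (if q = j then (J ^\<^sub>m m) $$ (i,q) * ?a j else 0) + 
        (if q = j - 1 then (if j = 0 then 0 else (J ^\<^sub>m m) $$ (i,q) * N $$ (q,j)) else 0)"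
        using that bi[of q j] by (cases "q = j"; cases "J $$ (q,j) = 0"; cases "j = 0") (auto simp: Nij)
    qed
    finally show ?thesis using that by (simp add: sum.distrib)
  qed
  have tri: "(J ^\<^sub>m m) $$ (i,j) = (if i = j then ?a i ^ m else 0)" if "i < n" "j \<le> i" for i j m
    using that
  proof (induction m arbitrary: i j)
    case (Suc m)
    then show ?case using step[of i j m] by (auto simp: mult.commute)
  qed (use J in auto)
  have a0: "?a i = 0 \<or> ?a i = l" if "i < n" for i
  proof -
    have "(J ^\<^sub>m Suc M) $$ (i,i) = l * (J ^\<^sub>m M) $$ (i,i)" unfolding p using that J by simp
    then have "?a i ^ Suc M = l * ?a i ^ M" unfolding tri[OF that order_refl] by simp
    then have "(?a i - l) * ?a i ^ M = 0" by (simp add: algebra_simps)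
    then show ?thesis by auto
  qed
  have N0: "?a i = 0 \<and> ?a j = 0" if "i < n" "j < n" "N $$ (i,j) \<noteq> 0" for i j
  proof -
    have ij: "j = Suc i" "?a i = ?a j" using bi[of i j] that Nij by (auto split: if_splits)
    have "(J ^\<^sub>m Suc M) $$ (i,j) = l * (J ^\<^sub>m M) $$ (i,j)" unfolding p using that J by simp
    then have "(J ^\<^sub>m M) $$ (i,j) * ?a j + ?a i ^ M * N $$ (i,j) = l * (J ^\<^sub>m M) $$ (i,j)"
      using step[of i j M] tri[of i i M] that ij by simp
    then have "?a j \<noteq> l" using that(3) l ij(2) by auto
    then show ?thesis using a0[of j] that ij by auto
  qed
  have DN: "D * N = 0\<^sub>m n n"
    by (rule eq_matI) (use N0 N in \<open>auto simp: D_def mat_diag_mult_left[of _ n n]\<close>)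
  have ND: "N * D = 0\<^sub>m n n"
    by (rule eq_matI) (use N0 N in \<open>auto simp: D_def mat_diag_mult_right[of _ n n]\<close>)
  have DD: "D * D = l \<cdot>\<^sub>m D" unfolding D_def mat_diag_diag
    by (rule eq_matI) (use a0 in \<open>auto simp: mat_diag_def\<close>)
  have NSD: "N ^\<^sub>m Suc m * D = 0\<^sub>m n n" for m
    unfolding pow_mat.simps using N D ND by (simp add: assoc_mult_mat[of _ n n _ n _ n])
  have JS: "J ^\<^sub>m Suc m = l ^ m \<cdot>\<^sub>m D + N ^\<^sub>m Suc m" for m
  proof (induction m)
    case (Suc m)
    have c: "N ^\<^sub>m Suc m \<in> carrier_mat n n" using N by (rule pow_carrier_mat)
    have "J ^\<^sub>m Suc (Suc m) = (l ^ m \<cdot>\<^sub>m D + N ^\<^sub>m Suc m) * (D + N)"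
      unfolding pow_mat.simps(2)[of J "Suc m"] Suc using JN by simp
    also have "\<dots> = (l ^ m \<cdot>\<^sub>m D + N ^\<^sub>m Suc m) * D + (l ^ m \<cdot>\<^sub>m D + N ^\<^sub>m Suc m) * N"
      using c N D by (intro mult_add_distrib_mat[of _ n n]) auto
    also have "(l ^ m \<cdot>\<^sub>m D + N ^\<^sub>m Suc m) * D = (l ^ m \<cdot>\<^sub>m D) * D + N ^\<^sub>m Suc m * D"
      using c N D by (intro add_mult_distrib_mat[of _ n n]) auto
    also have "(l ^ m \<cdot>\<^sub>m D) * D = l ^ Suc m \<cdot>\<^sub>m D"
      using D by (simp add: mult_smult_assoc_mat[of _ n n _ n] DD) (intro eq_matI; simp)
    also have "(l ^ m \<cdot>\<^sub>m D + N ^\<^sub>m Suc m) * N = (l ^ m \<cdot>\<^sub>m D) * N + N ^\<^sub>m Suc m * N"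
      using c N D by (intro add_mult_distrib_mat[of _ n n]) auto
    also have "(l ^ m \<cdot>\<^sub>m D) * N = 0\<^sub>m n n"
      using D N DN by (simp add: mult_smult_assoc_mat[of _ n n _ n])
    finally show ?case using NSD[of m] c N D by simp
  qed (use JN D N J in \<open>auto intro!: eq_matI\<close>)
  have Nk: "(N ^\<^sub>m m) $$ (i,j) = 0" if "i < n" "j < i + m" "j < n" for i j m
    using that
  proof (induction m arbitrary: j)
    case (Suc m)
    have "(N ^\<^sub>m m) $$ (i,q) * N $$ (q,j) = 0" if "q < n" for q
    proof (cases "q < i + m")
      case False
      then have "N $$ (q,j) = 0" using that Suc.prems bi[of q j] Nij[of q j] by auto
      then show ?thesis by simp
    qed (use Suc that in auto)
    then have "(\<Sum>q<n. (N ^\<^sub>m m) $$ (i,q) * N $$ (q,j)) = 0" by (intro sum.neutral) blast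
    then show ?case unfolding pow_mat.simps using Suc.prems N
      by (subst index_mult_sum[of _ n n _ n]) auto
  qed (use N in auto)
  show "J ^\<^sub>m (Suc k) = l ^ k \<cdot>\<^sub>m D" if "k \<ge> n"
    unfolding JS
  proof (rule eq_matI)
    fix i j assume "i < dim_row (l ^ k \<cdot>\<^sub>m D)" "j < dim_col (l ^ k \<cdot>\<^sub>m D)"
    then have "i < n" "j < n" using D by auto
    then show "(l ^ k \<cdot>\<^sub>m D + N ^\<^sub>m Suc k) $$ (i,j) = (l ^ k \<cdot>\<^sub>m D) $$ (i,j)"
      using Nk[of i j "Suc k"] that N D pow_carrier_mat[OF N, of "Suc k"] by simp
  qed (use pow_carrier_mat[OF N, of "Suc k"] D in auto)
qed

text \<open>
  In Jordan coordinates, conjugation by the diagonal matrix with entries \<open>exp (s * i)\<close> fixes the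
  diagonal and multiplies the superdiagonal by \<open>exp (- s)\<close>. The existence of such a group is the reason
  for using a Jordan form rather than some triangular form: there the off-diagonal part would be scaled
  by different powers, and \<open>B + u \<cdot>\<^sub>m N\<close> would not run along a segment.
\<close>

lemma jordan_scaling:
  assumes A: "(A::real mat) \<in> carrier_mat n n" and p: "A ^\<^sub>m (Suc M) = l \<cdot>\<^sub>m A ^\<^sub>m M" and l: "l \<noteq> 0"
  obtains B N T where "B \<in> carrier_mat n n" "N \<in> carrier_mat n n"
    "\<And>k. k \<ge> n \<Longrightarrow> A ^\<^sub>m (Suc k) = l ^ k \<cdot>\<^sub>m B"
    "\<And>s. inv_pair n (T s) (T (- s))" "T 0 = 1\<^sub>m n" "\<And>s t. T (s + t) = T s * T t"
    "\<And>s. T s * A * T (- s) = B + exp (- s) \<cdot>\<^sub>m N" "mat_tendsto T (1\<^sub>m n) (at 0)"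
proof -
  obtain as where "char_poly A = (\<Prod>a\<leftarrow>as. [:- a, 1:])" using char_poly_splits[OF A p] by blast
  then obtain n_as where "jordan_nf A n_as" using jordan_nf_exists[OF A] by blast
  then obtain P Q J where J: "J = jordan_matrix n_as" and sim: "similar_mat_wit A J P Q"
    unfolding jordan_nf_def similar_mat_def by blast
  note w = similar_mat_witD2[OF A sim]
  have PQ: "inv_pair n P Q" unfolding inv_pair_def using w by auto
  note as = assoc_mult_mat[of _ n n _ n _ n]
  note mc = mult_carrier_mat[of _ n n _ n]
  have pow: "A ^\<^sub>m k = P * J ^\<^sub>m k * Q" for k using similar_mat_wit_pow[OF sim, of k]
    unfolding similar_mat_wit_def Let_def by auto
  have Jpow: "J ^\<^sub>m k = Q * A ^\<^sub>m k * P" for k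
  proof -
    have "Q * A ^\<^sub>m k * P = Q * (P * (J ^\<^sub>m k * (Q * P)))"
      unfolding pow using w by (simp add: as mc)
    also have "\<dots> = J ^\<^sub>m k" using inv_pair_cancel[OF PQ, where k = n] w by (simp add: mc)
    finally show ?thesis by simp
  qed
  have J': "J ^\<^sub>m (Suc M) = l \<cdot>\<^sub>m J ^\<^sub>m M"
  proof -
    have c: "A ^\<^sub>m M \<in> carrier_mat n n" using A by simp
    show ?thesis unfolding Jpow p mult_smult_distrib[OF w(7) c]
      by (rule mult_smult_assoc_mat[OF mult_carrier_mat[OF w(7) c] w(6)])
  qed
  have bi: "j = Suc i \<and> J $$ (i,i) = J $$ (j,j)" if "i < n" "j < n" "i \<noteq> j" "J $$ (i,j) \<noteq> 0" for i j
    using jordan_matrix_bidiagonal[of i n_as j] that w(5) unfolding J by auto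
  define D where "D = mat_diag n (\<lambda>i. J $$ (i,i))"
  define E where "E s = mat_diag n (\<lambda>i. exp (s * real i))" for s
  define B where "B = P * D * Q"
  define N where "N = P * (J - D) * Q"
  define T where "T s = P * E s * Q" for s
  have D: "D \<in> carrier_mat n n" unfolding D_def by auto
  have E: "E s \<in> carrier_mat n n" for s unfolding E_def by auto
  have JD: "J - D \<in> carrier_mat n n" using D by (rule minus_carrier_mat)
  have EE: "E s * E t = E (s + t)" for s t unfolding E_def mat_diag_diag
    by (rule mat_diag_eqI) (simp add: algebra_simps flip: exp_add)
  have E0: "E 0 = 1\<^sub>m n" unfolding E_def by (rule mat_diag_eq_one) simp
  have B: "B \<in> carrier_mat n n" and N: "N \<in> carrier_mat n n" and T: "T s \<in> carrier_mat n n" for s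
    unfolding B_def N_def T_def using w D E JD by (auto simp: mc)
  have TT: "T (s + t) = T s * T t" for s t
  proof -
    have "T s * T t = P * (E s * (Q * (P * (E t * Q))))"
      unfolding T_def using w E by (simp add: as mc)
    also have "\<dots> = P * (E s * (E t * Q))" using inv_pair_cancel[OF PQ, where k = n] w E by (simp add: mc)
    also have "\<dots> = P * (E (s + t)) * Q" unfolding EE[symmetric] using w E by (simp add: as mc)
    finally show ?thesis unfolding T_def by simp
  qed
  have T0: "T 0 = 1\<^sub>m n" unfolding T_def E0 using w by simp
  have Tinv: "inv_pair n (T s) (T (- s))" for s
    unfolding inv_pair_def using T TT[of s "- s"] TT[of "- s" s] T0 by simp
  have EJE: "E s * J * E (- s) = D + exp (- s) \<cdot>\<^sub>m (J - D)" for s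
  proof (rule eq_matI)
    fix i j assume "i < dim_row (D + exp (- s) \<cdot>\<^sub>m (J - D))" "j < dim_col (D + exp (- s) \<cdot>\<^sub>m (J - D))"
    then have ij: "i < n" "j < n" using D by auto
    have "(E s * J * E (- s)) $$ (i,j) = exp (s * real i) * J $$ (i,j) * exp (- s * real j)"
      unfolding E_def using ij w(5)
      by (simp add: mat_diag_mult_left[of _ n n] mat_diag_mult_right[of _ n n])
    also have "\<dots> = (D + exp (- s) \<cdot>\<^sub>m (J - D)) $$ (i,j)"
    proof (cases "i = j \<or> J $$ (i,j) = 0")
      case True
      then show ?thesis using ij w(5) unfolding D_def 
        by (auto simp: mat_diag_def mult.commute simp flip: exp_add)
    next
      case False
      then have "j = Suc i" using bi ij by blast
      then have "exp (s * real i) * exp (- s * real j) = exp (- s)"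
        by (simp add: algebra_simps flip: exp_add)
      then show ?thesis using False ij w(5) unfolding D_def
        by (simp add: mat_diag_def mult.commute mult.left_commute)
    qed
    finally show "(E s * J * E (- s)) $$ (i,j) = (D + exp (- s) \<cdot>\<^sub>m (J - D)) $$ (i,j)" .
  qed (use E D w(5) in auto)
  have TAT: "T s * A * T (- s) = B + exp (- s) \<cdot>\<^sub>m N" for s
  proof -
    have "T s * A * T (- s) = P * (E s * (Q * (P * (J * (Q * (P * (E (- s) * Q)))))))"
      unfolding T_def w(3) using w(5-7) E by (simp add: as mc)
    also have "\<dots> = P * (E s * J * E (- s)) * Q"
      using inv_pair_cancel[OF PQ, where k = n] w(5-7) E by (simp add: as mc)
    also have "P * (E s * J * E (- s)) = P * D + P * (exp (- s) \<cdot>\<^sub>m (J - D))"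
      unfolding EJE using w D JD by (intro mult_add_distrib_mat[of _ n n]) auto
    also have "P * (exp (- s) \<cdot>\<^sub>m (J - D)) = exp (- s) \<cdot>\<^sub>m (P * (J - D))"
      by (rule mult_smult_distrib[OF w(6) JD])
    also have "(P * D + exp (- s) \<cdot>\<^sub>m (P * (J - D))) * Q = P * D * Q + (exp (- s) \<cdot>\<^sub>m (P * (J - D))) * Q"
      using w D JD by (intro add_mult_distrib_mat[of _ n n]) (auto simp: mc)
    also have "(exp (- s) \<cdot>\<^sub>m (P * (J - D))) * Q = exp (- s) \<cdot>\<^sub>m (P * (J - D) * Q)"
      using w D JD by (intro mult_smult_assoc_mat[of _ n n _ n]) (auto simp: mc)
    finally show ?thesis unfolding B_def N_def .
  qed
  have lim: "mat_tendsto T (1\<^sub>m n) (at 0)"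
  proof -
    have "mat_tendsto E (1\<^sub>m n) (at 0)"
    proof (rule mat_tendstoI[of _ n n])
      fix i j assume ij: "i < n" "j < n"
      have "((\<lambda>s. exp (s * real j)) \<longlongrightarrow> exp (0 * real j)) (at (0::real))"
        by (intro tendsto_intros)
      then show "((\<lambda>s. E s $$ (i,j)) \<longlongrightarrow> 1\<^sub>m n $$ (i,j)) (at 0)"
        using ij unfolding E_def by (cases "i = j") (auto simp: mat_diag_def)
    qed (use E in auto)
    then have "mat_tendsto (\<lambda>s. P * E s * Q) (P * 1\<^sub>m n * Q) (at 0)"
      using w by (intro mat_tendsto_mult[of _ _ _ _ _ n n n] mat_tendsto_const) auto
    then show ?thesis unfolding T_def using w by simp
  qed
  have Apow: "A ^\<^sub>m (Suc k) = l ^ k \<cdot>\<^sub>m B" if "k \<ge> n" for k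
  proof -
    have "A ^\<^sub>m (Suc k) = P * (l ^ k \<cdot>\<^sub>m D) * Q"
      unfolding pow D_def using bidiagonal_power[OF w(5) bi J' l that] by simp
    also have "P * (l ^ k \<cdot>\<^sub>m D) = l ^ k \<cdot>\<^sub>m (P * D)" by (rule mult_smult_distrib[OF w(6) D])
    also have "(l ^ k \<cdot>\<^sub>m (P * D)) * Q = l ^ k \<cdot>\<^sub>m B"
      unfolding B_def by (rule mult_smult_assoc_mat[OF mult_carrier_mat[OF w(6) D] w(7)])
    finally show ?thesis .
  qed
  show ?thesis by (rule that[OF B N Apow Tinv T0 TT TAT lim])
qed

section \<open>Rank one matrices and rank one powers\<close>

definition rank1 :: "nat \<Rightarrow> (nat \<Rightarrow> real) \<Rightarrow> (nat \<Rightarrow> real) \<Rightarrow> real mat" where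
  "rank1 n x y = mat n n (\<lambda>(i,j). x i * y j)"

lemma rank1_carrier [simp]: "rank1 n x y \<in> carrier_mat n n"
  unfolding rank1_def by auto

lemma rank1_index [simp]: "i < n \<Longrightarrow> j < n \<Longrightarrow> rank1 n x y $$ (i,j) = x i * y j"
  "dim_row (rank1 n x y) = n" "dim_col (rank1 n x y) = n"
  unfolding rank1_def by auto

lemma mult_rank1:
  "M \<in> carrier_mat n n \<Longrightarrow> M * rank1 n x y = rank1 n (\<lambda>i. \<Sum>l<n. M $$ (i,l) * x l) y"
  by (rule eq_matI) (simp_all add: index_mult_sum[of _ n n _ n] sum_distrib_right mult.assoc del: index_mult_mat(1))

lemma rank1_mult:
  "M \<in> carrier_mat n n \<Longrightarrow> rank1 n x y * M = rank1 n x (\<lambda>j. \<Sum>l<n. y l * M $$ (l,j))"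
  by (rule eq_matI) (simp_all add: index_mult_sum[of _ n n _ n] sum_distrib_left mult.assoc del: index_mult_mat(1))

lemma rank1_mult_rank1: "rank1 n x y * rank1 n z w = (\<Sum>l<n. y l * z l) \<cdot>\<^sub>m rank1 n x w"
  by (rule eq_matI)
    (simp_all add: index_mult_sum[of _ n n _ n] sum_distrib_left sum_distrib_right mult_ac del: index_mult_mat(1))

text \<open>
  For positive \<open>x\<close> and small positive \<open>e\<close>, all columns of \<open>perturb n e x (\<lambda>_. 1)\<close> are close to \<open>x\<close>, so they span a narrow cone
  around \<open>x\<close>. Since \<open>x\<close> is an eigenvector of this matrix for the eigenvalue \<open>e\<close> plus the sum of the
  entries of \<open>x\<close>, it lies in that cone with coordinates that are a multiple of \<open>x\<close>.
\<close>

definition perturb :: "nat \<Rightarrow> real \<Rightarrow> (nat \<Rightarrow> real) \<Rightarrow> (nat \<Rightarrow> real) \<Rightarrow> real mat" where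
  "perturb n e x y = e \<cdot>\<^sub>m 1\<^sub>m n + rank1 n x y"

text \<open>
  The Sherman--Morrison formula.
\<close>

definition perturb_inv :: "nat \<Rightarrow> real \<Rightarrow> (nat \<Rightarrow> real) \<Rightarrow> (nat \<Rightarrow> real) \<Rightarrow> real mat" where
  "perturb_inv n e x y =
     (1 / e) \<cdot>\<^sub>m 1\<^sub>m n + (- 1 / (e * (e + (\<Sum>l<n. y l * x l)))) \<cdot>\<^sub>m rank1 n x y"

lemma perturb_carrier [simp]: 
  "perturb n e x y \<in> carrier_mat n n" "perturb_inv n e x y \<in> carrier_mat n n"
  unfolding perturb_def perturb_inv_def by auto

lemma mult_perturb_index:
  assumes M: "M \<in> carrier_mat n n" and ij: "i < n" "j < n"
  shows "(M * (a \<cdot>\<^sub>m 1\<^sub>m n + b \<cdot>\<^sub>m rank1 n x y)) $$ (i,j) = a * M $$ (i,j) + b * ((\<Sum>l<n. M $$ (i,l) * x l) * y j)"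
proof -
  have "M * (a \<cdot>\<^sub>m 1\<^sub>m n + b \<cdot>\<^sub>m rank1 n x y) = M * (a \<cdot>\<^sub>m 1\<^sub>m n) + M * (b \<cdot>\<^sub>m rank1 n x y)"
    using M by (intro mult_add_distrib_mat[of _ n n]) auto
  moreover have "M * (a \<cdot>\<^sub>m 1\<^sub>m n) = a \<cdot>\<^sub>m M"
    using M mult_smult_distrib[of M n n "1\<^sub>m n" n a] by simp
  moreover have "M * (b \<cdot>\<^sub>m rank1 n x y) = b \<cdot>\<^sub>m (M * rank1 n x y)"
    using M by (intro mult_smult_distrib) auto
  ultimately show ?thesis using ij M by (simp add: mult_rank1 del: index_mult_mat(1))
qed

lemma perturb_mult_index:
  assumes M: "M \<in> carrier_mat n n" and ij: "i < n" "j < n"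
  shows "((a \<cdot>\<^sub>m 1\<^sub>m n + b \<cdot>\<^sub>m rank1 n x y) * M) $$ (i,j) = a * M $$ (i,j) + b * (x i * (\<Sum>l<n. y l * M $$ (l,j)))"
proof -
  have "(a \<cdot>\<^sub>m 1\<^sub>m n + b \<cdot>\<^sub>m rank1 n x y) * M = (a \<cdot>\<^sub>m 1\<^sub>m n) * M + (b \<cdot>\<^sub>m rank1 n x y) * M"
    using M by (intro add_mult_distrib_mat[of _ n n]) auto
  moreover have "(a \<cdot>\<^sub>m 1\<^sub>m n) * M = a \<cdot>\<^sub>m M"
    using M mult_smult_assoc_mat[of "1\<^sub>m n" n n M n a] by simp
  moreover have "(b \<cdot>\<^sub>m rank1 n x y) * M = b \<cdot>\<^sub>m (rank1 n x y * M)"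
    using M by (intro mult_smult_assoc_mat) auto
  ultimately show ?thesis using ij M by (simp add: rank1_mult del: index_mult_mat(1))
qed

lemma perturb_coefficient:
  assumes "e \<noteq> (0::real)" "e + s \<noteq> 0"
  shows "1 / e * w + - 1 / (e * (e + s)) * (s * w) = 1 / (e + s) * w"
proof -
  define t where "t = e + s"
  have t: "t \<noteq> 0" "s = t - e" using assms unfolding t_def by auto
  show ?thesis unfolding t_def[symmetric] t(2) using assms(1) t(1) by (simp add: field_simps)
qed

lemma perturb_coefficient_identity:
  assumes "e \<noteq> (0::real)" "e + s \<noteq> 0"
  shows "1 / e * (e * d + w) + - 1 / (e * (e + s)) * ((e + s) * w) = d"
proof -
  define t where "t = e + s"
  have t: "t \<noteq> 0" using assms unfolding t_def by auto
  show ?thesis unfolding t_def[symmetric] using assms(1) t by (simp add: field_simps)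
qed

lemma inv_pair_perturb:
  assumes e: "e \<noteq> 0" and s: "e + (\<Sum>l<n. y l * x l) \<noteq> 0"
  shows "inv_pair n (perturb n e x y) (perturb_inv n e x y)"
proof -
  define s where "s = (\<Sum>l<n. y l * x l)"
  have r: "(\<Sum>l<n. rank1 n x y $$ (i,l) * x l) = x i * s" if "i < n" for i
    using that by (simp add: s_def sum_distrib_left mult.assoc)
  have sum1: "(\<Sum>l<n. ((if i = l then 1 else 0) * x l)) = x i" if "i < n" for i
    using that by (simp add: if_distrib if_distribR cong: if_cong)
  have P: "(\<Sum>l<n. perturb n e x y $$ (i,l) * x l) = (e + s) * x i" if "i < n" for i
  proof -
    have "(\<Sum>l<n. perturb n e x y $$ (i,l) * x l) = (\<Sum>l<n. e * ((if i = l then 1 else 0) * x l) + rank1 n x y $$ (i,l) * x l)"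
      using that by (intro sum.cong) (auto simp: perturb_def algebra_simps)
    then show ?thesis using r[OF that] sum1[OF that]
      by (simp add: sum.distrib algebra_simps flip: sum_distrib_left)
  qed
  have Q: "(\<Sum>l<n. y l * perturb n e x y $$ (l,j)) = (e + s) * y j" if "j < n" for j
  proof -
    have "(\<Sum>l<n. y l * perturb n e x y $$ (l,j)) = (\<Sum>l<n. (if l = j then e * y l else 0) + y j * (y l * x l))"
      using that by (intro sum.cong) (auto simp: perturb_def algebra_simps)
    also have "\<dots> = e * y j + y j * s"
      using that by (simp add: sum.distrib s_def sum_distrib_left)
    finally show ?thesis by (simp add: algebra_simps)
  qed
  have "perturb n e x y * perturb_inv n e x y = 1\<^sub>m n"
  proof (rule eq_matI)
    fix i j assume "i < dim_row (1\<^sub>m n :: real mat)" "j < dim_col (1\<^sub>m n :: real mat)"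
    then have ij: "i < n" "j < n" by auto
    have "(perturb n e x y * perturb_inv n e x y) $$ (i,j) = 
       1 / e * perturb n e x y $$ (i,j) + - 1 / (e * (e + s)) * ((e + s) * x i * y j)"
      unfolding perturb_inv_def s_def[symmetric] using ij P[of i]
      by (subst mult_perturb_index) auto
    also have "\<dots> = 1\<^sub>m n $$ (i,j)"
      using ij perturb_coefficient_identity[of e s "1\<^sub>m n $$ (i,j)" "x i * y j"] e s
      unfolding s_def[symmetric] by (simp add: perturb_def mult_ac)
    finally show "(perturb n e x y * perturb_inv n e x y) $$ (i,j) = 1\<^sub>m n $$ (i,j)" .
  qed (auto simp: perturb_def perturb_inv_def)
  moreover have "perturb_inv n e x y * perturb n e x y = 1\<^sub>m n"
  proof (rule eq_matI)
    fix i j assume "i < dim_row (1\<^sub>m n :: real mat)" "j < dim_col (1\<^sub>m n :: real mat)"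
    then have ij: "i < n" "j < n" by auto
    have "(perturb_inv n e x y * perturb n e x y) $$ (i,j) = 
       1 / e * perturb n e x y $$ (i,j) + - 1 / (e * (e + s)) * (x i * ((e + s) * y j))"
      unfolding perturb_inv_def s_def[symmetric] using ij Q[of j]
      by (subst perturb_mult_index) auto
    also have "\<dots> = 1\<^sub>m n $$ (i,j)"
      using ij perturb_coefficient_identity[of e s "1\<^sub>m n $$ (i,j)" "x i * y j"] e s
      unfolding s_def[symmetric] by (simp add: perturb_def mult_ac)
    finally show "(perturb_inv n e x y * perturb n e x y) $$ (i,j) = 1\<^sub>m n $$ (i,j)" .
  qed (auto simp: perturb_def perturb_inv_def)
  ultimately show ?thesis unfolding inv_pair_def by simp
qed

lemma perturb_inv_mult_rank1:
  assumes "e \<noteq> 0" "e + (\<Sum>l<n. y l * x l) \<noteq> 0"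
  shows "perturb_inv n e x y * rank1 n x z = (1 / (e + (\<Sum>l<n. y l * x l))) \<cdot>\<^sub>m rank1 n x z"
proof -
  define s where "s = (\<Sum>l<n. y l * x l)"
  show ?thesis unfolding s_def[symmetric] 
  proof (rule eq_matI)
    fix i j assume "i < dim_row ((1 / (e + s)) \<cdot>\<^sub>m rank1 n x z)" "j < dim_col ((1 / (e + s)) \<cdot>\<^sub>m rank1 n x z)"
    then have ij: "i < n" "j < n" by auto
    have q: "(\<Sum>l<n. y l * rank1 n x z $$ (l,j)) = s * z j"
      using ij by (simp add: s_def sum_distrib_right mult.assoc)
    have "(perturb_inv n e x y * rank1 n x z) $$ (i,j) = 1 / e * (x i * z j) + - 1 / (e * (e + s)) * (x i * (s * z j))"
      unfolding perturb_inv_def s_def[symmetric] using ij q by (subst perturb_mult_index) auto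
    also have "\<dots> = 1 / (e + s) * (x i * z j)"
      using perturb_coefficient[of e s "x i * z j"] assms unfolding s_def[symmetric] by (simp add: mult.left_commute)
    finally show "(perturb_inv n e x y * rank1 n x z) $$ (i,j) = ((1 / (e + s)) \<cdot>\<^sub>m rank1 n x z) $$ (i,j)"
      using ij by simp
  qed (auto simp: perturb_inv_def)
qed

lemma rank1_mult_perturb_inv:
  assumes "e \<noteq> 0" "e + (\<Sum>l<n. y l * x l) \<noteq> 0"
  shows "rank1 n z y * perturb_inv n e x y = (1 / (e + (\<Sum>l<n. y l * x l))) \<cdot>\<^sub>m rank1 n z y"
proof -
  define s where "s = (\<Sum>l<n. y l * x l)"
  show ?thesis unfolding s_def[symmetric] 
  proof (rule eq_matI)
    fix i j assume "i < dim_row ((1 / (e + s)) \<cdot>\<^sub>m rank1 n z y)" "j < dim_col ((1 / (e + s)) \<cdot>\<^sub>m rank1 n z y)"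
    then have ij: "i < n" "j < n" by auto
    have q: "(\<Sum>l<n. rank1 n z y $$ (i,l) * x l) = z i * s"
      using ij by (simp add: s_def sum_distrib_left mult.assoc)
    have "(rank1 n z y * perturb_inv n e x y) $$ (i,j) = 1 / e * (z i * y j) + - 1 / (e * (e + s)) * (z i * s * y j)"
      unfolding perturb_inv_def s_def[symmetric] using ij q by (subst mult_perturb_index) auto
    also have "\<dots> = 1 / (e + s) * (z i * y j)"
      using perturb_coefficient[of e s "z i * y j"] assms unfolding s_def[symmetric] by (simp add: mult_ac)
    finally show "(rank1 n z y * perturb_inv n e x y) $$ (i,j) = ((1 / (e + s)) \<cdot>\<^sub>m rank1 n z y) $$ (i,j)"
      using ij by simp
  qed (auto simp: perturb_inv_def)
qed

text \<open>
  The form of being eventually rank one that passes along strong shift equivalences: one power has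
  rank one, and from there on multiplication by \<open>A\<close> is multiplication by \<open>l\<close>.
\<close>

definition rank1_powers :: "nat \<Rightarrow> real mat \<Rightarrow> real \<Rightarrow> bool" where
  "rank1_powers n A l \<longleftrightarrow> A \<in> carrier_mat n n \<and> 0 < l \<and>
     (\<exists>M x y. A ^\<^sub>m M = rank1 n x y \<and> A ^\<^sub>m Suc M = l \<cdot>\<^sub>m A ^\<^sub>m M \<and> A ^\<^sub>m M \<noteq> 0\<^sub>m n n)"

lemma pow_mat_add:
  assumes "A \<in> carrier_mat n n" shows "A ^\<^sub>m (a + b) = A ^\<^sub>m a * A ^\<^sub>m b"
proof (induction b)
  case (Suc b)
  have "A ^\<^sub>m (a + Suc b) = A ^\<^sub>m a * A ^\<^sub>m b * A" using Suc by simp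
  also have "\<dots> = A ^\<^sub>m a * (A ^\<^sub>m b * A)" using assms by (intro assoc_mult_mat[of _ n n _ n _ n]) auto
  finally show ?case by simp
qed (use assms in simp)

lemma rank1_powers_ge:
  assumes "(A :: real mat) \<in> carrier_mat n n" "A ^\<^sub>m Suc M = l \<cdot>\<^sub>m A ^\<^sub>m M"
  shows "A ^\<^sub>m (M + k) = l ^ k \<cdot>\<^sub>m A ^\<^sub>m M"
proof (induction k)
  case (Suc k)
  have c: "A ^\<^sub>m M \<in> carrier_mat n n" using assms(1) by simp
  have "A ^\<^sub>m (M + Suc k) = (l ^ k \<cdot>\<^sub>m A ^\<^sub>m M) * A" using Suc by simp
  also have "\<dots> = l ^ k \<cdot>\<^sub>m (A ^\<^sub>m Suc M)" 
    unfolding pow_mat.simps by (rule mult_smult_assoc_mat[OF c assms(1)])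
  finally show ?case unfolding assms(2) using c by (auto intro!: eq_matI)
qed (auto intro!: eq_matI)

lemma smult_rank1: "a \<cdot>\<^sub>m rank1 n x y = rank1 n (\<lambda>i. a * x i) y"
  by (auto intro!: eq_matI)

text \<open>
  The semisimple part \<open>B\<close> of \<open>A\<close> is proportional to the high powers of \<open>A\<close>, hence of rank one, and
  \<open>B * B = l \<cdot>\<^sub>m B\<close> determines the pairing of its two factors.
\<close>

lemma rank1_powers_scaling:
  assumes "rank1_powers n A l"
  obtains x y N T where "N \<in> carrier_mat n n"
    "\<And>k. k \<ge> n \<Longrightarrow> A ^\<^sub>m (Suc k) = l ^ k \<cdot>\<^sub>m rank1 n x y"
    "\<And>s. inv_pair n (T s) (T (- s))" "T 0 = 1\<^sub>m n" "\<And>s t. T (s + t) = T s * T t"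
    "\<And>s. T s * A * T (- s) = rank1 n x y + exp (- s) \<cdot>\<^sub>m N" "mat_tendsto T (1\<^sub>m n) (at 0)"
    "(\<Sum>i<n. y i * x i) = l"
proof -
  obtain M x y where A: "A \<in> carrier_mat n n" and l: "0 < l" and M: "A ^\<^sub>m M = rank1 n x y"
     "A ^\<^sub>m Suc M = l \<cdot>\<^sub>m A ^\<^sub>m M" "A ^\<^sub>m M \<noteq> 0\<^sub>m n n" using assms unfolding rank1_powers_def by blast
  obtain B N T where B: "B \<in> carrier_mat n n" and N: "N \<in> carrier_mat n n"
    and pow: "\<And>k. k \<ge> n \<Longrightarrow> A ^\<^sub>m (Suc k) = l ^ k \<cdot>\<^sub>m B"
    and T: "\<And>s. inv_pair n (T s) (T (- s))" "T 0 = 1\<^sub>m n" "\<And>s t. T (s + t) = T s * T t"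
    "\<And>s. T s * A * T (- s) = B + exp (- s) \<cdot>\<^sub>m N" "mat_tendsto T (1\<^sub>m n) (at 0)"
    using jordan_scaling[OF A M(2)] l by (metis less_irrefl)
  have e: "l ^ (M + n) \<cdot>\<^sub>m B = l ^ (Suc n) \<cdot>\<^sub>m rank1 n x y"
    using pow[of "M + n"] rank1_powers_ge[OF A M(2), of "Suc n"] M(1) by simp
  define a where "a = l ^ (Suc n) / l ^ (M + n)"
  have a: "a > 0" using l unfolding a_def by simp
  have Bx: "B = rank1 n (\<lambda>i. a * x i) y"
  proof (rule eq_matI)
    fix i j assume "i < dim_row (rank1 n (\<lambda>i. a * x i) y)" "j < dim_col (rank1 n (\<lambda>i. a * x i) y)"
    then have ij: "i < n" "j < n" by auto
    have "(l ^ (M + n) \<cdot>\<^sub>m B) $$ (i,j) = (l ^ (Suc n) \<cdot>\<^sub>m rank1 n x y) $$ (i,j)" using e by simp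
    then have "l ^ (M + n) * B $$ (i,j) = l ^ (Suc n) * (x i * y j)" using ij B by simp
    then show "B $$ (i,j) = rank1 n (\<lambda>i. a * x i) y $$ (i,j)"
      using ij l unfolding a_def by (simp add: field_simps)
  qed (use B in auto)
  have "(\<Sum>i<n. y i * (a * x i)) = l"
  proof -
    define s where "s = (\<Sum>i<n. y i * (a * x i))"
    have "A ^\<^sub>m (Suc n + Suc n) = A ^\<^sub>m Suc n * A ^\<^sub>m Suc n" by (rule pow_mat_add[OF A])
    then have "l ^ (Suc (2 * n)) \<cdot>\<^sub>m B = (l ^ n \<cdot>\<^sub>m B) * (l ^ n \<cdot>\<^sub>m B)"
      using pow[of "Suc (2 * n)"] pow[of n] by (simp add: mult_2 del: pow_mat.simps)
    also have "\<dots> = (l ^ n * l ^ n * s) \<cdot>\<^sub>m B"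
      unfolding Bx smult_rank1 rank1_mult_rank1 s_def
      by (auto intro!: eq_matI simp: sum_distrib_left sum_distrib_right mult_ac)
    finally have f: "l ^ (Suc (2 * n)) \<cdot>\<^sub>m B = (l ^ n * l ^ n * s) \<cdot>\<^sub>m B" .
    have "\<exists>i<n. \<exists>j<n. x i * y j \<noteq> 0"
    proof (rule ccontr)
      assume "\<not> ?thesis"
      then have "A ^\<^sub>m M = 0\<^sub>m n n" unfolding M(1) by (auto intro!: eq_matI)
      then show False using M(3) by simp
    qed
    then obtain i j where ij: "i < n" "j < n" "x i * y j \<noteq> 0" by blast
    have "(l ^ (Suc (2 * n)) \<cdot>\<^sub>m B) $$ (i,j) = ((l ^ n * l ^ n * s) \<cdot>\<^sub>m B) $$ (i,j)" using f by simp
    then have "l ^ (Suc (2 * n)) = l ^ n * l ^ n * s" using ij a B unfolding Bx by simp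
    moreover have "l ^ (Suc (2 * n)) = l * (l ^ n * l ^ n)" by (simp add: mult_2 power_add)
    ultimately have "l * (l ^ n * l ^ n) = s * (l ^ n * l ^ n)" by (metis mult.commute)
    moreover have "l ^ n * l ^ n \<noteq> 0" using l by simp
    ultimately have "l = s" by (metis mult_right_cancel)
    then show ?thesis unfolding s_def by simp
  qed
  then show ?thesis using that[OF N _ T(1-3) _ T(5), of "\<lambda>i. a * x i" y] pow T(4) unfolding Bx by simp
qed

section \<open>Positive forms of one matrix are equivalent\<close>

lemma pow_conj:
  assumes g: "inv_pair n g g'" and A: "A \<in> carrier_mat n n"
  shows "(g' * A * g) ^\<^sub>m k = g' * A ^\<^sub>m k * g"
proof -
  note c = inv_pair_carrier[OF g]
  note as = assoc_mult_mat[of _ n n _ n _ n] and mc = mult_carrier_mat[of _ n n _ n]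
  show ?thesis
  proof (induction k)
    case 0
    have "g' * g = 1\<^sub>m n" using g unfolding inv_pair_def by blast
    then show ?case using c A by simp
  next
    case (Suc k)
    have "(g' * A ^\<^sub>m k * g) * (g' * A * g) = g' * (A ^\<^sub>m k * (g * (g' * (A * g))))"
      using c A by (simp add: as mc)
    also have "\<dots> = g' * (A ^\<^sub>m k * (A * g))" using inv_pair_cancel[OF g, where k = n] c A by (simp add: mc)
    finally show ?case using c A Suc by (simp add: as mc)
  qed
qed

lemma pos_mat_perturb:
  assumes "0 < e" "\<And>i. i < n \<Longrightarrow> 0 < x i" "\<And>i. i < n \<Longrightarrow> 0 < y i"
  shows "pos_mat (perturb n e x y)"
  by (rule pos_matI[of _ n n]) (use assms in \<open>auto simp: perturb_def intro!: add_pos_pos\<close>)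

lemma smult_tendsto_zero:
  assumes "(c \<longlongrightarrow> 0) F" "B \<in> carrier_mat n m" "N \<in> carrier_mat n m"
  shows "mat_tendsto (\<lambda>x. B + c x \<cdot>\<^sub>m N) B F"
proof (rule mat_tendstoI)
  fix i j assume ij: "i < n" "j < m"
  have "((\<lambda>x. B $$ (i,j) + c x * N $$ (i,j)) \<longlongrightarrow> B $$ (i,j) + 0 * N $$ (i,j)) F"
    using assms(1) by (intro tendsto_intros)
  then show "((\<lambda>x. (B + c x \<cdot>\<^sub>m N) $$ (i,j)) \<longlongrightarrow> B $$ (i,j)) F" using ij assms by simp
qed (use assms in auto)

text \<open>
  The identity plus a small multiple of the all-ones matrix has positive entries, while its inverse
  is close to the identity.
\<close>

lemma exists_narrow_cone:
  assumes B: "B \<in> carrier_mat n n" "pos_mat B" and C: "C \<in> carrier_mat n n" "pos_mat C"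
  obtains k k' where "inv_pair n k k'" "pos_mat k" "pos_mat (k' * B * k')" "pos_mat (k' * C * k')"
proof -
  define d where "d m = 1 / real (Suc m)" for m
  define k' where "k' m = perturb_inv n 1 (\<lambda>_. d m) (\<lambda>_. 1)" for m
  have d: "d m > 0" for m unfolding d_def by simp
  have d0: "d \<longlonglongrightarrow> 0" unfolding d_def using LIMSEQ_inverse_real_of_nat by (simp add: inverse_eq_divide)
  have ip: "inv_pair n (perturb n 1 (\<lambda>_. d m) (\<lambda>_. 1)) (k' m)" for m
    unfolding k'_def using d[of m]
    by (intro inv_pair_perturb) (auto simp: add_nonneg_eq_0_iff)
  have kc: "k' m \<in> carrier_mat n n" for m unfolding k'_def by simp
  have lim: "mat_tendsto k' (1\<^sub>m n) sequentially"
  proof (rule mat_tendstoI[of _ n n])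
    fix i j assume ij: "i < n" "j < n"
    have "(\<lambda>m. 1\<^sub>m n $$ (i,j) + - 1 / (1 + real n * d m) * d m) \<longlonglongrightarrow> 1\<^sub>m n $$ (i,j) + - 1 / (1 + real n * 0) * 0"
      using d0 by (intro tendsto_intros) auto
    then show "(\<lambda>m. k' m $$ (i,j)) \<longlonglongrightarrow> 1\<^sub>m n $$ (i,j)"
      using ij by (simp add: k'_def perturb_inv_def)
  qed (use kc in auto)
  have ev: "\<forall>\<^sub>F m in sequentially. pos_mat (k' m * B * k' m)"
    if "B \<in> carrier_mat n n" "pos_mat B" for B
  proof -
    have "mat_tendsto (\<lambda>m. k' m * B * k' m) (1\<^sub>m n * B * 1\<^sub>m n) sequentially"
      using lim that by (intro mat_tendsto_mult[of _ _ _ _ _ n n n] mat_tendsto_const) auto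
    then show ?thesis using that by (intro eventually_pos_mat) auto
  qed
  have "\<forall>\<^sub>F m in sequentially. pos_mat (k' m * B * k' m) \<and> pos_mat (k' m * C * k' m)"
    using ev[OF B] ev[OF C] by (rule eventually_conj)
  then obtain m where "pos_mat (k' m * B * k' m)" "pos_mat (k' m * C * k' m)"
    using eventually_happens'[OF sequentially_bot] by blast
  then show ?thesis using that[OF ip[of m]] pos_mat_perturb[of 1 n "\<lambda>_. d m" "\<lambda>_. 1"] d[of m] by auto
qed

lemma pos_mat_convex:
  assumes "B \<in> carrier_mat n n" "pos_mat B" "N \<in> carrier_mat n n" "pos_mat (B + N)" "0 < u" "u \<le> (1::real)"
  shows "pos_mat (B + u \<cdot>\<^sub>m N)"
proof (rule pos_matI)
  fix i j assume ij: "i < n" "j < n"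
  have "B + N \<in> carrier_mat n n" using assms by simp
  then have "0 < B $$ (i,j)" "0 < (B + N) $$ (i,j)"
    using pos_matD[OF assms(2,1) ij] pos_matD[OF assms(4) _ ij] by blast+
  then have "0 \<le> (1 - u) * B $$ (i,j)" "0 < u * (B + N) $$ (i,j)"
    using assms(5,6) by auto
  then have "0 < (1 - u) * B $$ (i,j) + u * (B + N) $$ (i,j)" by linarith
  also have "\<dots> = (B + u \<cdot>\<^sub>m N) $$ (i,j)" using ij assms by (simp add: algebra_simps)
  finally show "0 < (B + u \<cdot>\<^sub>m N) $$ (i,j)" .
qed (use assms in auto)

lemma conj_add_smult:
  assumes "(p::real mat) \<in> carrier_mat n n" "q \<in> carrier_mat n n" "B \<in> carrier_mat n n" "N \<in> carrier_mat n n"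
  shows "p * (B + u \<cdot>\<^sub>m N) * q = p * B * q + u \<cdot>\<^sub>m (p * N * q)"
proof -
  have "p * (B + u \<cdot>\<^sub>m N) = p * B + u \<cdot>\<^sub>m (p * N)"
    using assms mult_smult_distrib[OF assms(1,4), of u] mult_add_distrib_mat[of p n n B n "u \<cdot>\<^sub>m N"] by simp
  moreover have "(p * B + u \<cdot>\<^sub>m (p * N)) * q = p * B * q + (u \<cdot>\<^sub>m (p * N)) * q"
    using assms by (intro add_mult_distrib_mat[of _ n n]) auto
  moreover have "(u \<cdot>\<^sub>m (p * N)) * q = u \<cdot>\<^sub>m (p * N * q)"
    using assms by (intro mult_smult_assoc_mat[of _ n n _ n]) auto
  ultimately show ?thesis by simp
qed

text \<open>
  A matrix together with the one-parameter group that scales its nilpotent part \<open>N\<close>. Conjugating by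
  \<open>T s\<close> means to move a cone by \<open>T (- s)\<close>.
\<close>

locale scaling_flow =
  fixes n :: nat and A B N :: "real mat" and T :: "real \<Rightarrow> real mat"
  assumes n0: "0 < n" and A: "A \<in> carrier_mat n n" and B: "B \<in> carrier_mat n n" and N: "N \<in> carrier_mat n n"
    and Tinv: "\<And>s. inv_pair n (T s) (T (- s))" and T0: "T 0 = 1\<^sub>m n"
    and Tadd: "\<And>s t. T (s + t) = T s * T t"
    and TA: "\<And>s. T s * A * T (- s) = B + exp (- s) \<cdot>\<^sub>m N"
    and Tlim: "mat_tendsto T (1\<^sub>m n) (at 0)"
begin

lemma T: "T s \<in> carrier_mat n n" using inv_pair_carrier[OF Tinv] by blast

lemma one_N: "1 \<cdot>\<^sub>m N = N" by (auto intro!: eq_matI)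

lemma A_eq: "A = B + N"
  using TA[of 0] T0 A one_N by simp

lemma moved_pair: "inv_pair n g g' \<Longrightarrow> inv_pair n (T (- s) * g) (g' * T s)"
  using inv_pair_mult[OF inv_pair_sym[OF Tinv]] by blast

text \<open>
  In the moved coordinates, the matrix is a convex combination of its values for \<open>s = 0\<close> and in the
  limit. One narrowing \<open>k\<close> of the cone works for these two, hence for all \<open>s\<close>, and it absorbs a small
  motion \<open>t\<close>; the admissible size of \<open>t\<close> therefore does not depend on \<open>s\<close>.
\<close>

lemma linked_nearby:
  assumes g: "inv_pair n g g'" and pB: "pos_mat (g' * B * g)" and pA: "pos_mat (g' * A * g)"
  shows "\<exists>h>0. \<forall>s\<ge>0. \<forall>t. \<bar>t\<bar> < h \<longrightarrow>
    linked n A (T (- s) * g) (g' * T s) (T (- (s + t)) * g) (g' * T (s + t))"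
proof -
  note gc = inv_pair_carrier[OF g]
  note as = assoc_mult_mat[of _ n n _ n _ n] and mc = mult_carrier_mat[of _ n n _ n]
  have Bc: "g' * B * g \<in> carrier_mat n n" and Nc: "g' * N * g \<in> carrier_mat n n" and Ac: "g' * A * g \<in> carrier_mat n n"
    using gc B N A by auto
  obtain k k' where k: "inv_pair n k k'" "pos_mat k" "pos_mat (k' * (g' * B * g) * k')" "pos_mat (k' * (g' * A * g) * k')"
    using exists_narrow_cone[OF Bc pB Ac pA] by blast
  note kc = inv_pair_carrier[OF k(1)]
  have m1: "mat_tendsto (\<lambda>t. g' * T t * (g * k)) (g' * 1\<^sub>m n * (g * k)) (at 0)"
    using Tlim gc kc by (intro mat_tendsto_mult[of _ _ _ _ _ n n n] mat_tendsto_const) auto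
  have one: "g' * 1\<^sub>m n * (g * k) = k" using inv_pair_cancel[OF g] gc kc by simp
  have ev1: "\<forall>\<^sub>F t in at 0. pos_mat (g' * T t * (g * k))"
    by (rule eventually_pos_mat[OF m1]) (simp only: one k(2))
  have m2: "mat_tendsto (\<lambda>t. k * g' * T t * g) (k * g' * 1\<^sub>m n * g) (at 0)"
    using Tlim gc kc by (intro mat_tendsto_mult[of _ _ _ _ _ n n n] mat_tendsto_const) auto
  have two: "k * g' * 1\<^sub>m n * g = k"
    using inv_pair_cancel_right[OF g kc(1)] right_mult_one_mat[OF mult_carrier_mat[OF kc(1) gc(2)]] by simp
  have ev2: "\<forall>\<^sub>F t in at 0. pos_mat (k * g' * T t * g)"
    by (rule eventually_pos_mat[OF m2]) (simp only: two k(2))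
  have "\<forall>\<^sub>F t in at 0. pos_mat (g' * T t * (g * k)) \<and> pos_mat (k * g' * T t * g)"
    using ev1 ev2 by (rule eventually_conj)
  then obtain h where h: "h > 0" "\<And>t. t \<noteq> 0 \<Longrightarrow> \<bar>t\<bar> < h \<Longrightarrow> pos_mat (g' * T t * (g * k)) \<and> pos_mat (k * g' * T t * g)"
    unfolding eventually_at by (auto simp: dist_real_def)
  have h': "pos_mat (g' * T t * (g * k)) \<and> pos_mat (k * g' * T t * g)" if "\<bar>t\<bar> < h" for t
    using h(2)[of t] that one two k(2) T0 by (cases "t = 0") auto
  have "linked n A (T (- s) * g) (g' * T s) (T (- (s + t)) * g) (g' * T (s + t))"
    if s: "s \<ge> 0" and t: "\<bar>t\<bar> < h" for s t
  proof -
    let ?c = "T (- s) * g * k" and ?c' = "k' * (g' * T s)"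
    let ?d = "k * (g' * T s)" and ?d' = "T (- s) * g * k'"
    have ic: "inv_pair n ?c ?c'" by (rule inv_pair_mult[OF moved_pair[OF g] k(1)])
    have id: "inv_pair n ?d ?d'" by (rule inv_pair_mult[OF k(1) inv_pair_sym[OF moved_pair[OF g]]])
    have cancelT: "T u * (T v * X) = T (u + v) * X" if "X \<in> carrier_mat n n" for u v X
      using T that by (simp add: Tadd as)
    have e: "(g' * T s) * ?c = k"
      using T gc kc inv_pair_cancel[OF g, where k = n] by (simp add: as mc cancelT T0)
    moreover have "(g' * T (s + t)) * ?c = g' * T t * (g * k)"
      using T gc kc by (simp add: as mc cancelT)
    moreover have "?d * (T (- s) * g) = k"
      using T gc kc inv_pair_cancel_right[OF g, where k = n] g by (simp add: as mc cancelT T0 inv_pair_def)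
    moreover have "?d * (T (- (s + t)) * g) = k * g' * T (- t) * g"
      using T gc kc by (simp add: as mc cancelT)
    moreover have "?c' * A * ?d' = k' * (g' * B * g) * k' + exp (- s) \<cdot>\<^sub>m (k' * (g' * N * g) * k')"
    proof -
      have "?c' * A * ?d' = k' * (g' * (T s * A * T (- s)) * g) * k'"
        using T gc kc A by (simp add: as mc)
      also have "\<dots> = k' * (g' * B * g + exp (- s) \<cdot>\<^sub>m (g' * N * g)) * k'"
        unfolding TA using conj_add_smult[OF gc(2,1) B N] by simp
      finally show ?thesis using conj_add_smult[OF kc(2,2) Bc Nc] by simp
    qed
    moreover have "pos_mat (k' * (g' * B * g) * k' + exp (- s) \<cdot>\<^sub>m (k' * (g' * N * g) * k'))"
    proof (rule pos_mat_convex)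
      have "g' * A * g = g' * B * g + 1 \<cdot>\<^sub>m (g' * N * g)"
        using conj_add_smult[OF gc(2,1) B N, of 1] A_eq one_N by simp
      then have "k' * (g' * A * g) * k' = k' * (g' * B * g) * k' + 1 \<cdot>\<^sub>m (k' * (g' * N * g) * k')"
        using conj_add_smult[OF kc(2,2) Bc Nc, of 1] by simp
      moreover have "1 \<cdot>\<^sub>m (k' * (g' * N * g) * k') = k' * (g' * N * g) * k'" by (auto intro!: eq_matI)
      ultimately show "pos_mat (k' * (g' * B * g) * k' + k' * (g' * N * g) * k')" using k(4) by simp
    qed (use k(3) kc gc B N s in auto)
    ultimately show ?thesis unfolding linked_def using ic id k(2) h'[of t] h'[of "- t"] t 
      by (intro exI[of _ ?c] exI[of _ ?c'] exI[of _ ?d] exI[of _ ?d'] conjI) (simp_all only: abs_minus_cancel)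
  qed
  then show ?thesis using h(1) by blast
qed

end

context dense_ring
begin

lemma represents_moved:
  assumes sc: "scaling_flow n A B N T" and U: "mat_over U A" and g: "U_inv n g g'"
    and pos: "pos_mat (g' * B * g)" "pos_mat (g' * A * g)" and s: "0 \<le> s"
  shows "represents n A (T (- s) * g) (g' * T s) (g' * A * g)"
proof -
  interpret sc: scaling_flow n A B N T by (rule sc)
  note ip = U_invD(1)[OF g]
  obtain h where h: "h > 0" "\<And>s t. s \<ge> 0 \<Longrightarrow> \<bar>t\<bar> < h \<Longrightarrow>
    linked n A (T (- s) * g) (g' * T s) (T (- (s + t)) * g) (g' * T (s + t))"
    using sc.linked_nearby[OF ip pos] by blast
  obtain m' :: nat where m': "s / h < real m'" using reals_Archimedean2 by blast
  define m where "m = Suc m'"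
  have "s / h < real m" using m' unfolding m_def by simp
  then have "s < real m * h" using h(1) by (simp add: pos_divide_less_eq)
  then have m: "0 < m" "s / real m < h" unfolding m_def by (simp_all add: pos_divide_less_eq mult.commute)
  have "represents n A (T (- (s / m * k)) * g) (g' * T (s / m * k)) (g' * A * g)" for k :: nat
  proof (induction k)
    case 0
    have "T (- 0) * g = g" "g' * T 0 = g'" using sc.T0 inv_pair_carrier[OF ip] by auto
    then show ?case using represents_U_basis[OF g] by simp
  next
    case (Suc k)
    have "linked n A (T (- (s / m * k)) * g) (g' * T (s / m * k))
       (T (- (s / m * k + s / m)) * g) (g' * T (s / m * k + s / m))"
      using s m by (intro h(2)) auto
    then have "represents n A (T (- (s / m * k + s / m)) * g) (g' * T (s / m * k + s / m)) (g' * A * g)"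
      by (rule represents_linked[OF sc.n0 sc.A U _ sc.moved_pair[OF ip] Suc])
    moreover have "s / m * k + s / m = s / m * Suc k" by (simp add: algebra_simps add_divide_distrib)
    ultimately show ?case by (simp only:)
  qed
  from this[of m] show ?thesis using m(1) by simp
qed

lemma exp_minus_tendsto_zero: "((\<lambda>s::real. exp (- s)) \<longlongrightarrow> 0) at_top"
  by (rule filterlim_compose[OF exp_at_bot filterlim_uminus_at_bot_at_top])

lemma perturb_alt: "perturb n e x y = rank1 n x y + e \<cdot>\<^sub>m 1\<^sub>m n"
  unfolding perturb_def by (rule comm_add_mat[of _ n n]) auto

lemma perturb_tendsto: "mat_tendsto (\<lambda>e. perturb n e x y) (rank1 n x y) (at_right 0)"
  unfolding perturb_alt by (rule smult_tendsto_zero[of _ _ _ n n]) auto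

text \<open>
  Both cones are moved by \<open>T (- s)\<close> until the matrix is dominated by its rank one part. Then narrow
  cones around \<open>x\<close> and, for covectors, around \<open>y\<close> link them, since the coefficients of
  \<open>rank1 n x y\<close> in these narrow cones are again a positive multiple of \<open>rank1 n x y\<close>.
\<close>

lemma conj_positive_core:
  assumes sc: "scaling_flow n A (rank1 n x y) N T" and U: "mat_over U A" and g: "U_inv n g g'"
    and pos: "pos_mat A" "pos_mat (g' * A * g)"
    and x: "\<And>i. i < n \<Longrightarrow> 0 < x i" and y: "\<And>i. i < n \<Longrightarrow> 0 < y i"
    and gx: "\<And>i. i < n \<Longrightarrow> 0 < (\<Sum>l<n. g' $$ (i,l) * x l)"
    and gy: "\<And>j. j < n \<Longrightarrow> 0 < (\<Sum>l<n. y l * g $$ (l,j))"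
  shows "sse Uplus A (g' * A * g)"
proof -
  interpret sc: scaling_flow n A "rank1 n x y" N T by (rule sc)
  note ip = U_invD(1)[OF g]
  note gc = U_inv_carrier[OF g]
  have posB: "pos_mat (rank1 n x y)" using x y by (intro pos_matI[of _ n n]) auto
  have posBg: "pos_mat (g' * rank1 n x y * g)"
    unfolding mult_rank1[OF gc(2)] rank1_mult[OF gc(1)]
    using gx gy by (intro pos_matI[of _ n n]) auto
  have rep1: "represents n A (T (- s)) (T s) A" if "0 \<le> s" for s
    using represents_moved[OF sc U U_inv_one _ _ that] posB pos(1) sc.A
      left_mult_one_mat[OF sc.T] right_mult_one_mat[OF sc.T] by simp
  have rep2: "represents n A (T (- s) * g) (g' * T s) (g' * A * g)" if "0 \<le> s" for s
    by (rule represents_moved[OF sc U g posBg pos(2) that])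
  let ?one = "\<lambda>_::nat. 1 :: real"
  have "mat_tendsto (\<lambda>e. g' * perturb n e x ?one) (g' * rank1 n x ?one) (at_right 0)"
    by (rule mat_tendsto_mult[OF mat_tendsto_const perturb_tendsto gc(2) rank1_carrier])
  moreover have "pos_mat (g' * rank1 n x ?one)"
    unfolding mult_rank1[OF gc(2)] using gx by (intro pos_matI[of _ n n]) auto
  ultimately have ev1: "\<forall>\<^sub>F e in at_right 0. pos_mat (g' * perturb n e x ?one)"
    by (rule eventually_pos_mat)
  have "mat_tendsto (\<lambda>e. perturb n e ?one y * g) (rank1 n ?one y * g) (at_right 0)"
    by (rule mat_tendsto_mult[OF perturb_tendsto mat_tendsto_const rank1_carrier gc(1)])
  moreover have "pos_mat (rank1 n ?one y * g)"
    unfolding rank1_mult[OF gc(1)] using gy by (intro pos_matI[of _ n n]) auto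
  ultimately have ev2: "\<forall>\<^sub>F e in at_right 0. pos_mat (perturb n e ?one y * g)"
    by (rule eventually_pos_mat)
  have "\<forall>\<^sub>F e in at_right 0. (0::real) < e \<and> pos_mat (g' * perturb n e x ?one) \<and> pos_mat (perturb n e ?one y * g)"
    using eventually_at_right_less ev1 ev2 by (intro eventually_conj)
  then obtain e :: real where e: "0 < e" "pos_mat (g' * perturb n e x ?one)" "pos_mat (perturb n e ?one y * g)"
    using eventually_happens'[OF trivial_limit_at_right_real] by blast
  define k k' w w' where "k = perturb n e x ?one" and "k' = perturb_inv n e x ?one"
    and "w = perturb n e ?one y" and "w' = perturb_inv n e ?one y"
  have sx: "0 \<le> (\<Sum>l<n. x l)" and sy: "0 \<le> (\<Sum>l<n. y l)"
    using x y by (auto intro!: sum_nonneg simp: less_imp_le)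
  have ipk: "inv_pair n k k'" and ipw: "inv_pair n w w'"
    unfolding k_def k'_def w_def w'_def using e(1) sx sy by (auto intro!: inv_pair_perturb)
  note kc = inv_pair_carrier[OF ipk] inv_pair_carrier[OF ipw]
  have "k' * rank1 n x y * w' = (1 / (e + sum x {..<n}) * (1 / (e + sum y {..<n}))) \<cdot>\<^sub>m rank1 n x y"
  proof -
    have "k' * rank1 n x y = (1 / (e + sum x {..<n})) \<cdot>\<^sub>m rank1 n x y"
      unfolding k'_def using perturb_inv_mult_rank1[of e ?one x n y] e(1) sx by simp
    moreover have "rank1 n x y * w' = (1 / (e + sum y {..<n})) \<cdot>\<^sub>m rank1 n x y"
      unfolding w'_def using rank1_mult_perturb_inv[of e y ?one n x] e(1) sy by simp
    ultimately show ?thesis using kc by (simp add: mult_smult_assoc_mat[of _ n n _ n]) (auto intro!: eq_matI)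
  qed
  then have pk: "pos_mat (k' * rank1 n x y * w')"
    using posB e(1) sx sy by (simp add: pos_mat_smult)
  have "mat_tendsto (\<lambda>s. k' * (rank1 n x y + exp (- s) \<cdot>\<^sub>m N) * w') (k' * rank1 n x y * w') at_top"
    using kc sc.N
    by (intro mat_tendsto_mult[of _ _ _ _ _ n n n] mat_tendsto_const
        smult_tendsto_zero[OF exp_minus_tendsto_zero, of _ n n]) auto
  then have "\<forall>\<^sub>F s in at_top. pos_mat (k' * (rank1 n x y + exp (- s) \<cdot>\<^sub>m N) * w')"
    using pk by (rule eventually_pos_mat)
  then have "\<forall>\<^sub>F s in at_top. 0 \<le> s \<and> pos_mat (k' * (rank1 n x y + exp (- s) \<cdot>\<^sub>m N) * w')"
    using eventually_ge_at_top by (intro eventually_conj)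
  then obtain s where s: "0 \<le> s" "pos_mat (k' * (rank1 n x y + exp (- s) \<cdot>\<^sub>m N) * w')"
    using eventually_happens'[OF trivial_limit_at_top_linorder] by blast
  let ?c = "T (- s) * k" and ?c' = "k' * T s" and ?d = "w * T s" and ?d' = "T (- s) * w'"
  note as = assoc_mult_mat[of _ n n _ n _ n] and mc = mult_carrier_mat[of _ n n _ n]
  note Tc = sc.T
  have TT: "T s * (T (- s) * X) = X" "T (- s) * (T s * X) = X" if "X \<in> carrier_mat n n" for X
    using inv_pair_cancel[OF sc.Tinv[of s] that] by auto
  have "linked n A (T (- s)) (T s) (T (- s) * g) (g' * T s)"
    unfolding linked_def
  proof (intro exI conjI)
    show "inv_pair n ?c ?c'" by (rule inv_pair_mult[OF inv_pair_sym[OF sc.Tinv] ipk])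
    show "inv_pair n ?d ?d'" by (rule inv_pair_mult[OF ipw sc.Tinv])
    show "pos_mat (T s * ?c)" using TT kc pos_mat_perturb[of e n x ?one] e(1) x
      by (simp add: k_def)
    show "pos_mat (g' * T s * ?c)" using TT kc gc Tc e(2) by (simp add: as mc k_def)
    show "pos_mat (?d * T (- s))" 
      using inv_pair_cancel_right[OF sc.Tinv[of s] kc(3)] pos_mat_perturb[of e n ?one y] e(1) y
      by (simp only: w_def)
    show "pos_mat (?d * (T (- s) * g))" using TT kc gc Tc e(3) by (simp add: as mc w_def)
    have "?c' * A * ?d' = k' * (T s * A * T (- s)) * w'"
      using kc Tc sc.A by (simp add: as mc)
    then show "pos_mat (?c' * A * ?d')" unfolding sc.TA using s(2) by simp
  qed
  then show ?thesis
    by (rule represents_unique[OF sc.n0 sc.A U _ rep1[OF s(1)] rep2[OF s(1)]])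
qed

lemma U_inv_uminus:
  assumes "U_inv n g g'" shows "U_inv n (- g) (- g')"
proof -
  note c = U_inv_carrier[OF assms]
  have "mat_over U (- g)" "mat_over U (- g')"
    using U_invD(2,3)[OF assms] c by (auto simp: mat_over_iff[of _ n n])
  moreover have "inv_pair n (- g) (- g')"
    using U_invD(1)[OF assms] c unfolding inv_pair_def by auto
  ultimately show ?thesis unfolding U_inv_def by auto
qed

lemma smult_pos_mat_cancel: "0 < a \<Longrightarrow> pos_mat (a \<cdot>\<^sub>m B) \<Longrightarrow> pos_mat B"
  unfolding pos_mat_def by (auto simp: zero_less_mult_iff)

text \<open>
  Positivity of \<open>A\<close> and of its conjugate passes to powers, hence to the rank one part in both bases. This
  fixes the signs of the two factors up to a common one, which is corrected by replacing \<open>g\<close> by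
  \<open>- g\<close>; both give the same conjugate.
\<close>

lemma conj_positive:
  assumes n0: "0 < n" and A: "rank1_powers n A l" and U: "mat_over U A" and g: "U_inv n g g'"
    and pos: "pos_mat A" "pos_mat (g' * A * g)"
  shows "sse Uplus A (g' * A * g)"
proof -
  obtain x y N T where N: "N \<in> carrier_mat n n" and
    pow: "\<And>k. k \<ge> n \<Longrightarrow> A ^\<^sub>m (Suc k) = l ^ k \<cdot>\<^sub>m rank1 n x y" and
    T: "\<And>s. inv_pair n (T s) (T (- s))" "T 0 = 1\<^sub>m n" "\<And>s t. T (s + t) = T s * T t"
    "\<And>s. T s * A * T (- s) = rank1 n x y + exp (- s) \<cdot>\<^sub>m N" "mat_tendsto T (1\<^sub>m n) (at 0)"
    and "(\<Sum>i<n. y i * x i) = l"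
    by (rule rank1_powers_scaling[OF A], rule that)
  have Ac: "A \<in> carrier_mat n n" and l: "0 < l" using A unfolding rank1_powers_def by auto
  note ip = U_invD(1)[OF g]
  note gc = U_inv_carrier[OF g]
  define x' y' where "x' = (\<lambda>i. \<bar>x i\<bar>)" and "y' = (\<lambda>i. \<bar>y i\<bar>)"
  have "pos_mat (l ^ n \<cdot>\<^sub>m rank1 n x y)" using pos_mat_pow[OF Ac n0 pos(1), of n] pow[of n] by simp
  then have posB: "pos_mat (rank1 n x y)" by (rule smult_pos_mat_cancel[rotated]) (use l in simp)
  have xy: "0 < x i * y j" if "i < n" "j < n" for i j using pos_matD[OF posB _ that] that by simp
  have B': "rank1 n x y = rank1 n x' y'"
  proof (rule eq_matI)
    fix i j assume "i < dim_row (rank1 n x' y')" "j < dim_col (rank1 n x' y')"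
    then have ij: "i < n" "j < n" by auto
    have "x' i * y' j = x i * y j" unfolding x'_def y'_def abs_mult[symmetric] using xy[OF ij] by (rule abs_of_pos)
    then show "rank1 n x y $$ (i,j) = rank1 n x' y' $$ (i,j)" using ij by simp
  qed auto
  have x': "0 < x' i" and y': "0 < y' i" if "i < n" for i
    using xy[OF that that] by (auto simp: x'_def y'_def)
  have sc: "scaling_flow n A (rank1 n x' y') N T"
    by unfold_locales (use n0 Ac N T B' in auto)
  have "pos_mat (l ^ n \<cdot>\<^sub>m (g' * rank1 n x' y' * g))"
  proof -
    have "(g' * A * g) ^\<^sub>m Suc n = g' * (l ^ n \<cdot>\<^sub>m rank1 n x' y') * g"
      unfolding pow_conj[OF ip Ac] using pow[of n] B' by simp
    also have "\<dots> = l ^ n \<cdot>\<^sub>m (g' * rank1 n x' y' * g)"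
      using gc mult_smult_distrib[OF gc(2), of "rank1 n x' y'" n "l ^ n"]
        mult_smult_assoc_mat[of "g' * rank1 n x' y'" n n g n "l ^ n"] by simp
    finally show ?thesis using pos_mat_pow[of "g' * A * g" n n] gc Ac n0 pos(2) by simp
  qed
  then have posBg: "pos_mat (g' * rank1 n x' y' * g)" by (rule smult_pos_mat_cancel[rotated]) (use l in simp)
  define p q where "p i = (\<Sum>k<n. g' $$ (i,k) * x' k)" and "q j = (\<Sum>k<n. y' k * g $$ (k,j))" for i j
  have pq: "0 < p i * q j" if "i < n" "j < n" for i j
    using pos_matD[OF posBg _ that] that gc
    unfolding mult_rank1[OF gc(2)] rank1_mult[OF gc(1)] p_def q_def by simp
  have ncong: "- g' * A * - g = g' * A * g"
    using gc Ac by simp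
  show ?thesis
  proof (cases "0 < p 0")
    case True
    then have q: "0 < q j" if "j < n" for j using pq[OF n0 that] by (simp add: zero_less_mult_iff)
    then have p: "0 < p i" if "i < n" for i using pq[OF that n0] q[OF n0] by (simp add: zero_less_mult_iff)
    show ?thesis
      by (rule conj_positive_core[OF sc U g pos x' y']) (use p q p_def q_def in auto)
  next
    case False
    then have q: "q j < 0" if "j < n" for j using pq[OF n0 that] by (simp add: zero_less_mult_iff)
    then have p: "p i < 0" if "i < n" for i using pq[OF that n0] q[OF n0] by (simp add: zero_less_mult_iff)
    have "0 < (\<Sum>k<n. (- g') $$ (i,k) * x' k)" if "i < n" for i
      using p[OF that] that gc by (simp add: p_def sum_negf)
    moreover have "0 < (\<Sum>k<n. y' k * (- g) $$ (k,j))" if "j < n" for j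
      using q[OF that] that gc by (simp add: q_def sum_negf)
    ultimately have "sse Uplus A (- g' * A * - g)"
      using pos by (intro conj_positive_core[OF sc U U_inv_uminus[OF g] _ _ x' y']) (auto simp: ncong)
    then show ?thesis by (simp only: ncong)
  qed
qed

end

lemma rank1_cong: "(\<And>i. i < n \<Longrightarrow> x i = x' i) \<Longrightarrow> (\<And>i. i < n \<Longrightarrow> y i = y' i) \<Longrightarrow> rank1 n x y = rank1 n x' y'"
  by (rule eq_matI) auto

section \<open>Rank one powers along elementary steps and existence of positive forms\<close>

lemma mult_pow_swap:
  assumes "(R::real mat) \<in> carrier_mat n m" "T \<in> carrier_mat m n"
  shows "(R * T) ^\<^sub>m Suc k = R * (T * R) ^\<^sub>m k * T"
proof (induction k)
  case (Suc k)
  have TR: "T * R \<in> carrier_mat m m" using assms by simp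
  have p: "(T * R) ^\<^sub>m k \<in> carrier_mat m m" using TR by simp
  have Rp: "R * (T * R) ^\<^sub>m k \<in> carrier_mat n m" using assms p by simp
  have "(R * T) ^\<^sub>m Suc (Suc k) = R * (T * R) ^\<^sub>m k * T * (R * T)" using Suc by simp
  also have "\<dots> = R * (T * R) ^\<^sub>m k * (T * (R * T))"
    by (rule assoc_mult_mat[OF Rp assms(2)]) (use assms in auto)
  also have "T * (R * T) = T * R * T" using assoc_mult_mat[OF assms(2,1,2)] by simp
  also have "R * (T * R) ^\<^sub>m k * (T * R * T) = R * (T * R) ^\<^sub>m k * (T * R) * T"
    using assoc_mult_mat[OF Rp TR assms(2)] by simp
  also have "R * (T * R) ^\<^sub>m k * (T * R) = R * ((T * R) ^\<^sub>m k * (T * R))"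
    by (rule assoc_mult_mat[OF assms(1) p TR])
  finally show ?case by simp
qed (use assms in auto)

lemma rank1_powers_swap:
  assumes R: "R \<in> carrier_mat n m" and T: "T \<in> carrier_mat m n" and r: "rank1_powers m (T * R) l"
  shows "rank1_powers n (R * T) l"
proof -
  obtain M x y where l: "0 < l" and M: "(T * R) ^\<^sub>m M = rank1 m x y"
     "(T * R) ^\<^sub>m Suc M = l \<cdot>\<^sub>m (T * R) ^\<^sub>m M" "(T * R) ^\<^sub>m M \<noteq> 0\<^sub>m m m"
    using r unfolding rank1_powers_def by blast
  let ?P = "(T * R) ^\<^sub>m M"
  have TR: "T * R \<in> carrier_mat m m" using R T by simp
  have P: "?P \<in> carrier_mat m m" using TR by simp
  have RP: "R * ?P \<in> carrier_mat n m" using R P by simp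
  have one: "(R * T) ^\<^sub>m Suc M = rank1 n (\<lambda>i. \<Sum>a<m. R $$ (i,a) * x a) (\<lambda>j. \<Sum>b<m. y b * T $$ (b,j))"
    unfolding mult_pow_swap[OF R T]
  proof (rule eq_matI)
    fix i j assume "i < dim_row (rank1 n (\<lambda>i. \<Sum>a<m. R $$ (i,a) * x a) (\<lambda>j. \<Sum>b<m. y b * T $$ (b,j)))"
      "j < dim_col (rank1 n (\<lambda>i. \<Sum>a<m. R $$ (i,a) * x a) (\<lambda>j. \<Sum>b<m. y b * T $$ (b,j)))"
    then have ij: "i < n" "j < n" by auto
    have e: "(R * ?P) $$ (i,b) = (\<Sum>a<m. R $$ (i,a) * x a) * y b" if "b < m" for b
    proof -
      have "(R * ?P) $$ (i,b) = (\<Sum>a<m. R $$ (i,a) * ?P $$ (a,b))" by (rule index_mult_sum[OF R P ij(1) that])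
      also have "\<dots> = (\<Sum>a<m. R $$ (i,a) * (x a * y b))" using M(1) that by simp
      finally show ?thesis by (simp add: sum_distrib_right mult.assoc)
    qed
    have "(R * ?P * T) $$ (i,j) = (\<Sum>b<m. (\<Sum>a<m. R $$ (i,a) * x a) * y b * T $$ (b,j))"
      unfolding index_mult_sum[OF RP T ij] using e by (intro sum.cong) auto
    then show "(R * ?P * T) $$ (i,j) = rank1 n (\<lambda>i. \<Sum>a<m. R $$ (i,a) * x a) (\<lambda>j. \<Sum>b<m. y b * T $$ (b,j)) $$ (i,j)"
      using ij by (simp add: sum_distrib_left mult.assoc)
  qed (use R T in auto)
  have two: "(R * T) ^\<^sub>m Suc (Suc M) = l \<cdot>\<^sub>m (R * T) ^\<^sub>m Suc M"
    unfolding mult_pow_swap[OF R T] M(2) mult_smult_distrib[OF R P]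
    by (rule mult_smult_assoc_mat[OF RP T])
  have "(R * T) ^\<^sub>m Suc M \<noteq> 0\<^sub>m n n"
  proof
    assume z: "(R * T) ^\<^sub>m Suc M = 0\<^sub>m n n"
    have "(T * R) ^\<^sub>m (M + 2) = T * (R * T) ^\<^sub>m Suc M * R"
      using mult_pow_swap[OF T R, of "Suc M"] by simp
    also have "\<dots> = 0\<^sub>m m m" unfolding z using T R by simp
    finally have "l ^ 2 \<cdot>\<^sub>m ?P = 0\<^sub>m m m" using rank1_powers_ge[OF TR M(2), of 2] by simp
    then have e: "(l ^ 2 \<cdot>\<^sub>m ?P) $$ (i,j) = 0\<^sub>m m m $$ (i,j)" for i j by simp
    have "?P $$ (i,j) = 0" if "i < m" "j < m" for i j
      using e[of i j] that carrier_matD[OF P] l by simp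
    then have "?P = 0\<^sub>m m m" using P by (intro eq_matI) auto
    then show False using M(3) by simp
  qed
  moreover have "R * T \<in> carrier_mat n n" using R T by simp
  ultimately show ?thesis unfolding rank1_powers_def using l one two
    by (intro conjI exI[of _ "Suc M"] exI[of _ "\<lambda>i. \<Sum>a<m. R $$ (i,a) * x a"]
        exI[of _ "\<lambda>j. \<Sum>b<m. y b * T $$ (b,j)"])
qed

lemma rank1_powers_conj:
  assumes "inv_pair n g g'" "rank1_powers n A l"
  shows "rank1_powers n (g' * A * g) l"
proof -
  note c = inv_pair_carrier[OF assms(1)]
  have A: "A \<in> carrier_mat n n" using assms(2) unfolding rank1_powers_def by auto
  have "A * g * g' = A" by (rule inv_pair_cancel_right[OF assms(1) A])
  then have "rank1_powers n (g' * (A * g)) l"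
    using rank1_powers_swap[OF c(2) mult_carrier_mat[OF A c(1)]] assms(2) by (simp only:)
  then show ?thesis using A c by (simp add: assoc_mult_mat[of _ n n _ n _ n])
qed

lemma eventually_at_right_zeroD: "eventually P (at_right (0::real)) \<Longrightarrow> \<exists>b>0. \<forall>y>0. y < b \<longrightarrow> P y"
  unfolding eventually_at_right_field by auto

context dense_ring
begin

lemma conj_positive_pair:
  assumes n0: "0 < n" and A: "rank1_powers n A l" and U: "mat_over U A" and g: "U_inv n g g'" and h: "U_inv n h h'"
    and pos: "pos_mat (g' * A * g)" "pos_mat (h' * A * h)"
  shows "sse Uplus (g' * A * g) (h' * A * h)"
proof -
  note gc = U_inv_carrier[OF g] U_inv_carrier[OF h]
  note as = assoc_mult_mat[of _ n n _ n _ n] and mc = mult_carrier_mat[of _ n n _ n]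
  have Ac: "A \<in> carrier_mat n n" using A unfolding rank1_powers_def by auto
  have "(h' * g) * (g' * A * g) * (g' * h) = h' * (g * (g' * (A * (g * (g' * h)))))"
    using gc Ac by (simp add: as mc)
  also have "\<dots> = h' * A * h"
    using inv_pair_cancel[OF U_invD(1)[OF g], where k = n] gc Ac by (simp add: as mc)
  finally have e: "(h' * g) * (g' * A * g) * (g' * h) = h' * A * h" .
  have "mat_over U (g' * A * g)"
    using over_mult[of _ n n _ n] gc Ac U U_invD[OF g] by auto
  then have "sse Uplus (g' * A * g) ((h' * g) * (g' * A * g) * (g' * h))"
    using rank1_powers_conj[OF U_invD(1)[OF g] A] U_inv_mult[OF U_inv_sym[OF g] h] pos e
    by (intro conj_positive[OF n0]) auto
  then show ?thesis unfolding e .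
qed

text \<open>
  After a change of basis \<open>V\<close> the eigenvector \<open>x\<close> has all entries 1. A narrow cone around it makes the
  rank one part positive, since \<open>y\<close> pairs positively with \<open>x\<close>. Moving by \<open>T (- s)\<close> for large \<open>s\<close> makes
  the whole matrix positive, and then a basis over \<open>U\<close> nearby does as well.
\<close>

lemma exists_positive_conj:
  assumes n0: "0 < n" and A: "rank1_powers n A l" and U: "mat_over U A"
  shows "\<exists>g g'. U_inv n g g' \<and> pos_mat (g' * A * g)"
proof -
  obtain x y N T where N: "N \<in> carrier_mat n n" and
    "\<And>k. k \<ge> n \<Longrightarrow> A ^\<^sub>m (Suc k) = l ^ k \<cdot>\<^sub>m rank1 n x y" and
    T: "\<And>s. inv_pair n (T s) (T (- s))" "T 0 = 1\<^sub>m n" "\<And>s t. T (s + t) = T s * T t"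
    "\<And>s. T s * A * T (- s) = rank1 n x y + exp (- s) \<cdot>\<^sub>m N" "mat_tendsto T (1\<^sub>m n) (at 0)"
    and sum: "(\<Sum>i<n. y i * x i) = l"
    by (rule rank1_powers_scaling[OF A], rule that)
  have Ac: "A \<in> carrier_mat n n" and l: "0 < l" using A unfolding rank1_powers_def by auto
  have "\<exists>i<n. x i \<noteq> 0"
  proof (rule ccontr)
    assume "\<not> ?thesis"
    then have "(\<Sum>i<n. y i * x i) = 0" by (intro sum.neutral) auto
    then show False using sum l by simp
  qed
  then obtain p where p: "p < n" "x p \<noteq> 0" by blast
  note as = assoc_mult_mat[of _ n n _ n _ n] and mc = mult_carrier_mat[of _ n n _ n]
  let ?one = "\<lambda>_::nat. 1 :: real"
  \<comment> \<open>\<open>V\<close> is the identity with column \<open>p\<close> increased by \<open>z\<close>, so that its row sums are the entries of \<open>x\<close>.\<close>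
  define z where "z i = x i - 1" for i
  define u where "u i = (if i = p then 1 else 0 :: real)" for i
  define V V' where "V = perturb n 1 z u" and "V' = perturb_inv n 1 z u"
  have uz: "(\<Sum>i<n. u i * z i) = z p"
  proof -
    have "(\<Sum>i<n. u i * z i) = (\<Sum>i<n. if i = p then z i else 0)" by (intro sum.cong) (auto simp: u_def)
    then show ?thesis using p by simp
  qed
  have ipV: "inv_pair n V V'" unfolding V_def V'_def using p uz by (intro inv_pair_perturb) (auto simp: z_def)
  note Vc = inv_pair_carrier[OF ipV]
  have Vsum: "(\<Sum>j<n. V $$ (i,j)) = x i" if "i < n" for i
  proof -
    have "(\<Sum>j<n. V $$ (i,j)) = (\<Sum>j<n. (if j = i then 1 else 0) + (if j = p then z i else 0))"
      using that by (intro sum.cong) (auto simp: V_def perturb_def u_def)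
    then show ?thesis using that p by (simp add: sum.distrib z_def)
  qed
  have "V * rank1 n ?one y = rank1 n x y"
    unfolding mult_rank1[OF Vc(1)] using Vsum by (intro rank1_cong) auto
  then have V'x: "V' * rank1 n x y = rank1 n ?one y"
    using inv_pair_cancel(2)[OF ipV rank1_carrier] by metis
  define w where "w j = (\<Sum>i<n. y i * V $$ (i,j))" for j
  have yV: "rank1 n ?one y * V = rank1 n ?one w" unfolding rank1_mult[OF Vc(1)] w_def ..
  have wsum: "(\<Sum>j<n. w j) = l"
  proof -
    have "(\<Sum>j<n. w j) = (\<Sum>i<n. \<Sum>j<n. y i * V $$ (i,j))" unfolding w_def by (rule sum.swap)
    also have "\<dots> = (\<Sum>i<n. y i * x i)" using Vsum by (intro sum.cong) (auto simp flip: sum_distrib_left)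
    finally show ?thesis using sum by simp
  qed
  have "mat_tendsto (\<lambda>e. rank1 n ?one w * perturb n e ?one ?one) (rank1 n ?one w * rank1 n ?one ?one) (at_right 0)"
    by (rule mat_tendsto_mult[OF mat_tendsto_const perturb_tendsto rank1_carrier rank1_carrier])
  moreover have "pos_mat (rank1 n ?one w * rank1 n ?one ?one)"
    unfolding rank1_mult_rank1 using wsum l by (intro pos_matI[of _ n n]) auto
  ultimately have "\<forall>\<^sub>F e in at_right 0. pos_mat (rank1 n ?one w * perturb n e ?one ?one)"
    by (rule eventually_pos_mat)
  then obtain b where b: "0 < b" "\<And>e. 0 < e \<Longrightarrow> e < b \<Longrightarrow> pos_mat (rank1 n ?one w * perturb n e ?one ?one)"
    using eventually_at_right_zeroD by blast
  define e where "e = b / 2"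
  have e: "0 < e" "pos_mat (rank1 n ?one w * perturb n e ?one ?one)"
    using b(1) by (auto simp: e_def intro!: b(2))
  define k k' where "k = perturb n e ?one ?one" and "k' = perturb_inv n e ?one ?one"
  have ipk: "inv_pair n k k'" unfolding k_def k'_def using e by (intro inv_pair_perturb) auto
  note kc = inv_pair_carrier[OF ipk]
  have "(k' * V') * rank1 n x y * (V * k) = k' * (V' * rank1 n x y) * V * k"
    using kc Vc by (simp add: as mc)
  also have "\<dots> = k' * rank1 n ?one y * V * k" unfolding V'x ..
  also have "k' * rank1 n ?one y = (1 / (e + n)) \<cdot>\<^sub>m rank1 n ?one y"
    unfolding k'_def using perturb_inv_mult_rank1[of e ?one ?one n y] e(1) by simp
  also have "(1 / (e + n)) \<cdot>\<^sub>m rank1 n ?one y * V = (1 / (e + n)) \<cdot>\<^sub>m rank1 n ?one w"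
    using mult_smult_assoc_mat[OF rank1_carrier Vc(1)] yV by simp
  also have "(1 / (e + n)) \<cdot>\<^sub>m rank1 n ?one w * k = (1 / (e + n)) \<cdot>\<^sub>m (rank1 n ?one w * k)"
    by (rule mult_smult_assoc_mat[OF rank1_carrier kc(1)])
  finally have pk: "pos_mat ((k' * V') * rank1 n x y * (V * k))"
    using e by (simp add: pos_mat_smult k_def)
  have ipVk: "inv_pair n (V * k) (k' * V')" by (rule inv_pair_mult[OF ipV ipk])
  note Vkc = inv_pair_carrier[OF ipVk]
  have "mat_tendsto (\<lambda>s. (k' * V') * (rank1 n x y + exp (- s) \<cdot>\<^sub>m N) * (V * k)) ((k' * V') * rank1 n x y * (V * k)) at_top"
    using Vkc N
    by (intro mat_tendsto_mult[of _ _ _ _ _ n n n] mat_tendsto_const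
        smult_tendsto_zero[OF exp_minus_tendsto_zero, of _ n n]) auto
  then have "\<forall>\<^sub>F s in at_top. pos_mat ((k' * V') * (rank1 n x y + exp (- s) \<cdot>\<^sub>m N) * (V * k))"
    using pk by (rule eventually_pos_mat)
  then obtain s where s: "pos_mat ((k' * V') * (rank1 n x y + exp (- s) \<cdot>\<^sub>m N) * (V * k))"
    using eventually_happens'[OF trivial_limit_at_top_linorder] by blast
  define h h' where "h = T (- s) * (V * k)" and "h' = (k' * V') * T s"
  have iph: "inv_pair n h h'" unfolding h_def h'_def by (rule inv_pair_mult[OF inv_pair_sym[OF T(1)] ipVk])
  have Tc: "T s \<in> carrier_mat n n" for s using inv_pair_carrier[OF T(1)] by blast
  have "h' * A * h = (k' * V') * (T s * A * T (- s)) * (V * k)"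
    unfolding h_def h'_def using Vkc kc Vc Tc Ac by (simp add: as mc)
  then have ph: "pos_mat (h' * A * h)" using s unfolding T(4) by simp
  obtain f c c' where c: "U_basis_seq n h h' f c c'" using U_basis_seq_exists[OF iph] by blast
  have "\<forall>\<^sub>F m in sequentially. pos_mat (c' m * A * c m)" by (rule U_basis_seq_both[OF c c Ac ph])
  then obtain m where "pos_mat (c' m * A * c m)" using eventually_happens'[OF sequentially_bot] by blast
  then show ?thesis using c unfolding U_basis_seq_def by blast
qed

end

section \<open>Zero extensions\<close>

lemma pos_four_block:
  assumes "A \<in> carrier_mat n m" "B \<in> carrier_mat n l" "C \<in> carrier_mat k m" "D \<in> carrier_mat k l"
    "pos_mat A" "pos_mat B" "pos_mat C" "pos_mat D"
  shows "pos_mat (four_block_mat A B C D)"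
proof (rule pos_matI[of _ "n + k" "m + l"])
  fix i j assume "i < n + k" "j < m + l"
  then show "0 < four_block_mat A B C D $$ (i,j)"
    using assms by (auto simp: pos_mat_def)
qed (use assms in auto)

lemma inv_pair_lower:
  assumes "X \<in> carrier_mat m n"
  shows "inv_pair (n + m) (four_block_mat (1\<^sub>m n) (0\<^sub>m n m) X (1\<^sub>m m))
    (four_block_mat (1\<^sub>m n) (0\<^sub>m n m) (- X) (1\<^sub>m m :: real mat))"
proof -
  have "four_block_mat (1\<^sub>m n) (0\<^sub>m n m) X (1\<^sub>m m) * four_block_mat (1\<^sub>m n) (0\<^sub>m n m) (- X) (1\<^sub>m m) = 1\<^sub>m (n + m)"
    if "X \<in> carrier_mat m n" for X :: "real mat"
    using that by (subst mult_four_block_mat[of _ n n _ m _ m]) (auto intro!: eq_matI)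
  from this[OF assms] this[of "- X"] assms show ?thesis unfolding inv_pair_def by auto
qed

lemma inv_pair_upper:
  assumes "Y \<in> carrier_mat n m"
  shows "inv_pair (n + m) (four_block_mat (1\<^sub>m n) Y (0\<^sub>m m n) (1\<^sub>m m))
    (four_block_mat (1\<^sub>m n) (- Y) (0\<^sub>m m n) (1\<^sub>m m :: real mat))"
proof -
  have "four_block_mat (1\<^sub>m n) Y (0\<^sub>m m n) (1\<^sub>m m) * four_block_mat (1\<^sub>m n) (- Y) (0\<^sub>m m n) (1\<^sub>m m) = 1\<^sub>m (n + m)"
    if "Y \<in> carrier_mat n m" for Y :: "real mat"
    using that by (subst mult_four_block_mat[of _ n n _ m _ m]) (auto intro!: eq_matI)
  from this[OF assms] this[of "- Y"] assms show ?thesis unfolding inv_pair_def by auto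
qed

lemma inv_pair_block_diag:
  assumes "inv_pair n g g'" "inv_pair m h h'"
  shows "inv_pair (n + m) (four_block_mat g (0\<^sub>m n m) (0\<^sub>m m n) h) (four_block_mat g' (0\<^sub>m n m) (0\<^sub>m m n) (h' :: real mat))"
proof -
  have "four_block_mat g (0\<^sub>m n m) (0\<^sub>m m n) h * four_block_mat g' (0\<^sub>m n m) (0\<^sub>m m n) h' = 1\<^sub>m (n + m)"
    if "inv_pair n g g'" "inv_pair m h h'" for g g' h h' :: "real mat"
    using that unfolding inv_pair_def by (subst mult_four_block_mat[of _ n n _ m _ m]) auto
  from this[OF assms] this[OF assms[THEN inv_pair_sym]] assms show ?thesis unfolding inv_pair_def by auto
qed

context dense_ring
begin

lemma over_uminus: "A \<in> carrier_mat n m \<Longrightarrow> mat_over U A \<Longrightarrow> mat_over U (- A)"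
  by (auto simp: mat_over_iff[of _ n m])

lemma U_inv_lower: "X \<in> carrier_mat m n \<Longrightarrow> mat_over U X \<Longrightarrow>
    U_inv (n + m) (four_block_mat (1\<^sub>m n) (0\<^sub>m n m) X (1\<^sub>m m)) (four_block_mat (1\<^sub>m n) (0\<^sub>m n m) (- X) (1\<^sub>m m))"
  unfolding U_inv_def using inv_pair_lower over_uminus
  by (auto intro!: over_four_block[of _ n n _ m _ m] over_one over_zero)

lemma U_inv_upper: "Y \<in> carrier_mat n m \<Longrightarrow> mat_over U Y \<Longrightarrow>
    U_inv (n + m) (four_block_mat (1\<^sub>m n) Y (0\<^sub>m m n) (1\<^sub>m m)) (four_block_mat (1\<^sub>m n) (- Y) (0\<^sub>m m n) (1\<^sub>m m))"
  unfolding U_inv_def using inv_pair_upper over_uminus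
  by (auto intro!: over_four_block[of _ n n _ m _ m] over_one over_zero)

lemma U_inv_block_diag: "U_inv n g g' \<Longrightarrow> U_inv m h h' \<Longrightarrow>
    U_inv (n + m) (four_block_mat g (0\<^sub>m n m) (0\<^sub>m m n) h) (four_block_mat g' (0\<^sub>m n m) (0\<^sub>m m n) h')"
  using inv_pair_block_diag[of n g g' m h h'] U_invD[of n g g'] U_invD[of m h h']
    U_inv_carrier[of n g g'] U_inv_carrier[of m h h'] unfolding U_inv_def[of "n + m"]
  by (auto intro!: over_four_block[of _ n n _ m _ m] over_zero)

lemma large_multiple:
  assumes P: "P \<in> carrier_mat n m" "pos_mat P" and S: "S \<in> carrier_mat n m"
  shows "\<exists>t\<in>U. pos_mat (t \<cdot>\<^sub>m P + S)"
proof -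
  have "\<forall>\<^sub>F t in at_top. \<forall>i\<in>{..<n}. \<forall>j\<in>{..<m}. - S $$ (i,j) / P $$ (i,j) < t"
    by (intro eventually_ball_finite ballI eventually_gt_at_top) auto
  then obtain b where b: "\<And>t i j. t \<ge> b \<Longrightarrow> i < n \<Longrightarrow> j < m \<Longrightarrow> - S $$ (i,j) / P $$ (i,j) < t"
    unfolding eventually_at_top_linorder by (auto simp del: mult_minus_left)
  obtain t where t: "t \<in> U" "b < t" using U_between[of b "b + 1"] by auto
  have "pos_mat (t \<cdot>\<^sub>m P + S)"
  proof (rule pos_matI[of _ n m])
    fix i j assume ij: "i < n" "j < m"
    have "0 < P $$ (i,j)" using pos_matD[OF P(2,1) ij] .
    then have "0 < t * P $$ (i,j) + S $$ (i,j)" using b[of t i j] t ij by (simp add: field_simps)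
    then show "0 < (t \<cdot>\<^sub>m P + S) $$ (i,j)" using ij P S by simp
  qed (use P S in auto)
  then show ?thesis using t by blast
qed

lemma small_multiple:
  assumes P: "P \<in> carrier_mat n m" "pos_mat P" and S: "S \<in> carrier_mat n m"
  shows "\<exists>u\<in>U. 0 < u \<and> pos_mat (P - u \<cdot>\<^sub>m S)"
proof -
  have "((\<lambda>u::real. - u) \<longlongrightarrow> 0) (at_right 0)"
    using tendsto_minus[of "\<lambda>u. u" 0 "at_right (0::real)"] by (simp add: tendsto_ident_at)
  then have "mat_tendsto (\<lambda>u. P + (- u) \<cdot>\<^sub>m S) P (at_right 0)"
    by (rule smult_tendsto_zero) (use P S in auto)
  then have "\<forall>\<^sub>F u in at_right 0. pos_mat (P + (- u) \<cdot>\<^sub>m S)" using P(2) by (rule eventually_pos_mat)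
  then obtain b where b: "0 < b" "\<And>u. 0 < u \<Longrightarrow> u < b \<Longrightarrow> pos_mat (P + (- u) \<cdot>\<^sub>m S)"
    using eventually_at_right_zeroD by blast
  obtain u where u: "u \<in> U" "0 < u" "u < b" using U_between[OF b(1)] by auto
  have "P - u \<cdot>\<^sub>m S = P + (- u) \<cdot>\<^sub>m S" using P S by (intro eq_matI) auto
  then show ?thesis using b(2)[OF u(2,3)] u by auto
qed

abbreviation ones :: "nat \<Rightarrow> nat \<Rightarrow> real mat" where
  "ones n m \<equiv> mat n m (\<lambda>_. 1)"

lemma pos_ones: "pos_mat (ones n m)"
  unfolding pos_mat_def by auto

lemma pos_smult_ones: "0 < t \<Longrightarrow> pos_mat (t \<cdot>\<^sub>m ones n m)"
  unfolding pos_mat_def by auto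

lemma over_ones: "t \<in> U \<Longrightarrow> mat_over U (t \<cdot>\<^sub>m ones n m)"
  by (subst mat_over_iff[of _ n m]) auto

text \<open>
  A shear by a large positive matrix makes the lower left block \<open>T\<close> positive. A second shear, by a
  small positive \<open>Y\<close>, makes all blocks positive, and the result is the product \<open>R * W\<close> of the block
  column \<open>(P, T)\<close> with the block row \<open>(1, Y)\<close>, whose product in the other order is \<open>P + Y * T = Q\<close>.
\<close>

lemma zero_extension_below:
  assumes nm: "0 < n" "0 < m" and Q: "Q \<in> carrier_mat n n" "mat_over U Q" "pos_mat Q"
    and S: "S \<in> carrier_mat m n" "mat_over U S"
  defines "M \<equiv> four_block_mat Q (0\<^sub>m n m) S (0\<^sub>m m m)"
  shows "\<exists>g g'. U_inv (n + m) g g' \<and> pos_mat (g' * M * g) \<and> sse Uplus Q (g' * M * g)"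
proof -
  have "pos_mat (ones m n * Q)"
    by (rule pos_mat_mult[of _ m n _ n]) (use pos_ones nm Q in auto)
  moreover have "ones m n * Q \<in> carrier_mat m n" by (rule mult_carrier_mat[of _ m n]) (use Q in auto)
  ultimately obtain t where t: "t \<in> U" "pos_mat (t \<cdot>\<^sub>m (ones m n * Q) + S)"
    using large_multiple[of "ones m n * Q" m n S] S by blast
  define X where "X = t \<cdot>\<^sub>m ones m n"
  define T where "T = X * Q + S"
  have X: "X \<in> carrier_mat m n" "mat_over U X" unfolding X_def using over_ones t by auto
  have XQ: "X * Q = t \<cdot>\<^sub>m (ones m n * Q)" unfolding X_def using Q by (intro mult_smult_assoc_mat[of _ m n]) auto
  have T: "T \<in> carrier_mat m n" "pos_mat T" "mat_over U T"
    using X Q S t XQ over_add[OF mult_carrier_mat[OF X(1) Q(1)] S(1) over_mult[OF X(1) Q(1) X(2) Q(2)] S(2)]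
    by (auto simp: T_def)
  obtain u where u: "u \<in> U" "0 < u" "pos_mat (Q - u \<cdot>\<^sub>m (ones n m * T))"
    using small_multiple[of Q n n "ones n m * T"] mult_carrier_mat[of "ones n m" n m T n] Q T by auto
  define Y where "Y = u \<cdot>\<^sub>m ones n m"
  have Y: "Y \<in> carrier_mat n m" "mat_over U Y" "pos_mat Y"
    unfolding Y_def using over_ones pos_smult_ones u by auto
  have YT: "Y * T = u \<cdot>\<^sub>m (ones n m * T)" unfolding Y_def using T by (intro mult_smult_assoc_mat[of _ n m]) auto
  define P where "P = Q - Y * T"
  have YTc: "Y * T \<in> carrier_mat n n" using Y T by simp
  have P: "P \<in> carrier_mat n n" "pos_mat P" "mat_over U P" "P + Y * T = Q"
    unfolding P_def using Q u(3) YT YTc over_minus[OF Q(1) YTc Q(2)] over_mult[OF Y(1) T(1) Y(2) T(3)]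
      minus_carrier_mat[OF YTc, of Q]
    by (auto intro!: eq_matI simp del: minus_carrier_mat)
  define L L' E E' where "L = four_block_mat (1\<^sub>m n) (0\<^sub>m n m) X (1\<^sub>m m)"
    and "L' = four_block_mat (1\<^sub>m n) (0\<^sub>m n m) (- X) (1\<^sub>m m)"
    and "E = four_block_mat (1\<^sub>m n) Y (0\<^sub>m m n) (1\<^sub>m m)"
    and "E' = four_block_mat (1\<^sub>m n) (- Y) (0\<^sub>m m n) (1\<^sub>m m)"
  have iL: "U_inv (n + m) L L'" unfolding L_def L'_def by (rule U_inv_lower[OF X])
  have iE: "U_inv (n + m) E E'" unfolding E_def E'_def by (rule U_inv_upper[OF Y(1,2)])
  have inv: "U_inv (n + m) (L' * E) (E' * L)" by (rule U_inv_mult[OF U_inv_sym[OF iL] iE])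
  note c = U_inv_carrier[OF iL] U_inv_carrier[OF iE]
  have M: "M \<in> carrier_mat (n + m) (n + m)" unfolding M_def using Q by simp
  note as = assoc_mult_mat[of _ "n + m" "n + m" _ "n + m" _ "n + m"] and mc = mult_carrier_mat[of _ "n + m" "n + m" _ "n + m"]
  \<comment> \<open>A block column and a block row, padded with empty blocks.\<close>
  define R W where "R = four_block_mat P (0\<^sub>m n 0) T (0\<^sub>m m 0)" and "W = four_block_mat (1\<^sub>m n) Y (0\<^sub>m 0 n) (0\<^sub>m 0 m)"
  have Rc: "R \<in> carrier_mat (n + m) n" and Wc: "W \<in> carrier_mat n (n + m)"
    unfolding R_def W_def using P by auto
  have RW: "R * W = four_block_mat P (P * Y) T (T * Y)"
    unfolding R_def W_def by (subst mult_four_block_mat[of _ n n _ 0 _ m _ _ n _ m]) (use P T Y in auto)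
  have WR: "W * R = Q"
  proof -
    have "W * R = four_block_mat (1\<^sub>m n * P + Y * T) (1\<^sub>m n * 0\<^sub>m n 0 + Y * 0\<^sub>m m 0) (0\<^sub>m 0 n * P + 0\<^sub>m 0 m * T) (0\<^sub>m 0 n * 0\<^sub>m n 0 + 0\<^sub>m 0 m * 0\<^sub>m m 0)"
      unfolding R_def W_def by (rule mult_four_block_mat) (use P T Y in auto)
    also have "\<dots> = Q" using P Y T Q YTc by (intro eq_matI) (auto simp: P_def)
    finally show ?thesis .
  qed
  have "(E' * L) * M * (L' * E) = E' * (L * M) * L' * E"
    using c M by (simp add: as mc)
  also have "L * M = four_block_mat Q (0\<^sub>m n m) T (0\<^sub>m m m)"
    unfolding L_def M_def by (subst mult_four_block_mat[of _ n n _ m _ m]) (use X Q S T T_def in auto)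
  also have "E' * four_block_mat Q (0\<^sub>m n m) T (0\<^sub>m m m) = four_block_mat P (0\<^sub>m n m) T (0\<^sub>m m m)"
  proof -
    have "Q + - Y * T = P" unfolding P_def using Y T Q by (intro eq_matI) auto
    then show ?thesis unfolding E'_def
      by (subst mult_four_block_mat[of _ n n _ m _ m]) (use Y Q T in auto)
  qed
  also have "\<dots> * L' = four_block_mat P (0\<^sub>m n m) T (0\<^sub>m m m)"
    unfolding L'_def by (subst mult_four_block_mat[of _ n n _ m _ m]) (use P X T in auto)
  also have "\<dots> * E = four_block_mat P (P * Y) T (T * Y)"
    unfolding E_def by (subst mult_four_block_mat[of _ n n _ m _ m]) (use P Y T in auto)
  finally have eq: "(E' * L) * M * (L' * E) = R * W" using RW by simp
  have pos: "pos_mat (R * W)" unfolding RW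
    using P Y T nm by (intro pos_four_block[of _ n n _ m _ m] pos_mat_mult[of _ n n _ m] pos_mat_mult[of _ m n _ m]) auto
  have z: "mat_over Uplus (0\<^sub>m a b)" for a b by (subst mat_over_iff[of _ a b]) auto
  have o1: "mat_over Uplus (1\<^sub>m n)" by (subst mat_over_iff[of _ n n]) auto
  have "elementary_sse Uplus Q (R * W)"
  proof (rule elementary_sseI[OF Wc Rc])
    show "mat_over Uplus W" unfolding W_def
      using Y P z o1 over_Uplus_of_pos[OF Y(2,3)] by (intro over_four_block[of _ n n _ m _ 0]) auto
    show "mat_over Uplus R" unfolding R_def
      using P T z over_Uplus_of_pos[OF P(3,2)] over_Uplus_of_pos[OF T(3,2)] by (intro over_four_block[of _ n n _ 0 _ m]) auto
  qed (use nm WR in auto)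
  then show ?thesis using inv pos eq by (intro exI[of _ "L' * E"] exI[of _ "E' * L"]) auto
qed

text \<open>
  The mirror image of the previous construction: here the result is the product of the block column
  \<open>(Y, 1)\<close> with the block row \<open>(T, P)\<close>, and \<open>T * Y + P = Q\<close>.
\<close>

lemma zero_extension_left:
  assumes nm: "0 < n" "0 < m" and Q: "Q \<in> carrier_mat m m" "mat_over U Q" "pos_mat Q"
    and S: "S \<in> carrier_mat m n" "mat_over U S"
  defines "M \<equiv> four_block_mat (0\<^sub>m n n) (0\<^sub>m n m) S Q"
  shows "\<exists>g g'. U_inv (n + m) g g' \<and> pos_mat (g' * M * g) \<and> sse Uplus Q (g' * M * g)"
proof -
  have "pos_mat (Q * ones m n)"
    by (rule pos_mat_mult[of _ m m _ n]) (use pos_ones nm Q in auto)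
  moreover have "Q * ones m n \<in> carrier_mat m n" by (rule mult_carrier_mat[of _ m m]) (use Q in auto)
  ultimately obtain t where t: "t \<in> U" "pos_mat (t \<cdot>\<^sub>m (Q * ones m n) + S)"
    using large_multiple[of "Q * ones m n" m n S] S by blast
  define X where "X = t \<cdot>\<^sub>m ones m n"
  define T where "T = S + Q * X"
  have X: "X \<in> carrier_mat m n" "mat_over U X" unfolding X_def using over_ones t by auto
  have QX: "Q * X = t \<cdot>\<^sub>m (Q * ones m n)" unfolding X_def using Q by (intro mult_smult_distrib) auto
  have "T = t \<cdot>\<^sub>m (Q * ones m n) + S"
    unfolding T_def QX using S Q by (intro comm_add_mat[of _ m n]) auto
  then have T: "T \<in> carrier_mat m n" "pos_mat T" "mat_over U T"
    using X Q S t over_add[OF S(1) mult_carrier_mat[OF Q(1) X(1)] S(2) over_mult[OF Q(1) X(1) Q(2) X(2)]]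
    by (auto simp: T_def)
  obtain u where u: "u \<in> U" "0 < u" "pos_mat (Q - u \<cdot>\<^sub>m (T * ones n m))"
    using small_multiple[of Q m m "T * ones n m"] Q T by auto
  define Y where "Y = u \<cdot>\<^sub>m ones n m"
  have Y: "Y \<in> carrier_mat n m" "mat_over U Y" "pos_mat Y"
    unfolding Y_def using over_ones pos_smult_ones u by auto
  have TY: "T * Y = u \<cdot>\<^sub>m (T * ones n m)" unfolding Y_def using T by (intro mult_smult_distrib) auto
  define P where "P = Q - T * Y"
  have TYc: "T * Y \<in> carrier_mat m m" using Y T by simp
  have P: "P \<in> carrier_mat m m" "pos_mat P" "mat_over U P"
    unfolding P_def using Q u(3) TY TYc over_minus[OF Q(1) TYc Q(2)] over_mult[OF T(1) Y(1) T(3) Y(2)]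
      minus_carrier_mat[OF TYc, of Q]
    by (auto simp del: minus_carrier_mat)
  define L L' E E' where "L = four_block_mat (1\<^sub>m n) (0\<^sub>m n m) X (1\<^sub>m m)"
    and "L' = four_block_mat (1\<^sub>m n) (0\<^sub>m n m) (- X) (1\<^sub>m m)"
    and "E = four_block_mat (1\<^sub>m n) Y (0\<^sub>m m n) (1\<^sub>m m)"
    and "E' = four_block_mat (1\<^sub>m n) (- Y) (0\<^sub>m m n) (1\<^sub>m m)"
  have iL: "U_inv (n + m) L L'" unfolding L_def L'_def by (rule U_inv_lower[OF X])
  have iE: "U_inv (n + m) E E'" unfolding E_def E'_def by (rule U_inv_upper[OF Y(1,2)])
  have inv: "U_inv (n + m) (L * E') (E * L')" by (rule U_inv_mult[OF iL U_inv_sym[OF iE]])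
  note c = U_inv_carrier[OF iL] U_inv_carrier[OF iE]
  have M: "M \<in> carrier_mat (n + m) (n + m)" unfolding M_def using Q by simp
  note as = assoc_mult_mat[of _ "n + m" "n + m" _ "n + m" _ "n + m"] and mc = mult_carrier_mat[of _ "n + m" "n + m" _ "n + m"]
  \<comment> \<open>A block column and a block row, padded with empty blocks.\<close>
  define R W where "R = four_block_mat Y (0\<^sub>m n 0) (1\<^sub>m m) (0\<^sub>m m 0)" and "W = four_block_mat T P (0\<^sub>m 0 n) (0\<^sub>m 0 m)"
  have Rc: "R \<in> carrier_mat (n + m) m" and Wc: "W \<in> carrier_mat m (n + m)"
    unfolding R_def W_def using Y T by auto
  have RW: "R * W = four_block_mat (Y * T) (Y * P) T P"
    unfolding R_def W_def by (subst mult_four_block_mat[of _ n m _ 0 _ m _ _ n _ m]) (use P T Y in auto)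
  have WR: "W * R = Q"
  proof -
    have "W * R = four_block_mat (T * Y + P * 1\<^sub>m m) (T * 0\<^sub>m n 0 + P * 0\<^sub>m m 0) (0\<^sub>m 0 n * Y + 0\<^sub>m 0 m * 1\<^sub>m m) (0\<^sub>m 0 n * 0\<^sub>m n 0 + 0\<^sub>m 0 m * 0\<^sub>m m 0)"
      unfolding R_def W_def by (rule mult_four_block_mat) (use P T Y in auto)
    also have "\<dots> = Q" using P Y T Q TYc by (intro eq_matI) (auto simp: P_def)
    finally show ?thesis .
  qed
  have "(E * L') * M * (L * E') = E * (L' * (M * L)) * E'"
    using c M by (simp add: as mc)
  also have "M * L = four_block_mat (0\<^sub>m n n) (0\<^sub>m n m) T Q"
    unfolding L_def M_def by (subst mult_four_block_mat[of _ n n _ m _ m]) (use X Q S T T_def in auto)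
  also have "L' * four_block_mat (0\<^sub>m n n) (0\<^sub>m n m) T Q = four_block_mat (0\<^sub>m n n) (0\<^sub>m n m) T Q"
    unfolding L'_def by (subst mult_four_block_mat[of _ n n _ m _ m]) (use Q X T in auto)
  also have "E * four_block_mat (0\<^sub>m n n) (0\<^sub>m n m) T Q = four_block_mat (Y * T) (Y * Q) T Q"
    unfolding E_def by (subst mult_four_block_mat[of _ n n _ m _ m]) (use Q Y T in auto)
  also have "\<dots> * E' = four_block_mat (Y * T) (Y * P) T P"
  proof -
    have "T * - Y + Q = P" unfolding P_def using Y T Q by (intro eq_matI) auto
    moreover have "Y * T * - Y + Y * Q = Y * P"
    proof -
      have "Y * P = Y * (T * - Y + Q)" using calculation by simp
      also have "\<dots> = Y * (T * - Y) + Y * Q" using Y T Q by (intro mult_add_distrib_mat[of _ n m]) auto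
      also have "Y * (T * - Y) = Y * T * - Y" using Y T by (intro assoc_mult_mat[symmetric]) auto
      finally show ?thesis by simp
    qed
    ultimately show ?thesis unfolding E'_def
      by (subst mult_four_block_mat[of _ n n _ m _ m]) (use Y Q T in auto)
  qed
  finally have eq: "(E * L') * M * (L * E') = R * W" using RW by simp
  have pos: "pos_mat (R * W)" unfolding RW
    using P Y T nm by (intro pos_four_block[of _ n n _ m _ m] pos_mat_mult[of _ n m _ m] pos_mat_mult[of _ n m _ n]) auto
  have z: "mat_over Uplus (0\<^sub>m a b)" for a b by (subst mat_over_iff[of _ a b]) auto
  have o1: "mat_over Uplus (1\<^sub>m m)" by (subst mat_over_iff[of _ m m]) auto
  have "elementary_sse Uplus Q (R * W)"
  proof (rule elementary_sseI[OF Wc Rc])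
    show "mat_over Uplus W" unfolding W_def
      using P T z over_Uplus_of_pos[OF P(3,2)] over_Uplus_of_pos[OF T(3,2)] by (intro over_four_block[of _ m n _ m _ 0]) auto
    show "mat_over Uplus R" unfolding R_def
      using Y z o1 over_Uplus_of_pos[OF Y(2,3)] by (intro over_four_block[of _ n m _ 0 _ m]) auto
  qed (use nm WR in auto)
  then show ?thesis using inv pos eq by (intro exI[of _ "L * E'"] exI[of _ "E * L'"]) auto
qed

end

lemma block_conj_below:
  assumes "(A::real mat) \<in> carrier_mat n n" "S \<in> carrier_mat m n" "g \<in> carrier_mat n n" "g' \<in> carrier_mat n n"
  shows "four_block_mat g' (0\<^sub>m n m) (0\<^sub>m m n) (1\<^sub>m m) *
    (four_block_mat A (0\<^sub>m n m) S (0\<^sub>m m m) * four_block_mat g (0\<^sub>m n m) (0\<^sub>m m n) (1\<^sub>m m)) =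
    four_block_mat (g' * A * g) (0\<^sub>m n m) (S * g) (0\<^sub>m m m)"
proof -
  have "four_block_mat A (0\<^sub>m n m) S (0\<^sub>m m m) * four_block_mat g (0\<^sub>m n m) (0\<^sub>m m n) (1\<^sub>m m)
     = four_block_mat (A * g) (0\<^sub>m n m) (S * g) (0\<^sub>m m m)"
    by (subst mult_four_block_mat[of _ n n _ m _ m]) (use assms in auto)
  also have "four_block_mat g' (0\<^sub>m n m) (0\<^sub>m m n) (1\<^sub>m m) * \<dots> =
    four_block_mat (g' * (A * g)) (0\<^sub>m n m) (S * g) (0\<^sub>m m m)"
    by (subst mult_four_block_mat[of _ n n _ m _ m]) (use assms in auto)
  also have "g' * (A * g) = g' * A * g" by (rule assoc_mult_mat[symmetric]) (use assms in auto)
  finally show ?thesis .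
qed

lemma block_conj_left:
  assumes "(B::real mat) \<in> carrier_mat m m" "S \<in> carrier_mat m n" "h \<in> carrier_mat m m" "h' \<in> carrier_mat m m"
  shows "four_block_mat (1\<^sub>m n) (0\<^sub>m n m) (0\<^sub>m m n) h' *
    (four_block_mat (0\<^sub>m n n) (0\<^sub>m n m) S B * four_block_mat (1\<^sub>m n) (0\<^sub>m n m) (0\<^sub>m m n) h) =
    four_block_mat (0\<^sub>m n n) (0\<^sub>m n m) (h' * S) (h' * B * h)"
proof -
  have "four_block_mat (0\<^sub>m n n) (0\<^sub>m n m) S B * four_block_mat (1\<^sub>m n) (0\<^sub>m n m) (0\<^sub>m m n) h
     = four_block_mat (0\<^sub>m n n) (0\<^sub>m n m) S (B * h)"
    by (subst mult_four_block_mat[of _ n n _ m _ m]) (use assms in auto)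
  also have "four_block_mat (1\<^sub>m n) (0\<^sub>m n m) (0\<^sub>m m n) h' * \<dots> =
    four_block_mat (0\<^sub>m n n) (0\<^sub>m n m) (h' * S) (h' * (B * h))"
    by (subst mult_four_block_mat[of _ n n _ m _ m]) (use assms in auto)
  also have "h' * (B * h) = h' * B * h" by (rule assoc_mult_mat[symmetric]) (use assms in auto)
  finally show ?thesis .
qed

text \<open>
  This conjugation turns one zero extension of \<open>R * S\<close> into one of \<open>S * R\<close>.
\<close>

lemma block_shear:
  assumes R: "(R::real mat) \<in> carrier_mat n m" and S: "S \<in> carrier_mat m n"
  shows "four_block_mat (1\<^sub>m n) (- R) (0\<^sub>m m n) (1\<^sub>m m) *
    (four_block_mat (R * S) (0\<^sub>m n m) S (0\<^sub>m m m) * four_block_mat (1\<^sub>m n) R (0\<^sub>m m n) (1\<^sub>m m)) =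
    four_block_mat (0\<^sub>m n n) (0\<^sub>m n m) S (S * R)"
proof -
  define A B where "A = R * S" and "B = S * R"
  have A: "A \<in> carrier_mat n n" and B: "B \<in> carrier_mat m m" unfolding A_def B_def using R S by auto
  have AB: "A * R = R * B" unfolding A_def B_def by (rule assoc_mult_mat[OF R S R])
  have "four_block_mat A (0\<^sub>m n m) S (0\<^sub>m m m) * four_block_mat (1\<^sub>m n) R (0\<^sub>m m n) (1\<^sub>m m)
     = four_block_mat A (R * B) S B"
    by (subst mult_four_block_mat[of _ n n _ m _ m]) (use A B R S AB B_def in auto)
  also have "four_block_mat (1\<^sub>m n) (- R) (0\<^sub>m m n) (1\<^sub>m m) * \<dots> =
    four_block_mat (A + - R * S) (R * B + - R * B) S B"
    by (subst mult_four_block_mat[of _ n n _ m _ m]) (use A B R S in auto)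
  also have "A + - R * S = 0\<^sub>m n n" unfolding A_def using R S by (intro eq_matI) auto
  also have "R * B + - R * B = 0\<^sub>m n m" using R B by (intro eq_matI) auto
  finally show ?thesis unfolding A_def B_def .
qed

context dense_ring
begin

lemma over_conj:
  "U_inv n g g' \<Longrightarrow> A \<in> carrier_mat n n \<Longrightarrow> mat_over U A \<Longrightarrow> mat_over U (g' * A * g)"
  using U_inv_carrier[of n g g'] U_invD[of n g g'] by (auto intro!: over_mult[of _ n n _ n])

text \<open>
  The zero extension of \<open>R * S\<close> is itself conjugate to one of \<open>S * R\<close>. Positive forms of \<open>R * S\<close> and of
  \<open>S * R\<close> thus both yield positive forms of one and the same matrix.
\<close>

lemma elementary_step:
  assumes nm: "0 < n" "0 < m" and R: "R \<in> carrier_mat n m" "mat_over U R" and S: "S \<in> carrier_mat m n" "mat_over U S"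
    and r: "rank1_powers m (S * R) l"
    and g: "U_inv n g g'" "pos_mat (g' * (R * S) * g)" and h: "U_inv m h h'" "pos_mat (h' * (S * R) * h)"
  shows "sse Uplus (g' * (R * S) * g) (h' * (S * R) * h)"
proof -
  let ?A = "R * S" and ?B = "S * R"
  define M where "M = four_block_mat ?A (0\<^sub>m n m) S (0\<^sub>m m m)"
  define M' where "M' = four_block_mat (0\<^sub>m n n) (0\<^sub>m n m) S ?B"
  note as = assoc_mult_mat[of _ "n + m" "n + m" _ "n + m" _ "n + m"] and mc = mult_carrier_mat[of _ "n + m" "n + m" _ "n + m"]
  note gc = U_inv_carrier[OF g(1)] U_inv_carrier[OF h(1)]
  have A: "?A \<in> carrier_mat n n" "mat_over U ?A" and B: "?B \<in> carrier_mat m m" "mat_over U ?B"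
    using R S over_mult[OF R(1) S(1)] over_mult[OF S(1) R(1)] by auto
  have M: "M \<in> carrier_mat (n + m) (n + m)" "mat_over U M" unfolding M_def
    using A S over_zero by (auto intro!: over_four_block[of _ n n _ m _ m])
  have M': "M' \<in> carrier_mat (n + m) (n + m)" unfolding M'_def using B by auto
  have rM: "rank1_powers (n + m) M l"
  proof -
    define X W where "X = four_block_mat R (0\<^sub>m n 0) (1\<^sub>m m) (0\<^sub>m m 0)" and "W = four_block_mat S (0\<^sub>m m m) (0\<^sub>m 0 n) (0\<^sub>m 0 m)"
    have c: "X \<in> carrier_mat (n + m) m" "W \<in> carrier_mat m (n + m)" unfolding X_def W_def using R S by auto
    have "X * W = M" unfolding X_def W_def M_def
      by (subst mult_four_block_mat[of _ n m _ 0 _ m _ _ n _ m]) (use R S in auto)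
    moreover have "W * X = ?B"
    proof -
      have "W * X = four_block_mat (S * R + 0\<^sub>m m m * 1\<^sub>m m) (S * 0\<^sub>m n 0 + 0\<^sub>m m m * 0\<^sub>m m 0) (0\<^sub>m 0 n * R + 0\<^sub>m 0 m * 1\<^sub>m m) (0\<^sub>m 0 n * 0\<^sub>m n 0 + 0\<^sub>m 0 m * 0\<^sub>m m 0)"
        unfolding X_def W_def by (rule mult_four_block_mat) (use R S in auto)
      also have "\<dots> = ?B" using R S by (intro eq_matI) auto
      finally show ?thesis .
    qed
    ultimately show ?thesis using rank1_powers_swap[OF c] r by simp
  qed
  let ?Qa = "g' * ?A * g" and ?Qb = "h' * ?B * h"
  have Qa: "?Qa \<in> carrier_mat n n" "mat_over U ?Qa" and Qb: "?Qb \<in> carrier_mat m m" "mat_over U ?Qb"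
    using A B gc over_conj[OF g(1) A] over_conj[OF h(1) B] by auto
  define D D' where "D = four_block_mat g (0\<^sub>m n m) (0\<^sub>m m n) (1\<^sub>m m)" and "D' = four_block_mat g' (0\<^sub>m n m) (0\<^sub>m m n) (1\<^sub>m m)"
  have iD: "U_inv (n + m) D D'" unfolding D_def D'_def by (rule U_inv_block_diag[OF g(1) U_inv_one])
  have DMD: "D' * (M * D) = four_block_mat ?Qa (0\<^sub>m n m) (S * g) (0\<^sub>m m m)"
    unfolding D_def D'_def M_def by (rule block_conj_below[OF A(1) S(1) gc(1,2)])
  have Sg: "S * g \<in> carrier_mat m n" "mat_over U (S * g)"
    using S gc over_mult[OF S(1) gc(1) S(2) U_invD(2)[OF g(1)]] by auto
  obtain a a' where a: "U_inv (n + m) a a'" "pos_mat (a' * (D' * (M * D)) * a)" "sse Uplus ?Qa (a' * (D' * (M * D)) * a)"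
    using zero_extension_below[OF nm Qa g(2) Sg] unfolding DMD by blast
  define H H' where "H = four_block_mat (1\<^sub>m n) R (0\<^sub>m m n) (1\<^sub>m m)" and "H' = four_block_mat (1\<^sub>m n) (- R) (0\<^sub>m m n) (1\<^sub>m m)"
  have iH: "U_inv (n + m) H H'" unfolding H_def H'_def by (rule U_inv_upper[OF R])
  have HMH: "H' * (M * H) = M'"
    unfolding H_def H'_def M_def M'_def by (rule block_shear[OF R(1) S(1)])
  define F F' where "F = four_block_mat (1\<^sub>m n) (0\<^sub>m n m) (0\<^sub>m m n) h" and "F' = four_block_mat (1\<^sub>m n) (0\<^sub>m n m) (0\<^sub>m m n) h'"
  have iF: "U_inv (n + m) F F'" unfolding F_def F'_def by (rule U_inv_block_diag[OF U_inv_one h(1)])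
  have FMF: "F' * (M' * F) = four_block_mat (0\<^sub>m n n) (0\<^sub>m n m) (h' * S) ?Qb"
    unfolding F_def F'_def M'_def by (rule block_conj_left[OF B(1) S(1) gc(3,4)])
  have hS: "h' * S \<in> carrier_mat m n" "mat_over U (h' * S)"
    using S gc over_mult[OF gc(4) S(1) U_invD(3)[OF h(1)] S(2)] by auto
  obtain b b' where b: "U_inv (n + m) b b'" "pos_mat (b' * (F' * (M' * F)) * b)" "sse Uplus ?Qb (b' * (F' * (M' * F)) * b)"
    using zero_extension_left[OF nm Qb h(2) hS] unfolding FMF by blast
  note c = U_inv_carrier[OF iD] U_inv_carrier[OF a(1)] U_inv_carrier[OF iH] U_inv_carrier[OF iF] U_inv_carrier[OF b(1)]
  have e1: "(a' * D') * M * (D * a) = a' * (D' * (M * D)) * a" using c M by (simp add: as mc)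
  have e2: "(b' * (F' * H')) * M * (H * F * b) = b' * (F' * (M' * F)) * b"
    unfolding HMH[symmetric] using c M by (simp add: as mc)
  have "sse Uplus ((a' * D') * M * (D * a)) ((b' * (F' * H')) * M * (H * F * b))"
    using a(2) b(2) nm
    by (intro conj_positive_pair[OF _ rM M(2) U_inv_mult[OF iD a(1)] U_inv_mult[OF U_inv_mult[OF iH iF] b(1)]])
      (auto simp only: e1 e2)
  then show ?thesis using a(3) b(3) sse_sym sse_trans unfolding e1 e2 by metis
qed

text \<open>
  The intermediate matrices of the chain may have negative entries, but each has a positive form, and
  the class of this form is constant along the chain.
\<close>

lemma sse_positive:
  assumes n0: "0 < n" and A: "A \<in> carrier_mat n n" "mat_over U A" "pos_mat A" "rank1_powers n A l" and s: "sse U A B"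
    and B: "B \<in> carrier_mat m m" "pos_mat B"
  shows "sse Uplus A B"
proof -
  have "\<exists>k g g'. 0 < k \<and> U_inv k g g' \<and> B \<in> carrier_mat k k \<and> mat_over U B \<and> rank1_powers k B l \<and>
      pos_mat (g' * B * g) \<and> sse Uplus A (g' * B * g)"
    using s
  proof (induction rule: rtranclp_induct)
    case base
    show ?case using A n0 U_inv_one[of n] by (intro exI[of _ n] exI[of _ "1\<^sub>m n"]) auto
  next
    case (step B C)
    then obtain k g g' where k: "0 < k" "U_inv k g g'" "B \<in> carrier_mat k k" "mat_over U B" "rank1_powers k B l"
      "pos_mat (g' * B * g)" "sse Uplus A (g' * B * g)" by blast
    obtain p q R T where e: "0 < p" "0 < q" "R \<in> carrier_mat p q" "T \<in> carrier_mat q p"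
     "mat_over U R" "mat_over U T" "B = R * T" "C = T * R"
      using step.hyps unfolding elementary_sse_def by blast
    have p: "p = k" using e(3,7) k(3) by auto
    have C: "C \<in> carrier_mat q q" "mat_over U C" using e over_mult[OF e(4,3)] by auto
    have rC: "rank1_powers q C l" unfolding e(8)
      using rank1_powers_swap[OF e(4,3)] k(5) unfolding e(7) p by simp
    obtain h h' where h: "U_inv q h h'" "pos_mat (h' * C * h)"
      using exists_positive_conj[OF e(2) rC C(2)] by blast
    have "sse Uplus (g' * B * g) (h' * C * h)"
      using elementary_step[OF e(1,2,3,5,4,6), of l g g' h h'] k h rC unfolding p e(7,8) by simp
    then show ?case using C rC h e(2) k(7) sse_trans by blast
  qed
  then obtain k g g' where k: "0 < k" "U_inv k g g'" "B \<in> carrier_mat k k" "mat_over U B" "rank1_powers k B l"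
      "pos_mat (g' * B * g)" "sse Uplus A (g' * B * g)" by blast
  have eq: "1\<^sub>m k * B * 1\<^sub>m k = B"
    using left_mult_one_mat[OF k(3)] right_mult_one_mat[OF k(3)] by simp
  have "pos_mat (1\<^sub>m k * B * 1\<^sub>m k)" unfolding eq by (rule B(2))
  then have "sse Uplus (g' * B * g) (1\<^sub>m k * B * 1\<^sub>m k)"
    by (rule conj_positive_pair[OF k(1,5,4,2) U_inv_one k(6)])
  then show ?thesis using k(7) sse_trans unfolding eq by blast
qed

end

section \<open>From nonnegative to positive matrices\<close>

definition irreducible_mat :: "nat \<Rightarrow> real mat \<Rightarrow> bool" where
  "irreducible_mat n A \<longleftrightarrow>
     (\<forall>Z. Z \<noteq> {} \<longrightarrow> Z \<subset> {..<n} \<longrightarrow> (\<exists>x\<in>Z. \<exists>y\<in>{..<n} - Z. 0 < A $$ (x,y)))"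

lemma irreducible_matD:
  "irreducible_mat n A \<Longrightarrow> Z \<noteq> {} \<Longrightarrow> Z \<subset> {..<n} \<Longrightarrow> \<exists>x\<in>Z. \<exists>y\<in>{..<n} - Z. 0 < A $$ (x,y)"
  unfolding irreducible_mat_def by blast

lemma irreducible_mat_mono:
  assumes "irreducible_mat n A" "\<And>i j. i < n \<Longrightarrow> j < n \<Longrightarrow> 0 < A $$ (i,j) \<Longrightarrow> 0 < B $$ (i,j)"
  shows "irreducible_mat n B"
  unfolding irreducible_mat_def
proof (intro allI impI)
  fix Z assume Z: "Z \<noteq> {}" "Z \<subset> {..<n}"
  then obtain x y where "x \<in> Z" "y \<in> {..<n} - Z" "0 < A $$ (x,y)" using irreducible_matD[OF assms(1)] by blast
  then show "\<exists>x\<in>Z. \<exists>y\<in>{..<n} - Z. 0 < B $$ (x,y)" using Z assms(2)[of x y] by auto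
qed

lemma eventually_small_multiple: "0 < (a::real) \<Longrightarrow> \<forall>\<^sub>F u in at_right 0. u * s < a"
proof -
  assume a: "0 < a"
  have "((\<lambda>u::real. u * s) \<longlongrightarrow> 0 * s) (at_right 0)" by (intro tendsto_intros)
  then show ?thesis using a by (auto intro: order_tendstoD(2))
qed

context dense_ring
begin

lemma over_Uplus_iff: "A \<in> carrier_mat n m \<Longrightarrow> mat_over Uplus A \<longleftrightarrow> (\<forall>i<n. \<forall>j<m. A $$ (i,j) \<in> U \<and> 0 \<le> A $$ (i,j))"
  by (auto simp: mat_over_iff)

lemma exists_small_U: "\<forall>\<^sub>F u in at_right 0. P u \<Longrightarrow> \<exists>u\<in>U. 0 < u \<and> P u"
  using eventually_at_right_zeroD[of P] U_between[of 0] by blast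

text \<open>
  If column \<open>k\<close> is positive, a small multiple of each other column can be subtracted from it without
  creating zeros. Undoing this by multiplication from the left instead of the right adds a multiple
  of row \<open>k\<close> to the rows in \<open>C\<close>.
\<close>

lemma row_addition:
  assumes n0: "0 < n" and A: "A \<in> carrier_mat n n" "mat_over Uplus A" and k: "k < n" "k \<notin> C"
    and col: "\<And>i. i < n \<Longrightarrow> 0 < A $$ (i,k)"
  shows "\<exists>B. elementary_sse Uplus A B \<and> B \<in> carrier_mat n n \<and> mat_over Uplus B \<and>
    (\<forall>i<n. \<forall>j<n. 0 < A $$ (i,j) \<longrightarrow> 0 < B $$ (i,j)) \<and>
    (\<forall>i<n. \<forall>j<n. i \<in> C \<longrightarrow> 0 < A $$ (k,j) \<longrightarrow> 0 < B $$ (i,j))"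
proof -
  define c where "c l = (if l \<in> C then 1 else 0 :: real)" for l
  have "\<forall>\<^sub>F u in at_right 0. \<forall>i\<in>{..<n}. u * (\<Sum>l<n. A $$ (i,l) * c l) < A $$ (i,k)"
    using col by (intro eventually_ball_finite ballI eventually_small_multiple) auto
  from exists_small_U[OF this] obtain u
    where u: "u \<in> U" "0 < u" "\<And>i. i < n \<Longrightarrow> u * (\<Sum>l<n. A $$ (i,l) * c l) < A $$ (i,k)"
    by auto
  define x where "x l = u * c l" for l
  have x: "x k = 0" "0 \<le> x l" "x l \<in> U" for l unfolding x_def c_def using k u by auto
  have xC: "0 < x l" if "l \<in> C" for l unfolding x_def c_def using that u by auto
  let ?X = "colop n k x" and ?X' = "colop n k (\<lambda>i. - x i)"
  have ip: "inv_pair n ?X ?X'" by (rule colop_inv[of k n x, OF k(1) x(1)])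
  define A' where "A' = A * ?X'"
  have A'c: "A' \<in> carrier_mat n n" unfolding A'_def using A by simp
  have A'ij: "A' $$ (i,j) = A $$ (i,j) - (if j = k then u * (\<Sum>l<n. A $$ (i,l) * c l) else 0)" if "i < n" "j < n" for i j
    unfolding A'_def mult_colop[OF A(1) k(1) that] x_def
    by (simp add: sum_negf sum_distrib_left mult_ac)
  have A'pos: "0 < A' $$ (i,j)" if "i < n" "j < n" "0 < A $$ (i,j)" for i j
    using A'ij[OF that(1,2)] that u(3)[of i] by auto
  have An: "0 \<le> A $$ (i,j)" "A $$ (i,j) \<in> U" if "i < n" "j < n" for i j
    using A that by (auto simp: over_Uplus_iff)
  have A'n: "0 \<le> A' $$ (i,j)" if "i < n" "j < n" for i j
    using A'ij[OF that] An[OF that] u(3)[OF that(1)] by auto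
  have oX: "mat_over U ?X'" "mat_over U ?X" using x by (auto intro!: colop_over)
  have "mat_over U A'" unfolding A'_def by (rule over_mult[OF A(1) colop_carrier over_Uplus[OF A(2)] oX(1)])
  then have A'o: "mat_over Uplus A'" using A'n A'c by (auto simp: over_Uplus_iff mat_over_iff[of _ n n])
  have Xo: "mat_over Uplus ?X" using x oX(2)
    by (auto simp: over_Uplus_iff[of _ n n] mat_over_iff[of _ n n]) (auto simp: colop_def)
  define B where "B = ?X * A'"
  have Bij: "B $$ (i,j) = A' $$ (i,j) + x i * A' $$ (k,j)" if "i < n" "j < n" for i j
    unfolding B_def by (rule colop_mult[OF A'c k(1) that])
  have "A = A' * ?X" unfolding A'_def using inv_pair_cancel_right(2)[OF ip A(1)] by simp
  then have "elementary_sse Uplus A B"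
    using A'c A'o Xo n0 by (intro elementary_sseI[of A' n n ?X]) (auto simp: B_def)
  moreover have "B \<in> carrier_mat n n" "mat_over Uplus B"
    unfolding B_def using over_mult_Uplus[OF colop_carrier A'c Xo A'o] mult_carrier_mat[OF colop_carrier A'c] by auto
  moreover have "0 < B $$ (i,j)" if "i < n" "j < n" "0 < A $$ (i,j)" for i j
    using Bij[OF that(1,2)] A'pos[OF that] x(2)[of i] A'n[OF k(1) that(2)] by (simp add: add_pos_nonneg)
  moreover have "0 < B $$ (i,j)" if "i < n" "j < n" "i \<in> C" "0 < A $$ (k,j)" for i j
    using Bij[OF that(1,2)] A'n[OF that(1,2)] xC[OF that(3)] A'pos[OF k(1) that(2,4)]
    by (simp add: add_nonneg_pos)
  ultimately show ?thesis by blast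
qed

text \<open>
  Let column \<open>v\<close> be positive. Adding row \<open>v\<close> to all rows makes column \<open>p\<close> positive for each positive entry
  \<open>(v, p)\<close>; then row \<open>p\<close> may be added to row \<open>v\<close>. By irreducibility row \<open>v\<close> gains positive entries until it
  is positive, and a last addition of row \<open>v\<close> to all rows fills the matrix.
\<close>

lemma fill_from_positive_column:
  assumes "0 < n" "A \<in> carrier_mat n n" "mat_over Uplus A" "irreducible_mat n A" "v < n" "\<And>i. i < n \<Longrightarrow> 0 < A $$ (i,v)"
  shows "\<exists>B. sse Uplus A B \<and> B \<in> carrier_mat n n \<and> mat_over Uplus B \<and> pos_mat B"
  using assms
proof (induction "card {j\<in>{..<n}. A $$ (v,j) \<le> 0}" arbitrary: A rule: less_induct)
  case less
  note A = less.prems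
  obtain B where B: "elementary_sse Uplus A B" "B \<in> carrier_mat n n" "mat_over Uplus B"
    "\<And>i j. i < n \<Longrightarrow> j < n \<Longrightarrow> 0 < A $$ (i,j) \<Longrightarrow> 0 < B $$ (i,j)"
    "\<And>i j. i < n \<Longrightarrow> j < n \<Longrightarrow> i \<noteq> v \<Longrightarrow> 0 < A $$ (v,j) \<Longrightarrow> 0 < B $$ (i,j)"
    using row_addition[OF A(1-3,5), of "- {v}"] A(6) by auto
  show ?case
  proof (cases "\<forall>j<n. 0 < A $$ (v,j)")
    case True
    have "pos_mat B" using B True by (intro pos_matI[of _ n n]) (metis, metis)
    then show ?thesis using B by blast
  next
    case False
    define F where "F = {j\<in>{..<n}. 0 < A $$ (v,j)}"
    have "v \<in> F" unfolding F_def using A(5,6) by auto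
    moreover have "F \<subset> {..<n}" using False unfolding F_def by auto
    ultimately obtain p y where p: "p \<in> F" "y < n" "y \<notin> F" "0 < A $$ (p,y)"
      using irreducible_matD[OF A(4), of F] by blast
    have pn: "p < n" "0 < A $$ (v,p)" and y0: "A $$ (v,y) \<le> 0" and pv: "p \<noteq> v" using p unfolding F_def by auto
    have colp: "0 < B $$ (i,p)" if "i < n" for i
      using B(4)[OF that pn(1)] B(5)[OF that pn(1)] pn by (cases "i = v") auto
    obtain C where C: "elementary_sse Uplus B C" "C \<in> carrier_mat n n" "mat_over Uplus C"
      "\<And>i j. i < n \<Longrightarrow> j < n \<Longrightarrow> 0 < B $$ (i,j) \<Longrightarrow> 0 < C $$ (i,j)"
      "\<And>j. j < n \<Longrightarrow> 0 < B $$ (p,j) \<Longrightarrow> 0 < C $$ (v,j)"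
      using row_addition[OF A(1) B(2,3) pn(1), of "{v}"] colp pv A(5) by auto
    have AC: "0 < C $$ (i,j)" if "i < n" "j < n" "0 < A $$ (i,j)" for i j using B(4) C(4) that by blast
    have "0 < C $$ (v,y)" using C(5) B(4) p pn by blast
    then have "{j\<in>{..<n}. C $$ (v,j) \<le> 0} \<subset> {j\<in>{..<n}. A $$ (v,j) \<le> 0}"
      using AC[OF A(5)] y0 p(2) by (auto simp: not_less[symmetric])
    then have "card {j\<in>{..<n}. C $$ (v,j) \<le> 0} < card {j\<in>{..<n}. A $$ (v,j) \<le> 0}"
      by (intro psubset_card_mono) auto
    then obtain E where "sse Uplus C E" "E \<in> carrier_mat n n" "mat_over Uplus E" "pos_mat E"
      using less.hyps[of C] A(1,5,6) C(2,3) AC irreducible_mat_mono[OF A(4), of C] by blast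
    then show ?thesis using B(1) C(1) by (meson converse_rtranclp_into_rtranclp)
  qed
qed

text \<open>
  State splitting: a small weight \<open>u\<close> is taken off every positive entry of column \<open>v\<close>, and the rank one
  matrix taken off, the product of a column \<open>Y\<close> with the unit row of \<open>v\<close>, becomes a new state. Its
  only successors are \<open>v\<close> and itself. It is preceded by itself and by the states that reach \<open>v\<close> in two
  steps; because of the loop at \<open>v\<close> these include all that precede \<open>v\<close>, and by irreducibility at least
  one more.
\<close>

lemma split_to_positive_column:
  assumes "0 < n" "A \<in> carrier_mat n n" "mat_over Uplus A" "irreducible_mat n A" "v < n" "0 < A $$ (v,v)"
  shows "\<exists>m B w. 0 < m \<and> sse Uplus A B \<and> B \<in> carrier_mat m m \<and> mat_over Uplus B \<and> irreducible_mat m B \<and>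
    w < m \<and> (\<forall>i<m. 0 < B $$ (i,w))"
  using assms
proof (induction "card {i\<in>{..<n}. A $$ (i,v) \<le> 0}" arbitrary: A v n rule: less_induct)
  case less
  note A = less.prems
  define Z where "Z = {i\<in>{..<n}. A $$ (i,v) \<le> 0}"
  show ?case
  proof (cases "Z = {}")
    case True
    then have "\<forall>i<n. 0 < A $$ (i,v)" unfolding Z_def by (auto simp: not_le)
    then show ?thesis using A by blast
  next
    case False
    have "v \<notin> Z" unfolding Z_def using A(6) by auto
    then have "Z \<subset> {..<n}" unfolding Z_def using A(5) by auto
    then obtain p y where p: "p \<in> Z" "y < n" "y \<notin> Z" "0 < A $$ (p,y)"
      using irreducible_matD[OF A(4) False] by blast
    have An: "0 \<le> A $$ (i,j)" "A $$ (i,j) \<in> U" if "i < n" "j < n" for i j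
      using A that by (auto simp: over_Uplus_iff)
    have pn: "p < n" and yv: "0 < A $$ (y,v)" using p unfolding Z_def by auto
    have "\<forall>\<^sub>F u in at_right 0. \<forall>i\<in>{..<n} - Z. u * 1 < A $$ (i,v)"
      by (intro eventually_ball_finite ballI eventually_small_multiple) (auto simp: Z_def)
    from exists_small_U[OF this] obtain u
      where u: "u \<in> U" "0 < u" "\<And>i. i < n \<Longrightarrow> i \<notin> Z \<Longrightarrow> u < A $$ (i,v)"
      by auto
    define Y where "Y i = (if i \<in> Z then 0 else u)" for i
    define A' where "A' i j = A $$ (i,j) - (if j = v then Y i else 0)" for i j
    have Y: "0 \<le> Y i" "Y i \<in> U" for i unfolding Y_def using u by auto
    have A'n: "0 \<le> A' i j" "A' i j \<in> U" if "i < n" "j < n" for i j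
      using An[OF that] u(1,2) u(3)[OF that(1)] unfolding A'_def Y_def by auto
    have A'p: "0 < A' i j" if "i < n" "j < n" "0 < A $$ (i,j)" for i j
      using that u(2) u(3)[OF that(1)] unfolding A'_def Y_def by auto
    define R where "R = mat (Suc n) n (\<lambda>(i,j). if i < n then A' i j else if j = v then 1 else 0)"
    define W where "W = mat n (Suc n) (\<lambda>(i,j). if j < n then (if i = j then 1 else 0) else Y i)"
    have Rc: "R \<in> carrier_mat (Suc n) n" and Wc: "W \<in> carrier_mat n (Suc n)" unfolding R_def W_def by auto
    have oR: "mat_over Uplus R" unfolding over_Uplus_iff[OF Rc] using A'n by (auto simp: R_def)
    have oW: "mat_over Uplus W" unfolding over_Uplus_iff[OF Wc] using Y by (auto simp: W_def)
    have WR: "W * R = A"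
    proof (rule eq_matI)
      fix i j assume "i < dim_row A" "j < dim_col A"
      then have ij: "i < n" "j < n" using A by auto
      have "(W * R) $$ (i,j) = (\<Sum>l<Suc n. W $$ (i,l) * R $$ (l,j))" by (rule index_mult_sum[OF Wc Rc ij])
      also have "\<dots> = (\<Sum>l<n. if l = i then A' l j else 0) + Y i * (if j = v then 1 else 0)"
        unfolding sum.lessThan_Suc using ij by (intro arg_cong2[of _ _ _ _ "(+)"] sum.cong) (auto simp: W_def R_def)
      also have "\<dots> = A $$ (i,j)" using ij by (simp add: A'_def)
      finally show "(W * R) $$ (i,j) = A $$ (i,j)" .
    qed (use Rc Wc A in auto)
    define B where "B = R * W"
    have Bc: "B \<in> carrier_mat (Suc n) (Suc n)" unfolding B_def using Rc Wc by simp
    have oB: "mat_over Uplus B" unfolding B_def by (rule over_mult_Uplus[OF Rc Wc oR oW])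
    have sB: "elementary_sse Uplus A B"
      by (rule elementary_sseI[OF Wc Rc]) (use A(1) oR oW WR B_def in auto)
    have Bin: "B $$ (i,j) = R $$ (i,j)" if "i < Suc n" "j < n" for i j
    proof -
      have "B $$ (i,j) = (\<Sum>l<n. R $$ (i,l) * W $$ (l,j))" unfolding B_def by (rule index_mult_sum[OF Rc Wc]) (use that in auto)
      also have "\<dots> = (\<Sum>l<n. if l = j then R $$ (i,l) else 0)" using that by (intro sum.cong) (auto simp: W_def)
      finally show ?thesis using that by simp
    qed
    have Bn: "B $$ (i,n) = (\<Sum>l<n. R $$ (i,l) * Y l)" if "i < Suc n" for i
    proof -
      have "B $$ (i,n) = (\<Sum>l<n. R $$ (i,l) * W $$ (l,n))" unfolding B_def by (rule index_mult_sum[OF Rc Wc]) (use that in auto)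
      also have "\<dots> = (\<Sum>l<n. R $$ (i,l) * Y l)" by (intro sum.cong) (auto simp: W_def)
      finally show ?thesis .
    qed
    have R0: "0 \<le> R $$ (i,l)" if "i < Suc n" "l < n" for i l using A'n that by (auto simp: R_def)
    have two: "0 < B $$ (i,n)" if "i < Suc n" "l < n" "0 < R $$ (i,l)" "l \<notin> Z" for i l
    proof -
      have "0 < R $$ (i,l) * Y l" using that u by (simp add: Y_def)
      also have "\<dots> \<le> (\<Sum>l<n. R $$ (i,l) * Y l)"
        using that R0[OF that(1)] Y by (intro member_le_sum) auto
      finally show ?thesis using Bn[OF that(1)] by simp
    qed
    have BA: "0 < B $$ (i,j)" if "i < n" "j < n" "0 < A $$ (i,j)" for i j
      using Bin[of i j] A'p[OF that] that by (auto simp: R_def)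
    have Bnv: "0 < B $$ (n,v)" using Bin[of n v] A(5) by (simp add: R_def)
    have Bnn: "0 < B $$ (n,n)" using two[of n v] A(5) \<open>v \<notin> Z\<close> by (simp add: R_def)
    have Bvn: "0 < B $$ (i,n)" if "i < n" "i \<notin> Z" for i
    proof (rule two[of _ v])
      have "0 < A $$ (i,v)" using that unfolding Z_def by (auto simp: not_le)
      then show "0 < R $$ (i,v)" using A'p[OF that(1) A(5)] that by (simp add: R_def A(5))
    qed (use that A(5) \<open>v \<notin> Z\<close> in auto)
    have Bpn: "0 < B $$ (p,n)"
      by (rule two[of _ y]) (use A'p[OF pn p(2,4)] p pn in \<open>auto simp: R_def\<close>)
    have irr: "irreducible_mat (Suc n) B"
      unfolding irreducible_mat_def
    proof (intro allI impI)
      fix S assume S: "S \<noteq> {}" "S \<subset> {..<Suc n}"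
      show "\<exists>x\<in>S. \<exists>y\<in>{..<Suc n} - S. 0 < B $$ (x,y)"
      proof (cases "S \<inter> {..<n} = {} \<or> {..<n} \<subseteq> S")
        case True
        then show ?thesis
        proof
          assume "S \<inter> {..<n} = {}"
          then have "x = n" if "x \<in> S" for x using S(2) that by (cases "x < n") auto
          then have "S = {n}" using S(1) by blast
          then show ?thesis using Bnv A(5) by (intro bexI[of _ n] bexI[of _ v]) auto
        next
          assume i: "{..<n} \<subseteq> S"
          then have "n \<notin> S" using S(2) by (auto simp: less_Suc_eq)
          then show ?thesis using i A(5) Bvn[OF A(5) \<open>v \<notin> Z\<close>] by (intro bexI[of _ v] bexI[of _ n]) auto
        qed
      next
        case False
        then obtain a b where "a \<in> S \<inter> {..<n}" "b \<in> {..<n} - (S \<inter> {..<n})" "0 < A $$ (a,b)"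
          using irreducible_matD[OF A(4), of "S \<inter> {..<n}"] by blast
        then show ?thesis using BA by (intro bexI[of _ a] bexI[of _ b]) auto
      qed
    qed
    have "{i\<in>{..<Suc n}. B $$ (i,n) \<le> 0} \<subset> Z"
    proof
      show "{i\<in>{..<Suc n}. B $$ (i,n) \<le> 0} \<subseteq> Z"
        using Bnn Bvn by (auto simp: less_Suc_eq not_less[symmetric])
      show "{i\<in>{..<Suc n}. B $$ (i,n) \<le> 0} \<noteq> Z" using p(1) Bpn by auto
    qed
    then have "card {i\<in>{..<Suc n}. B $$ (i,n) \<le> 0} < card Z"
      by (rule psubset_card_mono[rotated]) (simp add: Z_def)
    then have "\<exists>m C w. 0 < m \<and> sse Uplus B C \<and> C \<in> carrier_mat m m \<and> mat_over Uplus C \<and> irreducible_mat m C \<and>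
       w < m \<and> (\<forall>i<m. 0 < C $$ (i,w))"
      unfolding Z_def by (rule less.hyps) (use Bc oB irr Bnn in auto)
    then show ?thesis using sB by (meson converse_rtranclp_into_rtranclp)
  qed
qed

end

lemma trace_swap:
  assumes "(A::real mat) \<in> carrier_mat n m" "B \<in> carrier_mat m n"
  shows "(\<Sum>i<n. (A * B) $$ (i,i)) = (\<Sum>i<m. (B * A) $$ (i,i))"
proof -
  have "(\<Sum>i<n. (A * B) $$ (i,i)) = (\<Sum>i<n. \<Sum>l<m. A $$ (i,l) * B $$ (l,i))"
    using assms by (intro sum.cong index_mult_sum) auto
  also have "\<dots> = (\<Sum>l<m. \<Sum>i<n. B $$ (l,i) * A $$ (i,l))"
    by (subst sum.swap) (simp add: mult.commute)
  also have "\<dots> = (\<Sum>i<m. (B * A) $$ (i,i))"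
    using assms by (intro sum.cong index_mult_sum[symmetric]) auto
  finally show ?thesis .
qed

text \<open>
  The trace of \<open>T s * A * T (- s)\<close> does not depend on \<open>s\<close>, so the nilpotent part has trace 0.
\<close>

lemma rank1_powers_trace:
  assumes "rank1_powers n A l" shows "(\<Sum>i<n. A $$ (i,i)) = l"
proof -
  obtain x y N T where N: "N \<in> carrier_mat n n" and
    "\<And>k. k \<ge> n \<Longrightarrow> A ^\<^sub>m (Suc k) = l ^ k \<cdot>\<^sub>m rank1 n x y" and
    T: "\<And>s. inv_pair n (T s) (T (- s))" "T 0 = 1\<^sub>m n" "\<And>s t. T (s + t) = T s * T t"
    "\<And>s. T s * A * T (- s) = rank1 n x y + exp (- s) \<cdot>\<^sub>m N" "mat_tendsto T (1\<^sub>m n) (at 0)"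
    and sum: "(\<Sum>i<n. y i * x i) = l"
    by (rule rank1_powers_scaling[OF assms], rule that)
  have A: "A \<in> carrier_mat n n" using assms unfolding rank1_powers_def by auto
  have tr: "(\<Sum>i<n. A $$ (i,i)) = l + exp (- s) * (\<Sum>i<n. N $$ (i,i))" for s
  proof -
    note c = inv_pair_carrier[OF T(1)[of s]]
    have "(\<Sum>i<n. (T s * A * T (- s)) $$ (i,i)) = (\<Sum>i<n. (T (- s) * (T s * A)) $$ (i,i))"
      using c A by (intro trace_swap) auto
    also have "T (- s) * (T s * A) = A" by (rule inv_pair_cancel(2)[OF T(1) A])
    finally have "(\<Sum>i<n. A $$ (i,i)) = (\<Sum>i<n. y i * x i + exp (- s) * N $$ (i,i))"
      unfolding T(4) using N by (simp add: mult.commute)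
    then show ?thesis using sum by (simp add: sum.distrib sum_distrib_left)
  qed
  have "exp (- 0) * (\<Sum>i<n. N $$ (i,i)) = exp (- 1) * (\<Sum>i<n. N $$ (i,i))" using tr[of 0] tr[of 1] by simp
  then have "(\<Sum>i<n. N $$ (i,i)) = 0" by simp
  then show ?thesis using tr[of 0] by simp
qed

context dense_ring
begin

text \<open>
  Deleting a zero row and the column of the same index is an elementary step: \<open>A\<close> factors through the
  inclusion of the remaining coordinates. A zero column is treated by the projection onto them.
\<close>

lemma delete_zero_line:
  assumes A: "A \<in> carrier_mat n n" "mat_over Uplus A" "rank1_powers n A l" and k: "k < n"
    and z: "(\<forall>j<n. A $$ (k,j) = 0) \<or> (\<forall>j<n. A $$ (j,k) = 0)"
  shows "\<exists>B. elementary_sse Uplus A B \<and> 0 < n - 1 \<and> B \<in> carrier_mat (n - 1) (n - 1) \<and> mat_over Uplus B \<and> rank1_powers (n - 1) B l"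
proof -
  define i' where "i' = insert_index k"
  have i'n: "i' l < n" "i' l \<noteq> k" if "l < n - 1" for l using that k unfolding i'_def insert_index_def by auto
  have An: "A $$ (i,j) \<in> U" "0 \<le> A $$ (i,j)" if "i < n" "j < n" for i j
    using A that by (auto simp: over_Uplus_iff)
  have pick: "(\<Sum>l<n - 1. if i = i' l then f (i' l) else 0) = (if i = k then 0 else f i)" if "i < n" for i and f :: "nat \<Rightarrow> real"
  proof (cases "i = k")
    case True
    then show ?thesis using i'n by (intro trans[OF sum.neutral]) auto
  next
    case False
    define p where "p = delete_index k i"
    have p: "i' p = i" "p < n - 1" using False that k unfolding p_def i'_def
      by (auto simp: insert_delete_index delete_index_def)
    have "(\<Sum>l<n - 1. if i = i' l then f (i' l) else 0) = (\<Sum>l<n - 1. if l = p then f i else 0)"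
    proof (intro sum.cong refl)
      fix l
      show "(if i = i' l then f (i' l) else 0) = (if l = p then f i else 0)"
        using p(1) delete_insert_index[of k l] delete_insert_index[of k p] unfolding i'_def by (metis)
    qed
    then show ?thesis using False p by simp
  qed
  have "\<exists>R T. R \<in> carrier_mat n (n - 1) \<and> T \<in> carrier_mat (n - 1) n \<and> mat_over Uplus R \<and> mat_over Uplus T \<and> R * T = A"
    using z
  proof
    assume z: "\<forall>j<n. A $$ (k,j) = 0"
    define R where "R = mat n (n - 1) (\<lambda>(i,j). if i = i' j then 1 else 0 :: real)"
    define T where "T = mat (n - 1) n (\<lambda>(i,j). A $$ (i' i,j))"
    have c: "R \<in> carrier_mat n (n - 1)" "T \<in> carrier_mat (n - 1) n" unfolding R_def T_def by auto
    have "R * T = A"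
    proof (rule eq_matI)
      fix i j assume "i < dim_row A" "j < dim_col A"
      then have ij: "i < n" "j < n" using A by auto
      have "(R * T) $$ (i,j) = (\<Sum>l<n - 1. if i = i' l then A $$ (i' l,j) else 0)"
        unfolding index_mult_sum[OF c ij] using ij by (intro sum.cong) (auto simp: R_def T_def)
      also have "\<dots> = A $$ (i,j)" using pick[OF ij(1), of "\<lambda>i. A $$ (i,j)"] z ij by auto
      finally show "(R * T) $$ (i,j) = A $$ (i,j)" .
    qed (use c A in auto)
    moreover have "mat_over Uplus R" "mat_over Uplus T"
      unfolding over_Uplus_iff[OF c(1)] over_Uplus_iff[OF c(2)] using An i'n by (auto simp: R_def T_def)
    ultimately show ?thesis using c by blast
  next
    assume z: "\<forall>j<n. A $$ (j,k) = 0"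
    define R where "R = mat n (n - 1) (\<lambda>(i,j). A $$ (i,i' j))"
    define T where "T = mat (n - 1) n (\<lambda>(i,j). if j = i' i then 1 else 0 :: real)"
    have c: "R \<in> carrier_mat n (n - 1)" "T \<in> carrier_mat (n - 1) n" unfolding R_def T_def by auto
    have "R * T = A"
    proof (rule eq_matI)
      fix i j assume "i < dim_row A" "j < dim_col A"
      then have ij: "i < n" "j < n" using A by auto
      have "(R * T) $$ (i,j) = (\<Sum>l<n - 1. if j = i' l then A $$ (i,i' l) else 0)"
        unfolding index_mult_sum[OF c ij] using ij by (intro sum.cong) (auto simp: R_def T_def)
      also have "\<dots> = A $$ (i,j)" using pick[OF ij(2), of "\<lambda>j. A $$ (i,j)"] z ij by auto
      finally show "(R * T) $$ (i,j) = A $$ (i,j)" .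
    qed (use c A in auto)
    moreover have "mat_over Uplus R" "mat_over Uplus T"
      unfolding over_Uplus_iff[OF c(1)] over_Uplus_iff[OF c(2)] using An i'n by (auto simp: R_def T_def)
    ultimately show ?thesis using c by blast
  qed
  then obtain R T where RT: "R \<in> carrier_mat n (n - 1)" "T \<in> carrier_mat (n - 1) n" "mat_over Uplus R" "mat_over Uplus T" "R * T = A" by blast
  have r: "rank1_powers (n - 1) (T * R) l" using rank1_powers_swap[OF RT(2,1)] A(3) RT(5) by simp
  have "0 < n - 1"
  proof (rule ccontr)
    assume "\<not> 0 < n - 1"
    then have n1: "n - 1 = 0" by simp
    obtain M where "(T * R) ^\<^sub>m M \<noteq> 0\<^sub>m (n - 1) (n - 1)" using r unfolding rank1_powers_def by blast
    moreover have "(T * R) ^\<^sub>m M \<in> carrier_mat (n - 1) (n - 1)" using RT by simp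
    ultimately show False unfolding n1 by (metis carrier_matD eq_matI index_zero_mat(2,3) less_nat_zero_code)
  qed
  then show ?thesis using RT r over_mult_Uplus[OF RT(2,1,4,3)] k
    by (intro exI[of _ "T * R"]) (auto intro!: elementary_sseI[of R n "n - 1" T])
qed

lemma delete_zero_lines:
  assumes "0 < n" "A \<in> carrier_mat n n" "mat_over Uplus A" "rank1_powers n A l"
  shows "\<exists>m B. 0 < m \<and> sse Uplus A B \<and> B \<in> carrier_mat m m \<and> mat_over Uplus B \<and> rank1_powers m B l \<and>
    (\<forall>i<m. \<exists>j<m. 0 < B $$ (i,j)) \<and> (\<forall>j<m. \<exists>i<m. 0 < B $$ (i,j))"
  using assms
proof (induction n arbitrary: A rule: less_induct)
  case (less n)
  note A = less.prems
  have An: "0 \<le> A $$ (i,j)" if "i < n" "j < n" for i j using A that by (auto simp: over_Uplus_iff)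
  show ?case
  proof (cases "\<exists>k<n. (\<forall>j<n. A $$ (k,j) = 0) \<or> (\<forall>j<n. A $$ (j,k) = 0)")
    case True
    then obtain B where B: "elementary_sse Uplus A B" "0 < n - 1" "B \<in> carrier_mat (n - 1) (n - 1)" "mat_over Uplus B" "rank1_powers (n - 1) B l"
      using delete_zero_line[OF A(2-4)] by blast
    then obtain m C where C: "0 < m" "sse Uplus B C" "C \<in> carrier_mat m m" "mat_over Uplus C" "rank1_powers m C l"
       "(\<forall>i<m. \<exists>j<m. 0 < C $$ (i,j)) \<and> (\<forall>j<m. \<exists>i<m. 0 < C $$ (i,j))"
      using less.IH[of "n - 1" B] A(1) by auto
    then show ?thesis using converse_rtranclp_into_rtranclp[OF B(1) C(2)] by blast
  next
    case False
    then have "\<exists>j<n. 0 < A $$ (i,j)" "\<exists>j<n. 0 < A $$ (j,i)" if "i < n" for i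
      using that An by (metis order_le_less)+
    then show ?thesis using A by blast
  qed
qed

text \<open>
  Without zero rows and columns no power has any either, and a nonnegative rank one matrix without zero
  rows and columns is positive.
\<close>

lemma trimmed_power_pos:
  assumes A: "A \<in> carrier_mat n n" "mat_over Uplus A" "rank1_powers n A l"
    and rows: "\<And>i. i < n \<Longrightarrow> \<exists>j<n. 0 < A $$ (i,j)" and cols: "\<And>j. j < n \<Longrightarrow> \<exists>i<n. 0 < A $$ (i,j)"
  shows "\<exists>k. pos_mat (A ^\<^sub>m k)"
proof -
  have An: "0 \<le> A $$ (i,j)" if "i < n" "j < n" for i j using A that by (auto simp: over_Uplus_iff)
  have P: "(\<forall>i<n. \<forall>j<n. 0 \<le> (A ^\<^sub>m k) $$ (i,j)) \<and> (\<forall>i<n. \<exists>j<n. 0 < (A ^\<^sub>m k) $$ (i,j)) \<and>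
     (\<forall>j<n. \<exists>i<n. 0 < (A ^\<^sub>m k) $$ (i,j))" for k
  proof (induction k)
    case (Suc k)
    let ?P = "A ^\<^sub>m k"
    have P: "?P \<in> carrier_mat n n" using A by simp
    have e: "(A ^\<^sub>m Suc k) $$ (i,j) = (\<Sum>l<n. ?P $$ (i,l) * A $$ (l,j))" if "i < n" "j < n" for i j
      unfolding pow_mat.simps by (rule index_mult_sum[OF P A(1) that])
    have nn: "0 \<le> ?P $$ (i,l) * A $$ (l,j)" if "i < n" "j < n" "l < n" for i j l using Suc An that by simp
    have pos: "0 < (A ^\<^sub>m Suc k) $$ (i,j)" if "i < n" "j < n" "l < n" "0 < ?P $$ (i,l)" "0 < A $$ (l,j)" for i j l
    proof -
      have "0 < ?P $$ (i,l) * A $$ (l,j)" using that by simp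
      also have "\<dots> \<le> (\<Sum>l<n. ?P $$ (i,l) * A $$ (l,j))" using that nn by (intro member_le_sum) auto
      finally show ?thesis using e that by simp
    qed
    show ?case
    proof (intro conjI allI impI)
      show "0 \<le> (A ^\<^sub>m Suc k) $$ (i,j)" if "i < n" "j < n" for i j
        unfolding e[OF that] using nn that by (intro sum_nonneg) auto
      show "\<exists>j<n. 0 < (A ^\<^sub>m Suc k) $$ (i,j)" if i: "i < n" for i
      proof -
        obtain q where q: "q < n" "0 < ?P $$ (i,q)" using Suc i by blast
        obtain j where "j < n" "0 < A $$ (q,j)" using rows[OF q(1)] by blast
        then show ?thesis using pos[OF i _ q(1) q(2)] by blast
      qed
      show "\<exists>i<n. 0 < (A ^\<^sub>m Suc k) $$ (i,j)" if j: "j < n" for j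
      proof -
        obtain q where q: "q < n" "0 < A $$ (q,j)" using cols[OF j] by blast
        obtain i where "i < n" "0 < ?P $$ (i,q)" using Suc q(1) by blast
        then show ?thesis using pos[OF _ j q(1) _ q(2)] by blast
      qed
    qed
  qed (use A in auto)
  obtain M x y where M: "A ^\<^sub>m M = rank1 n x y" using A(3) unfolding rank1_powers_def by blast
  have "pos_mat (A ^\<^sub>m M)"
  proof (rule pos_matI[of _ n n])
    fix i j assume ij: "i < n" "j < n"
    obtain q where q: "q < n" "0 < (A ^\<^sub>m M) $$ (i,q)" using P[of M] ij(1) by blast
    obtain r where r: "r < n" "0 < (A ^\<^sub>m M) $$ (r,j)" using P[of M] ij(2) by blast
    have "x i \<noteq> 0" "y j \<noteq> 0" using q r ij unfolding M by auto
    then show "0 < (A ^\<^sub>m M) $$ (i,j)" using P[of M] ij unfolding M by (simp add: order_less_le)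
  qed (use A in simp)
  then show ?thesis by blast
qed

lemma irreducible_of_pos_power:
  assumes A: "A \<in> carrier_mat n n" "mat_over Uplus A" and p: "pos_mat (A ^\<^sub>m k)"
  shows "irreducible_mat n A"
  unfolding irreducible_mat_def
proof (intro allI impI)
  fix Z assume Z: "Z \<noteq> {}" "Z \<subset> {..<n}"
  have An: "0 \<le> A $$ (i,j)" if "i < n" "j < n" for i j using A that by (auto simp: over_Uplus_iff)
  show "\<exists>x\<in>Z. \<exists>y\<in>{..<n} - Z. 0 < A $$ (x,y)"
  proof (rule ccontr)
    assume c: "\<not> ?thesis"
    have z: "A $$ (x,y) = 0" if "x \<in> Z" "y \<in> {..<n} - Z" for x y
      using c An[of x y] that Z(2) by (auto simp: not_less order_antisym)
    have "(A ^\<^sub>m m) $$ (x,y) = 0" if "x \<in> Z" "y \<in> {..<n} - Z" for x y m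
      using that
    proof (induction m arbitrary: y)
      case 0
      then have "x < n" "y < n" "x \<noteq> y" using Z by auto
      then show ?case using A(1) by simp
    next
      case (Suc m)
      have "(A ^\<^sub>m m) $$ (x,l) * A $$ (l,y) = 0" if "l < n" for l
        using z[of l y] Suc.IH[OF Suc.prems(1), of l] Suc.prems that by (cases "l \<in> Z") auto
      then have "(\<Sum>l<n. (A ^\<^sub>m m) $$ (x,l) * A $$ (l,y)) = 0" by (intro sum.neutral) blast
      then show ?case unfolding pow_mat.simps using Suc.prems Z(2) A(1)
        by (subst index_mult_sum[of _ n n _ n]) auto
    qed
    moreover obtain x y where "x \<in> Z" "y \<in> {..<n} - Z" using Z by blast
    moreover have "0 < (A ^\<^sub>m k) $$ (x,y)" using calculation(2,3) Z(2) A(1) by (intro pos_matD[OF p, of n n]) auto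
    ultimately show False by simp
  qed
qed

lemma sse_to_positive:
  assumes n0: "0 < n" and A: "A \<in> carrier_mat n n" "mat_over Uplus A" "rank1_powers n A l"
  shows "\<exists>m B. 0 < m \<and> sse Uplus A B \<and> B \<in> carrier_mat m m \<and> mat_over Uplus B \<and> pos_mat B"
proof -
  obtain m B where B: "0 < m" "sse Uplus A B" "B \<in> carrier_mat m m" "mat_over Uplus B" "rank1_powers m B l"
    "\<And>i. i < m \<Longrightarrow> \<exists>j<m. 0 < B $$ (i,j)" "\<And>j. j < m \<Longrightarrow> \<exists>i<m. 0 < B $$ (i,j)"
    using delete_zero_lines[OF n0 A] by blast
  obtain k where "pos_mat (B ^\<^sub>m k)" using trimmed_power_pos[OF B(3-7)] by blast
  then have irr: "irreducible_mat m B" by (rule irreducible_of_pos_power[OF B(3,4)])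
  have "\<exists>v<m. 0 < B $$ (v,v)"
  proof (rule ccontr)
    assume "\<not> ?thesis"
    then have "B $$ (i,i) \<le> 0" if "i < m" for i using that by (meson not_le)
    then have "(\<Sum>i<m. B $$ (i,i)) \<le> 0" by (intro sum_nonpos) auto
    moreover have "0 < l" using B(5) unfolding rank1_powers_def by auto
    ultimately show False using rank1_powers_trace[OF B(5)] by simp
  qed
  then obtain v where "v < m" "0 < B $$ (v,v)" by blast
  then obtain q C w where C: "0 < q" "sse Uplus B C" "C \<in> carrier_mat q q" "mat_over Uplus C" "irreducible_mat q C"
    "w < q" "\<And>i. i < q \<Longrightarrow> 0 < C $$ (i,w)"
    using split_to_positive_column[OF B(1,3,4) irr] by blast
  obtain E where "sse Uplus C E" "E \<in> carrier_mat q q" "mat_over Uplus E" "pos_mat E"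
    using fill_from_positive_column[OF C(1,3-7)] by blast
  then show ?thesis using B(2) C(1,2) sse_trans by metis
qed

end

section \<open>Eventually rank one nonnegative matrices\<close>

lemma rank_eq_one_outer:
  assumes M: "(M::real mat) \<in> carrier_mat n n" and r: "vec_space.rank n M = 1"
  shows "\<exists>x y. M = rank1 n x y" and "M \<noteq> 0\<^sub>m n n"
proof -
  interpret V: vec_space "TYPE(real)" n .
  show "M \<noteq> 0\<^sub>m n n" using r V.rank_0I by (metis zero_neq_one)
  let ?C = "set (cols M)"
  have C: "?C \<subseteq> carrier_vec n" using cols_dim M by blast
  have "\<exists>S. finite S \<and> maximal S (\<lambda>T. T \<subseteq> ?C \<and> V.lin_indpt T) \<and> {} \<subseteq> S"
    by (rule maximal_exists_superset[of ?C]) (auto simp: V.lin_dep_def)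
  then obtain S where S: "maximal S (\<lambda>T. T \<subseteq> ?C \<and> V.lin_indpt T)" by blast
  then have SC: "S \<subseteq> ?C" "V.lin_indpt S" unfolding maximal_def by auto
  have "card S = 1" using V.rank_card_indpt[OF M S] r by simp
  then obtain v where v: "S = {v}" by (rule card_1_singletonE)
  have vc: "v \<in> carrier_vec n" using SC C v by auto
  have span: "V.span {v} \<subseteq> {a \<cdot>\<^sub>v v |a. True}"
  proof -
    have "V.lincomb a {v} = a v \<cdot>\<^sub>v v" for a
      using V.lincomb_insert2[of "{}" a v] vc by (auto simp: Pi_def)
    then show ?thesis using V.finite_span[of "{v}"] vc by (auto simp: Pi_def)
  qed
  have col: "\<exists>a. col M j = a \<cdot>\<^sub>v v" if "j < n" for j
  proof -
    have cj: "col M j \<in> ?C" using that M by (auto simp: cols_def)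
    have "col M j \<in> V.span S"
    proof (rule ccontr)
      assume c: "col M j \<notin> V.span S"
      have "col M j \<notin> S" using c V.span_mem[of S "col M j"] SC(1) C by auto
      then have "V.lin_indpt (S \<union> {col M j})"
        using V.lin_dep_iff_in_span[of S "col M j"] SC C cj c by auto
      then have "S \<union> {col M j} = S" using S SC(1) cj unfolding maximal_def by blast
      then show False using \<open>col M j \<notin> S\<close> by auto
    qed
    then show ?thesis using span unfolding v by auto
  qed
  then obtain y where y: "\<And>j. j < n \<Longrightarrow> col M j = y j \<cdot>\<^sub>v v" by metis
  have "M = rank1 n (\<lambda>i. v $ i) y"
  proof (rule eq_matI)
    fix i j assume "i < dim_row (rank1 n (\<lambda>i. v $ i) y)" "j < dim_col (rank1 n (\<lambda>i. v $ i) y)"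
    then have ij: "i < n" "j < n" by auto
    have "M $$ (i,j) = col M j $ i" using ij M by simp
    also have "\<dots> = y j * v $ i" using y[OF ij(2)] vc ij by simp
    finally show "M $$ (i,j) = rank1 n (\<lambda>i. v $ i) y $$ (i,j)" using ij by simp
  qed (use M in auto)
  then show "\<exists>x y. M = rank1 n x y" by blast
qed

text \<open>
  Let \<open>P\<close> be a power of rank one. As \<open>P * P\<close> does not vanish, it is a nonzero multiple of \<open>P\<close>; and
  \<open>P * (A * P)\<close> is a multiple of \<open>P\<close>, so that \<open>P * A\<close> is one too. Nonnegativity of the powers makes the
  factor \<open>l\<close> positive.
\<close>

lemma rank1_powers_of_eventually_rank_one:
  assumes A: "A \<in> carrier_mat n n" and nn: "mat_over {0..} A" and r: "eventually_rank_one A"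
  shows "\<exists>l. rank1_powers n A l"
proof -
  have An: "0 \<le> A $$ (i,j)" if "i < n" "j < n" for i j using nn A that by (auto simp: mat_over_iff)
  obtain K where K: "\<And>k. k \<ge> K \<Longrightarrow> vec_space.rank n (A ^\<^sub>m k) = 1"
    using r A unfolding eventually_rank_one_def eventually_sequentially by auto
  have Pc: "A ^\<^sub>m k \<in> carrier_mat n n" for k using A by simp
  obtain x y where xy: "A ^\<^sub>m K = rank1 n x y" using rank_eq_one_outer(1)[OF Pc K] by blast
  define P where "P = A ^\<^sub>m K"
  have P: "P \<in> carrier_mat n n" unfolding P_def by (rule Pc)
  define m where "m = (\<Sum>i<n. y i * x i)"
  have PP: "P * P = m \<cdot>\<^sub>m P" unfolding P_def xy m_def by (rule rank1_mult_rank1)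
  have "P * P \<noteq> 0\<^sub>m n n"
    using rank_eq_one_outer(2)[OF Pc K, of "K + K"] pow_mat_add[OF A, of K K] unfolding P_def by simp
  then have m0: "m \<noteq> 0" unfolding PP using P by auto
  have P0: "P \<noteq> 0\<^sub>m n n" using rank_eq_one_outer(2)[OF Pc K, of K] unfolding P_def by simp
  have comm: "P * A = A * P" using pow_mat_add[OF A, of K 1] pow_mat_add[OF A, of 1 K] A
    unfolding P_def by (simp add: add.commute)
  define b where "b = (\<Sum>i<n. \<Sum>j<n. y i * A $$ (i,j) * x j)"
  have PAP: "P * (A * P) = b \<cdot>\<^sub>m P"
  proof -
    have "A * P = rank1 n (\<lambda>i. \<Sum>j<n. A $$ (i,j) * x j) y" unfolding P_def xy by (rule mult_rank1[OF A])
    then show ?thesis unfolding P_def xy b_def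
      by (simp add: rank1_mult_rank1 sum_distrib_left mult.assoc)
  qed
  define l where "l = b / m"
  have PA: "P * A = l \<cdot>\<^sub>m P"
  proof -
    have "m \<cdot>\<^sub>m (P * A) = P * P * A" unfolding PP by (rule mult_smult_assoc_mat[symmetric, OF P A])
    also have "\<dots> = P * (A * P)" using assoc_mult_mat[OF P P A] comm by simp
    finally have e: "m \<cdot>\<^sub>m (P * A) = b \<cdot>\<^sub>m P" unfolding PAP .
    show ?thesis
    proof (rule eq_matI)
      fix i j assume "i < dim_row (l \<cdot>\<^sub>m P)" "j < dim_col (l \<cdot>\<^sub>m P)"
      then have ij: "i < n" "j < n" using P by auto
      have PAc: "P * A \<in> carrier_mat n n" using P A by simp
      have "(m \<cdot>\<^sub>m (P * A)) $$ (i,j) = (b \<cdot>\<^sub>m P) $$ (i,j)" using e by simp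
      then have "m * (P * A) $$ (i,j) = b * P $$ (i,j)"
        using ij carrier_matD[OF P] carrier_matD[OF PAc] by (simp del: index_mult_mat(1))
      then show "(P * A) $$ (i,j) = (l \<cdot>\<^sub>m P) $$ (i,j)"
        using ij P m0 by (simp add: l_def field_simps del: index_mult_mat(1))
    qed (use P A in auto)
  qed
  have PAS: "A ^\<^sub>m Suc K = l \<cdot>\<^sub>m A ^\<^sub>m K" using PA unfolding P_def by simp
  have l0: "l \<noteq> 0"
  proof
    assume "l = 0"
    then have "A ^\<^sub>m Suc K = 0\<^sub>m n n" unfolding PAS using carrier_matD[OF Pc[of K]] by (intro eq_matI) auto
    then show False using rank_eq_one_outer(2)[OF Pc K, of "Suc K"] by simp
  qed
  have Pn: "0 \<le> (A ^\<^sub>m k) $$ (i,j)" if "i < n" "j < n" for i j k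
    using that
  proof (induction k arbitrary: j)
    case (Suc k)
    have "(A ^\<^sub>m Suc k) $$ (i,j) = (\<Sum>q<n. (A ^\<^sub>m k) $$ (i,q) * A $$ (q,j))"
      unfolding pow_mat.simps by (rule index_mult_sum[OF Pc A]) (use Suc.prems in auto)
    then show ?case using Suc An by (auto intro!: sum_nonneg)
  qed (use A in auto)
  obtain i j where ij: "i < n" "j < n" "P $$ (i,j) \<noteq> 0"
    using P0 P by (metis carrier_matD eq_matI index_zero_mat)
  then have "0 < P $$ (i,j)" using Pn[of i j K] unfolding P_def by (simp add: order_less_le)
  moreover have "0 \<le> l * P $$ (i,j)"
    using Pn[OF ij(1,2), of "Suc K"] unfolding PAS using ij carrier_matD[OF Pc[of K]] by (simp add: P_def)
  ultimately have "0 < l" using l0 by (simp add: zero_le_mult_iff)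
  then show ?thesis unfolding rank1_powers_def using A xy PAS P0 P_def by blast
qed

lemma rank1_powers_sse:
  assumes "sse S A B" "A \<in> carrier_mat n n" "rank1_powers n A l" "B \<in> carrier_mat m m"
  shows "rank1_powers m B l"
proof -
  have "\<exists>k. B \<in> carrier_mat k k \<and> rank1_powers k B l"
    using assms(1)
  proof (induction rule: rtranclp_induct)
    case (step B C)
    then obtain k where k: "B \<in> carrier_mat k k" "rank1_powers k B l" by blast
    obtain p q R T where e: "R \<in> carrier_mat p q" "T \<in> carrier_mat q p" "B = R * T" "C = T * R"
      using step.hyps unfolding elementary_sse_def by blast
    have "p = k" using e k(1) by auto
    then show ?case using rank1_powers_swap[OF e(2,1)] k(2) e by (intro exI[of _ q]) auto
  qed (use assms in blast)
  then show ?thesis using assms(4) by auto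
qed

lemma sse_mono: "sse S A B \<Longrightarrow> S \<subseteq> S' \<Longrightarrow> sse S' A B"
proof (induction rule: rtranclp_induct)
  case (step B C)
  then have "elementary_sse S' B C" unfolding elementary_sse_def using mat_over_mono[of S _ S'] by blast
  then show ?case using step by (simp add: rtranclp.rtrancl_into_rtrancl)
qed simp

theorem theorem6p4:
  fixes U :: "real set" and A B :: "real mat"
  assumes "nondiscrete_unital_subring U"
    and "mat_over {0..} A" and "eventually_rank_one A"
    and "mat_over {0..} B" and "eventually_rank_one B"
    and "strong_shift_equivalent_over U A B"
  shows "strong_shift_equivalent_over (U \<inter> {0..}) A B"
proof -
  interpret dense_ring U by unfold_locales (rule assms(1))
  obtain l As where ends: "As (0::nat) = A" "As l = B"
    and sq: "\<forall>i\<le>l. square_mat (As i) \<and> 0 < dim_row (As i) \<and> mat_over U (As i)"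
    using assms(6) unfolding strong_shift_equivalent_over_def by blast
  define n m where "n = dim_row A" and "m = dim_row B"
  have A: "A \<in> carrier_mat n n" "0 < n" "mat_over U A" and B: "B \<in> carrier_mat m m" "0 < m" "mat_over U B"
    using sq[rule_format, of 0] sq[rule_format, of l] ends unfolding n_def m_def by auto
  have Ap: "mat_over Uplus A" and Bp: "mat_over Uplus B"
    using A(3) B(3) assms(2,4) unfolding mat_over_def by auto
  obtain a b where ra: "rank1_powers n A a" and rb: "rank1_powers m B b"
    using rank1_powers_of_eventually_rank_one[OF A(1) assms(2,3)]
      rank1_powers_of_eventually_rank_one[OF B(1) assms(4,5)] by blast
  obtain p P where P: "0 < p" "sse Uplus A P" "P \<in> carrier_mat p p" "mat_over Uplus P" "pos_mat P"
    using sse_to_positive[OF A(2,1) Ap ra] by blast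
  obtain q Q where Q: "0 < q" "sse Uplus B Q" "Q \<in> carrier_mat q q" "mat_over Uplus Q" "pos_mat Q"
    using sse_to_positive[OF B(2,1) Bp rb] by blast
  have "sse U P Q"
    using sse_mono[OF sse_sym[OF P(2)], of U] sse_of_strong_shift_equivalent_over[OF assms(6)]
      sse_mono[OF Q(2), of U] sse_trans[of U] by (meson Int_lower1)
  moreover have "rank1_powers p P a" by (rule rank1_powers_sse[OF P(2) A(1) ra P(3)])
  ultimately have "sse Uplus P Q"
    using sse_positive[OF P(1,3) over_Uplus[OF P(4)] P(5) _ _ Q(3,5)] by blast
  then have "sse Uplus A B" using P(2) sse_sym[OF Q(2)] sse_trans by metis
  then show ?thesis by (rule strong_shift_equivalent_over_of_sse[OF _ semiring_Uplus A(1,2) Ap])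
qed

end
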